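(* Let $K$ be a number field which is a normal (Galois) extension of $\mathbb{Q}$ of degree $N=[K:\mathbb{Q}]\ge 2$, let $M\ge 2$, and let $(a_m,b_m)\in\mathbb{Z}^+\times\mathbb{Z}$ for $m=1,\dots,M$ satisfy $$\prod_{m,k=1,\ m\ne k}^{M}(a_m b_k-a_k b_m)\ne 0 .$$ Then for large real $x$, $$S(x):=\sum_{1\le n\le x}\ \prod_{m=1}^M \mathbf{b}_K(a_m n+b_m)\ \ll\ \gamma(a_1,b_1,\dots,a_M,b_M)\,\frac{x}{(\log x)^{M(1-1/N)}},$$ where $$\gamma(a_1,b_1,\dots,a_M,b_M)=\prod_{p\in\mathbb{P}'}\Bigl(1+\frac{M}{p}\Bigr),$$ and the implied constant depends only on $M$ and $K$ (not on $a_1,b_1,\dots,a_M,b_M$).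
   Context: $\mathcal{O}_K$ denotes the ring of integers of $K$. For an integer $n$, $\mathbf{b}_K(n)=1$ if $n$ is a positive integer and there exists a nonzero integral ideal $\mathfrak{A}$ of $\mathcal{O}_K$ with norm $\mathcal{N}(\mathfrak{A})=n$, and $\mathbf{b}_K(n)=0$ otherwise. $p$ always denotes a rational prime and $\mathbb{P}$ is the set of rational primes. For each divisor $r$ of $N$, $\mathbb{P}_r$ is the set of primes $p$ not dividing the discriminant of $K$ such that $p\mathcal{O}_K=\mathfrak{P}_1\cdots\mathfrak{P}_{N/r}$ with distinct prime ideals $\mathfrak{P}_i$ each of norm $p^r$. The finite set $\mathbb{P}'$ is defined by $$\mathbb{P}'=\Bigl\{p\in\bigcup_{r\mid N,\ r>1}\mathbb{P}_r:\ p \text{ divides } \prod_{m=1}^M a_m\prod_{m,k=1,\,m\ne k}^M(a_mb_k-a_kb_m)\Bigr\}.$$ *)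

theory Defs
  imports Complex_Main "HOL-Computational_Algebra.Computational_Algebra"
    "HOL-Combinatorics.Permutations"
begin

definition subfield_C :: "complex set \<Rightarrow> bool" where
  "subfield_C K \<longleftrightarrow> 0 \<in> K \<and> 1 \<in> K \<and> (\<forall>x\<in>K. \<forall>y\<in>K. x + y \<in> K \<and> x * y \<in> K)
     \<and> (\<forall>x\<in>K. - x \<in> K \<and> (x \<noteq> 0 \<longrightarrow> inverse x \<in> K))"

definition rat_basis :: "complex set \<Rightarrow> complex list \<Rightarrow> bool" where
  "rat_basis K ws \<longleftrightarrow> set ws \<subseteq> K
     \<and> (\<forall>c::nat \<Rightarrow> rat. (\<Sum>i<length ws. of_rat (c i) * ws ! i) = 0 \<longrightarrow> (\<forall>i<length ws. c i = 0))
     \<and> (\<forall>x\<in>K. \<exists>c::nat \<Rightarrow> rat. x = (\<Sum>i<length ws. of_rat (c i) * ws ! i))"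

definition number_field :: "complex set \<Rightarrow> bool" where
  "number_field K \<longleftrightarrow> subfield_C K \<and> (\<exists>ws. rat_basis K ws)"

definition field_degree :: "complex set \<Rightarrow> nat" where
  "field_degree K = length (SOME ws. rat_basis K ws)"

text \<open>Normality: every irreducible rational polynomial with a root in K splits in K
  (equivalently, all of its complex roots lie in K).\<close>
definition normal_ext :: "complex set \<Rightarrow> bool" where
  "normal_ext K \<longleftrightarrow> (\<forall>p :: rat poly. irreducible p \<longrightarrow>
      (\<exists>x\<in>K. poly (map_poly of_rat p) x = 0) \<longrightarrow>
      (\<forall>z. poly (map_poly of_rat p) z = 0 \<longrightarrow> z \<in> K))"

definition ring_of_integers :: "complex set \<Rightarrow> complex set" where
  "ring_of_integers K = {x \<in> K. algebraic_int x}"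

definition integral_basis :: "complex set \<Rightarrow> complex list \<Rightarrow> bool" where
  "integral_basis K ws \<longleftrightarrow> set ws \<subseteq> ring_of_integers K
     \<and> (\<forall>c::nat \<Rightarrow> int. (\<Sum>i<length ws. of_int (c i) * ws ! i) = 0 \<longrightarrow> (\<forall>i<length ws. c i = 0))
     \<and> (\<forall>x\<in>ring_of_integers K. \<exists>c::nat \<Rightarrow> int. x = (\<Sum>i<length ws. of_int (c i) * ws ! i))"

definition embeddings :: "complex set \<Rightarrow> (complex \<Rightarrow> complex) set" where
  "embeddings K = {\<sigma>. \<sigma> 1 = 1 \<and> (\<forall>x\<in>K. \<forall>y\<in>K. \<sigma> (x + y) = \<sigma> x + \<sigma> y \<and> \<sigma> (x * y) = \<sigma> x * \<sigma> y)
                      \<and> (\<forall>x. x \<notin> K \<longrightarrow> \<sigma> x = 0)}"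

definition field_trace :: "complex set \<Rightarrow> complex \<Rightarrow> complex" where
  "field_trace K \<alpha> = (\<Sum>\<sigma>\<in>embeddings K. \<sigma> \<alpha>)"

text \<open>Discriminant: determinant (Leibniz formula) of the trace form on an integral basis.\<close>
definition discriminant_C :: "complex set \<Rightarrow> complex" where
  "discriminant_C K = (let ws = (SOME ws. integral_basis K ws); n = length ws in
     (\<Sum>\<pi> | \<pi> permutes {..<n}. of_int (sign \<pi>) *
        (\<Prod>i<n. field_trace K (ws ! i * ws ! (\<pi> i)))))"

definition discriminant :: "complex set \<Rightarrow> int" where
  "discriminant K = (THE d::int. of_int d = discriminant_C K)"

definition is_ideal :: "complex set \<Rightarrow> complex set \<Rightarrow> bool" where
  "is_ideal K A \<longleftrightarrow> A \<subseteq> ring_of_integers K \<and> 0 \<in> A \<and> (\<forall>x\<in>A. \<forall>y\<in>A. x + y \<in> A)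
     \<and> (\<forall>x\<in>A. \<forall>r\<in>ring_of_integers K. r * x \<in> A)"

definition ideal_norm :: "complex set \<Rightarrow> complex set \<Rightarrow> nat" where
  "ideal_norm K A = card ((\<lambda>x. {y \<in> ring_of_integers K. x - y \<in> A}) ` ring_of_integers K)"

definition prime_ideal :: "complex set \<Rightarrow> complex set \<Rightarrow> bool" where
  "prime_ideal K P \<longleftrightarrow> is_ideal K P \<and> P \<noteq> ring_of_integers K
     \<and> (\<forall>x\<in>ring_of_integers K. \<forall>y\<in>ring_of_integers K. x * y \<in> P \<longrightarrow> x \<in> P \<or> y \<in> P)"

definition ideal_mult :: "complex set \<Rightarrow> complex set \<Rightarrow> complex set" where
  "ideal_mult A B = {z. \<exists>xs ys. set xs \<subseteq> A \<and> set ys \<subseteq> B \<and> length xs = length ys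
                        \<and> z = sum_list (map2 (*) xs ys)}"

definition ideal_prod_list :: "complex set \<Rightarrow> complex set list \<Rightarrow> complex set" where
  "ideal_prod_list K Ps = foldr ideal_mult Ps (ring_of_integers K)"

definition principal_nat :: "complex set \<Rightarrow> nat \<Rightarrow> complex set" where
  "principal_nat K p = {of_nat p * x | x. x \<in> ring_of_integers K}"

definition bK :: "complex set \<Rightarrow> int \<Rightarrow> nat" where
  "bK K n = (if n > 0 \<and> (\<exists>A. is_ideal K A \<and> A \<noteq> {0} \<and> int (ideal_norm K A) = n) then 1 else 0)"

definition primes_split :: "complex set \<Rightarrow> nat \<Rightarrow> nat set" where
  "primes_split K r = {p. prime p \<and> \<not> int p dvd discriminant K \<and>
     (\<exists>Ps. length Ps = field_degree K div r \<and> distinct Ps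
        \<and> (\<forall>P\<in>set Ps. prime_ideal K P \<and> ideal_norm K P = p ^ r)
        \<and> ideal_prod_list K Ps = principal_nat K p)}"

definition cross_prod :: "nat \<Rightarrow> (nat \<Rightarrow> int) \<Rightarrow> (nat \<Rightarrow> int) \<Rightarrow> int" where
  "cross_prod M a b = (\<Prod>m\<in>{1..M}. \<Prod>k\<in>{1..M} - {m}. a m * b k - a k * b m)"

definition exc_primes :: "complex set \<Rightarrow> nat \<Rightarrow> (nat \<Rightarrow> int) \<Rightarrow> (nat \<Rightarrow> int) \<Rightarrow> nat set" where
  "exc_primes K M a b = {p \<in> (\<Union>r \<in> {r. r dvd field_degree K \<and> r > 1}. primes_split K r).
       int p dvd ((\<Prod>m\<in>{1..M}. a m) * cross_prod M a b)}"

definition gamma_fac :: "complex set \<Rightarrow> nat \<Rightarrow> (nat \<Rightarrow> int) \<Rightarrow> (nat \<Rightarrow> int) \<Rightarrow> real" where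
  "gamma_fac K M a b = (\<Prod>p\<in>exc_primes K M a b. 1 + real M / real p)"

definition S_sum :: "complex set \<Rightarrow> nat \<Rightarrow> (nat \<Rightarrow> int) \<Rightarrow> (nat \<Rightarrow> int) \<Rightarrow> real \<Rightarrow> real" where
  "S_sum K M a b x = (\<Sum>n\<in>{1..nat \<lfloor>x\<rfloor>}. \<Prod>m\<in>{1..M}. real (bK K (a m * int n + b m)))"

end

theory Submission
  imports Defs "HOL-Number_Theory.Cong" "Jordan_Normal_Form.Char_Poly"
begin

text \<open>If \<open>p\<close> does not divide the discriminant, all primes of \<open>K\<close> above \<open>p\<close> are conjugate of norm
  \<open>p ^ r\<close>, and for \<open>r > 1\<close> no ideal norm is exactly divisible by \<open>p\<close>. So the integers counted by
  \<open>S\<close> avoid, for every such \<open>p\<close>, the roughly \<open>M p\<close> residues modulo \<open>p\<^sup>2\<close> at which some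
  \<open>a m * n + b m\<close> is exactly divisible by \<open>p\<close>, and an upper bound sieve applies. Its quality is
  governed by the sum of \<open>1 / p\<close> over the primes with \<open>r > 1\<close>, which is at least
  \<open>(1 - 1 / N) ln ln z - O(1)\<close> as soon as the completely split primes satisfy
  \<open>\<Sum> ln p / p \<le> (ln z) / N + O(1)\<close>. The latter is obtained without the Dedekind zeta function, by
  comparing two estimates of the product of the norms of all differences of points in a box of
  algebraic integers.\<close>

section \<open>Sums over primes\<close>

text \<open>An upper bound for the split primes suffices because the sieving primes are the
  complement: the lower Mertens bound for all primes minus the upper bound for the split ones leaves
  (1 - 1/N) ln ln z. The 1/N is visible in the box: it holds B^N integers whose conjugates are O(B),
  so the primes up to X = B^N are weighed against ln B = (ln X) / N. The modulus p^2 is forced,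
  because p^2 may well divide a norm; the residues where it divides a form lower the density from
  M/p to M/p - M/p^2, a convergent loss. Primes dividing some a_m or some a_m b_k - a_k b_m need not
  have this density. They are left out of the sieve, and the lost factor exp(M sum 1/p) over them is
  what gamma pays for. Uniformity holds because the sieve sees the a_m and b_m only through the
  number of excluded residues: its error term and the threshold for x depend on M alone. From the
  field come these facts: the discriminant is nonzero, the primes over p are conjugate, p O_K is
  their intersection for p prime to the discriminant, and a norm exactly divisible by p yields a
  prime ideal of norm p.\<close>

lemma prime_gt_1_real: "prime (p::nat) \<Longrightarrow> real p > 1"
  using prime_gt_1_nat by force

lemma finite_primes_le [simp]: "finite {p::nat. prime p \<and> p \<le> n}"
  by (rule finite_subset[of _ "{..n}"]) auto

text \<open>Powers of distinct primes are coprime. The lemma turns separate divisibilities into one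
  inequality of sizes; the exponent may vary with p, as it does for factorials and for norms of
  differences in a box.\<close>

lemma prod_primes_dvd:
  fixes n :: nat and A :: "nat set"
  assumes "finite A" "\<And>p. p \<in> A \<Longrightarrow> prime p" "\<And>p. p \<in> A \<Longrightarrow> p ^ e p dvd n"
  shows "(\<Prod>p\<in>A. p ^ e p) dvd n"
  using assms
proof (induction A rule: finite_induct)
  case (insert q A)
  have "coprime (q ^ e q) (\<Prod>p\<in>A. p ^ e p)"
  proof (rule prod_coprime_right)
    fix p assume "p \<in> A"
    then have "coprime q p" using insert by (intro primes_coprime) auto
    then show "coprime (q ^ e q) (p ^ e p)" by simp
  qed
  with insert show ?case by (simp add: divides_mult)
qed auto

section \<open>Chebyshev's upper bound and the upper half of Mertens' first theorem\<close>

text \<open>The two equal middle coefficients both occur in a row with sum 2 * 4 ^ m.\<close>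

lemma central_binomial_odd_le: "(2 * m + 1) choose m \<le> (4::nat) ^ m"
proof -
  have "((2 * m + 1) choose m) + ((2 * m + 1) choose (m + 1)) \<le> (\<Sum>k\<le>2*m+1. (2*m+1) choose k)"
    using sum_mono2[of "{..2*m+1}" "{m, m+1}" "\<lambda>k. (2*m+1) choose k"] by simp
  also have "\<dots> = 2 ^ (2 * m + 1)" by (rule choose_row_sum)
  also have "\<dots> = 2 * 4 ^ m" by (simp add: power_mult)
  finally show ?thesis
    using binomial_symmetric[of m "2*m+1"] by simp
qed

text \<open>Erdos's induction. An even n > 2 is not prime; for n = 2 m + 1 the primes in (m + 1, n]
  all divide the binomial coefficient n over m, which is at most 4 ^ m, and the primes up to m + 1
  fall under the induction hypothesis.\<close>

lemma prod_primes_le_4_power: "(\<Prod>p\<in>{p::nat. prime p \<and> p \<le> n}. p) \<le> 4 ^ n"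
proof (induction n rule: less_induct)
  case (less n)
  consider "n < 2" | "n = 2" | "n > 2" "even n" | "n > 2" "odd n" by linarith
  then show ?case
  proof cases
    case 1
    then have "{p::nat. prime p \<and> p \<le> n} = {}" by (auto dest: prime_ge_2_nat)
    then show ?thesis by (simp only: prod.empty one_le_power)
  next
    case 2
    then have "{p::nat. prime p \<and> p \<le> n} = {2}" by (auto dest: prime_ge_2_nat)
    then show ?thesis using 2 by (simp only:) simp
  next
    case 3
    then have "\<not> prime n" using prime_odd_nat by blast
    then have "{p::nat. prime p \<and> p \<le> n} = {p. prime p \<and> p \<le> n - 1}"
      using 3 by (auto simp: le_eq_less_or_eq)
    moreover have "(\<Prod>p\<in>{p::nat. prime p \<and> p \<le> n-1}. p) \<le> 4 ^ (n - 1)" using less 3 by simp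
    moreover have "(4::nat) ^ (n-1) \<le> 4 ^ n" by (simp add: power_increasing)
    ultimately show ?thesis by (metis (no_types, lifting) order.trans)
  next
    case 4
    then obtain m where m: "n = 2 * m + 1" "m \<ge> 1" by (auto elim!: oddE)
    let ?A = "{p::nat. prime p \<and> m + 1 < p \<and> p \<le> n}"
    have fin: "finite ?A" by (rule finite_subset[of _ "{..n}"]) auto
    have "{p::nat. prime p \<and> p \<le> n} = {p. prime p \<and> p \<le> m + 1} \<union> ?A" using m by auto
    then have eq: "(\<Prod>p\<in>{p::nat. prime p \<and> p \<le> n}. p)
        = (\<Prod>p\<in>{p. prime p \<and> p \<le> m + 1}. p) * (\<Prod>p\<in>?A. p)"
      using fin by (simp only:) (subst prod.union_disjoint, auto)
    have "(\<Prod>p\<in>?A. p ^ 1) dvd (2*m+1) choose m"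
    proof (rule prod_primes_dvd[OF fin])
      fix p assume p: "p \<in> ?A"
      have "((2*m+1) choose m) * (fact m * fact (m+1)) = fact (2*m+1)"
        using binomial_fact_lemma[of m "2*m+1"] by (simp add: algebra_simps)
      moreover have "p dvd fact (2*m+1)" using p m by (simp add: prime_dvd_fact_iff del: fact_Suc)
      moreover have "\<not> p dvd fact m" "\<not> p dvd fact (m+1)"
        using p by (simp_all add: prime_dvd_fact_iff del: fact_Suc)
      ultimately show "p ^ 1 dvd (2*m+1) choose m"
        using p by (metis (mono_tags, lifting) mem_Collect_eq power_one_right prime_dvd_multD)
    qed auto
    then have "(\<Prod>p\<in>?A. p) \<le> (2*m+1) choose m" by (intro dvd_imp_le) auto
    also have "\<dots> \<le> 4 ^ m" by (rule central_binomial_odd_le)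
    finally have "(\<Prod>p\<in>?A. p) \<le> 4 ^ m" .
    moreover have "(\<Prod>p\<in>{p. prime p \<and> p \<le> m + 1}. p) \<le> 4 ^ (m + 1)"
      using less.IH[of "m+1"] m by simp
    ultimately have "(\<Prod>p\<in>{p::nat. prime p \<and> p \<le> n}. p) \<le> 4 ^ (m+1) * 4 ^ m"
      unfolding eq by (intro mult_mono) auto
    then show ?thesis by (simp add: m(1) mult_2 power_add)
  qed
qed

lemma sum_ln_primes_le: "(\<Sum>p\<in>{p::nat. prime p \<and> p \<le> n}. ln (real p)) \<le> real n * ln 4"
proof -
  have pos: "(\<Prod>p\<in>{p::nat. prime p \<and> p \<le> n}. real p) > 0"
    by (intro prod_pos) (auto simp: prime_gt_0_nat)
  have "(\<Sum>p\<in>{p::nat. prime p \<and> p \<le> n}. ln (real p)) = ln (\<Prod>p\<in>{p::nat. prime p \<and> p \<le> n}. real p)"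
    by (subst ln_prod) (auto simp: prime_gt_0_nat)
  also have "\<dots> \<le> ln (4 ^ n)"
  proof -
    have "real (\<Prod>p\<in>{p::nat. prime p \<and> p \<le> n}. p) \<le> real (4 ^ n)"
      using prod_primes_le_4_power of_nat_le_iff by blast
    then have "(\<Prod>p\<in>{p::nat. prime p \<and> p \<le> n}. real p) \<le> 4 ^ n" by simp
    then show ?thesis using pos by (simp add: ln_mono)
  qed
  also have "\<dots> = real n * ln 4" by (simp add: ln_realpow)
  finally show ?thesis .
qed

text \<open>Only one factor p is taken from each multiple of p up to n. The higher powers of p in
  the factorial may be given up, since the factorial is going to be bounded from above.\<close>

lemma prime_power_dvd_fact:
  fixes p n :: nat
  assumes "p > 0"
  shows "p ^ (n div p) dvd fact n"
proof -
  let ?k = "n div p"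
  have inj: "inj_on ((*) p) {1..?k}" using assms by (auto simp: inj_on_def)
  have "(\<Prod>j\<in>{1..?k}. p * j) = (\<Prod>i\<in>(*) p ` {1..?k}. i)"
    using prod.reindex[OF inj, of "\<lambda>i. i"] by (simp add: o_def)
  moreover have "(\<Prod>i\<in>(*) p ` {1..?k}. i) dvd (\<Prod>i\<in>{1..n}. i)"
  proof (rule prod_dvd_prod_subset)
    show "(*) p ` {1..?k} \<subseteq> {1..n}"
      using assms by (auto simp: less_eq_div_iff_mult_less_eq mult.commute)
  qed auto
  moreover have "p ^ ?k dvd (\<Prod>j\<in>{1..?k}. p * j)" by (simp add: prod.distrib)
  ultimately show ?thesis by (metis fact_prod of_nat_id dvd_trans)
qed

text \<open>Compares the prime powers in n! with n! <= n ^ n. Replacing n / p by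
  \<open>n div p\<close> costs at most one ln p for each prime, which Chebyshev's bound pays for
  with n ln 4.\<close>

lemma sum_ln_primes_over_primes_le:
  assumes "n \<ge> 1"
  shows "(\<Sum>p\<in>{p::nat. prime p \<and> p \<le> n}. ln (real p) / real p) \<le> ln (real n) + ln 4"
proof -
  let ?A = "{p::nat. prime p \<and> p \<le> n}"
  have "(\<Prod>p\<in>?A. p ^ (n div p)) dvd fact n"
    by (rule prod_primes_dvd) (auto intro!: prime_power_dvd_fact simp: prime_gt_0_nat)
  then have "(\<Prod>p\<in>?A. p ^ (n div p)) \<le> fact n" by (intro dvd_imp_le) auto
  also have "(fact n :: nat) \<le> n ^ n" using fact_le_power[of n, where ?'a=nat] by simp
  finally have "real (\<Prod>p\<in>?A. p ^ (n div p)) \<le> real (n ^ n)" using of_nat_le_iff by blast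
  then have le: "(\<Prod>p\<in>?A. real p ^ (n div p)) \<le> real n ^ n" by simp
  have pos: "(\<Prod>p\<in>?A. real p ^ (n div p)) > 0"
    by (intro prod_pos) (auto simp: prime_gt_0_nat)
  have "(\<Sum>p\<in>?A. real (n div p) * ln (real p)) = ln (\<Prod>p\<in>?A. real p ^ (n div p))"
    by (subst ln_prod) (auto simp: prime_gt_0_nat ln_realpow)
  also have "\<dots> \<le> ln (real n ^ n)" using le pos by (simp add: ln_mono)
  also have "\<dots> = n * ln n" using assms by (simp add: ln_realpow)
  finally have 1: "(\<Sum>p\<in>?A. real (n div p) * ln (real p)) \<le> n * ln n" .
  have "real n * (\<Sum>p\<in>?A. ln (real p) / real p) = (\<Sum>p\<in>?A. (real n / real p) * ln (real p))"
    by (simp add: sum_distrib_left)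
  also have "\<dots> \<le> (\<Sum>p\<in>?A. (real (n div p) + 1) * ln (real p))"
  proof (rule sum_mono)
    fix p assume "p \<in> ?A"
    then have p: "prime p" by simp
    have "real n / real p \<le> real (n div p) + 1"
      by (metis floor_divide_of_nat_eq of_int_of_nat_eq real_of_int_floor_add_one_ge)
    then show "(real n / real p) * ln (real p) \<le> (real (n div p) + 1) * ln (real p)"
      using prime_gt_1_real[OF p] by (intro mult_right_mono) auto
  qed
  also have "\<dots> = (\<Sum>p\<in>?A. real (n div p) * ln (real p)) + (\<Sum>p\<in>?A. ln (real p))"
    by (simp add: algebra_simps sum.distrib)
  also have "\<dots> \<le> n * ln n + n * ln 4" using 1 sum_ln_primes_le[of n] by linarith
  finally have "real n * (\<Sum>p\<in>?A. ln (real p) / real p) \<le> real n * (ln n + ln 4)"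
    by (simp add: algebra_simps)
  then show ?thesis using assms by simp
qed

section \<open>The reciprocal sum of the primes from below\<close>

lemma ln_le_sum_inverse: "ln (real n + 1) \<le> (\<Sum>k=1..n. 1 / real k)"
proof (induction n)
  case (Suc n)
  have "ln (real (Suc n) + 1) = ln (real n + 1) + ln (1 + 1 / (real n + 1))"
  proof -
    have "real (Suc n) + 1 = (real n + 1) * (1 + 1 / (real n + 1))" by (simp add: divide_simps) 
    then show ?thesis by (simp only:) (rule ln_mult_pos, auto intro!: add_pos_nonneg)
  qed
  also have "ln (1 + 1 / (real n + 1)) \<le> 1 / (real n + 1)"
    by (rule ln_add_one_self_le_self) simp
  finally show ?case using Suc by (simp add: add.commute)
qed simp

text \<open>Telescoping against 1 / (n (n + 1)); the term 1 / n carries the induction. For n = 0 it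
  is 0 by the convention on division, hence the separate case.\<close>

lemma sum_inverse_squares_le: "(\<Sum>k=1..n. 1 / real k ^ 2) \<le> 2 - 1 / real n"
proof (induction n)
  case (Suc n)
  show ?case
  proof (cases "n = 0")
    case False
    then have "1 / real (Suc n) ^ 2 \<le> 1 / (real n * real (Suc n))"
      by (intro divide_left_mono) (auto simp: power2_eq_square)
    also have "\<dots> = 1 / real n - 1 / real (Suc n)" using False by (simp add: field_simps)
    finally have "1 / real (Suc n) ^ 2 \<le> 1 / real n - 1 / real (Suc n)" .
    then show ?thesis using Suc by simp
  qed simp
qed simp

lemma prod_one_plus:
  fixes f :: "'a \<Rightarrow> 'b :: comm_semiring_1"
  assumes "finite A"
  shows "(\<Prod>x\<in>A. 1 + f x) = (\<Sum>X\<in>Pow A. \<Prod>x\<in>X. f x)"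
  using prod_add[OF assms, of f "\<lambda>_. 1"] by (simp add: add.commute)

lemma squarefree_eq_prod_prime_factors:
  fixes n :: nat
  assumes "squarefree n"
  shows "n = \<Prod>(prime_factors n)"
proof -
  have n0: "n \<noteq> 0" using assms by (metis not_squarefree_0)
  then have "n = (\<Prod>p\<in>prime_factors n. p ^ multiplicity p n)"
    by (subst prod_prime_factors) auto
  also have "\<dots> = (\<Prod>p\<in>prime_factors n. p)"
    using assms n0 by (intro prod.cong) (auto simp: squarefree_factorial_semiring')
  finally show ?thesis by simp
qed

text \<open>Each k is a squarefree number times a square. Expanding the product gives the
  reciprocals of all squarefree numbers built from primes up to n, and the squares contribute a
  factor of at most 2.\<close>

lemma sum_inverse_le_prod_primes:
  "(\<Sum>k=1..n. 1 / real k) \<le> 2 * (\<Prod>p\<in>{p::nat. prime p \<and> p \<le> n}. 1 + 1 / real p)"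
proof -
  let ?A = "{p::nat. prime p \<and> p \<le> n}"
  let ?f = "\<lambda>k::nat. (prime_factors (squarefree_part k), square_part k)"
  let ?w = "\<lambda>(T::nat set, m::nat). (\<Prod>p\<in>T. 1 / real p) * (1 / real m ^ 2)"
  have dec: "k = \<Prod>(prime_factors (squarefree_part k)) * square_part k ^ 2" for k :: nat
    using squarefree_eq_prod_prime_factors[of "squarefree_part k"] squarefree_decompose[of k] by simp
  have inj: "inj_on ?f {1..n}"
    by (rule inj_onI) (metis dec prod.inject)
  have sub: "?f ` {1..n} \<subseteq> Pow ?A \<times> {1..n}"
  proof safe
    fix k p assume k: "k \<in> {1..n}" and p: "p \<in> prime_factors (squarefree_part k)"
    have "p dvd squarefree_part k" using p by auto
    also have "squarefree_part k dvd k" using squarefree_decompose[of k] by (metis dvd_triv_left)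
    finally have "p \<le> k" using k by (intro dvd_imp_le) auto
    then show "p \<le> n" using k by simp
    show "prime p" using p by auto
  next
    fix k assume k: "k \<in> {1..n}"
    have "square_part k ^ 2 dvd k" by simp
    then have "square_part k dvd k" by (metis dvd_trans dvd_triv_left power2_eq_square)
    then have "square_part k \<le> k" using k by (intro dvd_imp_le) auto
    moreover have "square_part k \<noteq> 0" using k by simp
    then have "square_part k \<ge> 1" by linarith
    ultimately show "square_part k \<in> {1..n}" using k by simp
  qed
  have "(\<Sum>k=1..n. 1 / real k) = (\<Sum>k=1..n. ?w (?f k))"
  proof (rule sum.cong[OF refl])
    fix k assume "k \<in> {1..n}"
    have "real k = (\<Prod>p\<in>prime_factors (squarefree_part k). real p) * real (square_part k) ^ 2"
      using arg_cong[OF dec[of k], of real] by simp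
    then show "1 / real k = ?w (?f k)" by (simp add: prod_dividef)
  qed
  also have "\<dots> = sum ?w (?f ` {1..n})" by (simp only: sum.reindex[OF inj] o_def)
  also have "\<dots> \<le> sum ?w (Pow ?A \<times> {1..n})"
    by (rule sum_mono2[OF _ sub]) (auto intro!: mult_nonneg_nonneg prod_nonneg divide_nonneg_nonneg)
  also have "\<dots> = (\<Sum>T\<in>Pow ?A. \<Prod>p\<in>T. 1 / real p) * (\<Sum>m=1..n. 1 / real m ^ 2)"
    by (simp add: sum_product sum.cartesian_product)
  also have "\<dots> = (\<Prod>p\<in>?A. 1 + 1 / real p) * (\<Sum>m=1..n. 1 / real m ^ 2)"
    by (simp add: prod_one_plus)
  also have "\<dots> \<le> (\<Prod>p\<in>?A. 1 + 1 / real p) * 2"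
  proof (rule mult_left_mono)
    have "1 / real n \<ge> 0" by simp
    then show "(\<Sum>m=1..n. 1 / real m ^ 2) \<le> 2" using sum_inverse_squares_le[of n] by linarith
  qed (auto intro!: prod_nonneg add_nonneg_nonneg)
  finally show ?thesis by (simp add: mult.commute)
qed

lemma prod_one_plus_le_exp:
  fixes f :: "'a \<Rightarrow> real"
  assumes "\<And>x. x \<in> A \<Longrightarrow> f x \<ge> 0"
  shows "(\<Prod>x\<in>A. 1 + f x) \<le> exp (sum f A)"
proof (cases "finite A")
  case True
  have "(\<Prod>x\<in>A. 1 + f x) \<le> (\<Prod>x\<in>A. exp (f x))"
    using assms by (intro prod_mono) (auto intro: add_nonneg_nonneg)
  then show ?thesis using True by (simp add: exp_sum)
qed simp

text \<open>The logarithm of the preceding comparison, with 1 + t <= exp t in each factor; ln 2 is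
  the cost of the squares.\<close>

lemma sum_inverse_primes_ge:
  assumes "n \<ge> 2"
  shows "(\<Sum>p\<in>{p::nat. prime p \<and> p \<le> n}. 1 / real p) \<ge> ln (ln (real n)) - ln 2"
proof -
  let ?s = "\<Sum>p\<in>{p::nat. prime p \<and> p \<le> n}. 1 / real p"
  have pos: "ln (real n) > 0" using assms by simp
  have "ln (real n) \<le> ln (real n + 1)" using assms by simp
  also have "\<dots> \<le> (\<Sum>k=1..n. 1 / real k)" by (rule ln_le_sum_inverse)
  also have "\<dots> \<le> 2 * (\<Prod>p\<in>{p::nat. prime p \<and> p \<le> n}. 1 + 1 / real p)"
    by (rule sum_inverse_le_prod_primes)
  also have "\<dots> \<le> 2 * exp ?s" by (intro mult_left_mono prod_one_plus_le_exp) auto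
  finally have "ln (ln (real n)) \<le> ln (2 * exp ?s)" using pos by (subst ln_le_cancel_iff) auto
  then show ?thesis by (simp add: ln_mult)
qed

section \<open>Partial summation from ln p / p to 1 / p\<close>

lemma summation_by_parts_ln:
  fixes u :: "nat \<Rightarrow> real"
  assumes "n \<ge> 2"
  shows "(\<Sum>k=2..n. u k / ln (real k)) = (\<Sum>k=2..n. u k) / ln (real n)
     + (\<Sum>k=2..<n. (\<Sum>j=2..k. u j) * (1 / ln (real k) - 1 / ln (real (Suc k))))"
  using assms
proof (induction n rule: dec_induct)
  case (step n)
  have s: "(\<Sum>k=2..Suc n. u k / ln (real k)) = (\<Sum>k=2..n. u k / ln (real k)) + u (Suc n) / ln (real (Suc n))"
    "(\<Sum>k=2..Suc n. u k) = (\<Sum>k=2..n. u k) + u (Suc n)"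
    "(\<Sum>k=2..<Suc n. (\<Sum>j=2..k. u j) * (1 / ln (real k) - 1 / ln (real (Suc k))))
     = (\<Sum>k=2..<n. (\<Sum>j=2..k. u j) * (1 / ln (real k) - 1 / ln (real (Suc k))))
       + (\<Sum>j=2..n. u j) * (1 / ln (real n) - 1 / ln (real (Suc n)))"
    using step by simp_all
  show ?case unfolding s step.IH by (simp add: algebra_simps add_divide_distrib)
qed simp

text \<open>Abel summation with weights 1 / ln k. The main term c ln k (1 / ln k - 1 / ln (k + 1))
  is at most c times the increment of ln ln, by 1 - a / b <= ln b - ln a, so both sums telescope and
  leave only boundary terms at 2 and n.\<close>

lemma sum_inverse_le_of_sum_ln_over_le:
  fixes R :: "nat set" and c C :: real
  assumes "c \<ge> 0" "C \<ge> 0"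
    and U: "\<And>n. n \<ge> 2 \<Longrightarrow> (\<Sum>p\<in>{p\<in>R. 2 \<le> p \<and> p \<le> n}. ln (real p) / real p) \<le> c * ln (real n) + C"
    and n: "n \<ge> 2"
  shows "(\<Sum>p\<in>{p\<in>R. 2 \<le> p \<and> p \<le> n}. 1 / real p)
     \<le> c * ln (ln (real n)) + (c - c * ln (ln 2) + C / ln 2)"
proof -
  define u where "u k = (if k \<in> R then ln (real k) / real k else 0)" for k
  have sumR: "(\<Sum>p\<in>{p\<in>R. 2 \<le> p \<and> p \<le> n}. f p) = (\<Sum>k=2..n. if k \<in> R then f k else 0)"
    for f :: "nat \<Rightarrow> real" and n
    by (subst sum.inter_filter[symmetric]) (auto intro!: sum.cong)
  have U': "(\<Sum>k=2..m. u k) \<le> c * ln (real m) + C" if "m \<ge> 2" for m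
    using U[OF that] unfolding sumR u_def .
  have "(\<Sum>p\<in>{p\<in>R. 2 \<le> p \<and> p \<le> n}. 1 / real p) = (\<Sum>k=2..n. u k / ln (real k))"
    unfolding sumR u_def by (rule sum.cong) auto
  also have "\<dots> = (\<Sum>k=2..n. u k) / ln (real n)
     + (\<Sum>k=2..<n. (\<Sum>j=2..k. u j) * (1 / ln (real k) - 1 / ln (real (Suc k))))"
    by (rule summation_by_parts_ln[OF n])
  also have "\<dots> \<le> (c + C / ln (real n)) +
      (\<Sum>k=2..<n. c * (ln (ln (real (Suc k))) - ln (ln (real k))) - C * (1 / ln (real (Suc k)) - 1 / ln (real k)))"
  proof (rule add_mono)
    have "(\<Sum>k=2..n. u k) / ln (real n) \<le> (c * ln (real n) + C) / ln (real n)"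
      using U'[OF n] n by (intro divide_right_mono) auto
    also have "\<dots> = c + C / ln (real n)" using n by (simp add: add_divide_distrib)
    finally show "(\<Sum>k=2..n. u k) / ln (real n) \<le> c + C / ln (real n)" .
  next
    show "(\<Sum>k=2..<n. (\<Sum>j=2..k. u j) * (1 / ln (real k) - 1 / ln (real (Suc k))))
       \<le> (\<Sum>k=2..<n. c * (ln (ln (real (Suc k))) - ln (ln (real k))) - C * (1 / ln (real (Suc k)) - 1 / ln (real k)))"
    proof (rule sum_mono)
      fix k assume k: "k \<in> {2..<n}"
      define a b where "a = ln (real k)" and "b = ln (real (Suc k))"
      have ab: "0 < a" "a < b" unfolding a_def b_def using k by auto
      have "(\<Sum>j=2..k. u j) * (1 / a - 1 / b) \<le> (c * a + C) * (1 / a - 1 / b)"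
        using U'[of k] k ab by (intro mult_right_mono) (auto simp: a_def frac_le)
      also have "\<dots> = c * (1 - a / b) - C * (1 / b - 1 / a)"
        using ab by (simp add: field_simps)
      also have "1 - a / b \<le> ln b - ln a"
        using ln_le_minus_one[of "a / b"] ab by (simp add: ln_div)
      then have "c * (1 - a / b) - C * (1 / b - 1 / a) \<le> c * (ln b - ln a) - C * (1 / b - 1 / a)"
        using assms(1) by (simp add: mult_left_mono)
      finally show "(\<Sum>j=2..k. u j) * (1 / ln (real k) - 1 / ln (real (Suc k)))
        \<le> c * (ln (ln (real (Suc k))) - ln (ln (real k))) - C * (1 / ln (real (Suc k)) - 1 / ln (real k))"
        by (simp add: a_def b_def)
    qed
  qed
  also have "\<dots> = (c + C / ln (real n)) + (c * (ln (ln (real n)) - ln (ln 2)) - C * (1 / ln (real n) - 1 / ln 2))"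
  proof -
    have "(\<Sum>k=2..<n. ln (ln (real (Suc k))) - ln (ln (real k))) = ln (ln (real n)) - ln (ln (real 2))"
      using n by (rule sum_Suc_diff')
    moreover have "(\<Sum>k=2..<n. 1 / ln (real (Suc k)) - 1 / ln (real k)) = 1 / ln (real n) - 1 / ln (real 2)"
      using n by (rule sum_Suc_diff')
    ultimately show ?thesis
      by (simp only: sum_subtractf[of "\<lambda>k. c * _ k" "\<lambda>k. C * _ k"] sum_distrib_left[symmetric]) simp
  qed
  also have "\<dots> = c * ln (ln (real n)) + (c - c * ln (ln 2) + C / ln 2)"
    by (simp add: algebra_simps)
  finally show ?thesis .
qed

section \<open>An upper bound sieve modulo squares of primes\<close>

text \<open>The Chinese remainder theorem as independence: over a full period the mean of the
  product is the product of the means.\<close>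

lemma sum_lessThan_coprime_periodic:
  fixes \<phi> \<psi> :: "nat \<Rightarrow> real"
  assumes "coprime a b" "a > 0" "b > 0"
    and \<phi>: "\<And>n. \<phi> (n mod a) = \<phi> n" and \<psi>: "\<And>n. \<psi> (n mod b) = \<psi> n"
  shows "(\<Sum>n<a*b. \<phi> n * \<psi> n) = (\<Sum>n<a. \<phi> n) * (\<Sum>n<b. \<psi> n)"
proof -
  let ?f = "\<lambda>n. (n mod a, n mod b)"
  have inj: "inj_on ?f {..<a*b}"
  proof (rule inj_onI)
    fix x y assume *: "x \<in> {..<a*b}" "y \<in> {..<a*b}" "?f x = ?f y"
    then have "[x = y] (mod a)" "[x = y] (mod b)" by (auto simp: cong_def)
    then have "[x = y] (mod a * b)" using assms(1) by (rule coprime_cong_mult_nat)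
    then show "x = y" using * by (simp add: cong_def)
  qed
  have "?f ` {..<a*b} \<subseteq> {..<a} \<times> {..<b}" using assms by auto
  then have im: "?f ` {..<a*b} = {..<a} \<times> {..<b}"
    by (rule card_subset_eq[rotated]) (simp_all add: card_image[OF inj] card_cartesian_product)
  have "(\<Sum>n<a*b. \<phi> n * \<psi> n) = (\<Sum>n<a*b. (\<lambda>(i,j). \<phi> i * \<psi> j) (?f n))"
    by (simp add: \<phi> \<psi>)
  also have "\<dots> = (\<Sum>(i,j)\<in>{..<a} \<times> {..<b}. \<phi> i * \<psi> j)"
    unfolding im[symmetric] by (subst sum.reindex[OF inj]) (simp add: o_def)
  also have "\<dots> = (\<Sum>n<a. \<phi> n) * (\<Sum>n<b. \<psi> n)"
    by (simp add: sum_product sum.cartesian_product)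
  finally show ?thesis .
qed

lemma sum_prod_periodic_primes:
  fixes \<phi> :: "nat \<Rightarrow> nat \<Rightarrow> real"
  assumes "finite T" "\<And>p. p \<in> T \<Longrightarrow> prime p"
    and "\<And>p n. p \<in> T \<Longrightarrow> \<phi> p (n mod p\<^sup>2) = \<phi> p n"
  shows "(\<Sum>n<(\<Prod>p\<in>T. p\<^sup>2). \<Prod>p\<in>T. \<phi> p n) = (\<Prod>p\<in>T. \<Sum>n<p\<^sup>2. \<phi> p n)
    \<and> (\<forall>n. (\<Prod>p\<in>T. \<phi> p (n mod (\<Prod>p\<in>T. p\<^sup>2))) = (\<Prod>p\<in>T. \<phi> p n))"
  using assms
proof (induction T rule: finite_induct)
  case (insert q T)
  let ?L = "\<Prod>p\<in>T. p\<^sup>2"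
  have per: "\<phi> p (n mod m) = \<phi> p n" if "p \<in> insert q T" "p\<^sup>2 dvd m" for p n m
    using insert.prems(2)[OF that(1), of "n mod m"] insert.prems(2)[OF that(1), of n] that(2)
    by (simp add: mod_mod_cancel)
  have perT: "(\<Prod>p\<in>T. \<phi> p (n mod ?L)) = (\<Prod>p\<in>T. \<phi> p n)" for n
    using insert by (intro prod.cong) (auto intro!: per dvd_prodI)
  have "coprime (q\<^sup>2) ?L"
  proof (rule prod_coprime_right)
    fix p assume "p \<in> T"
    then have "coprime q p" using insert by (intro primes_coprime) auto
    then show "coprime (q\<^sup>2) (p\<^sup>2)" by simp
  qed
  moreover have "?L > 0" using insert by (auto intro!: prod_pos simp: prime_gt_0_nat)
  moreover have "q\<^sup>2 > 0" using insert by (auto simp: prime_gt_0_nat)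
  ultimately have "(\<Sum>n<q\<^sup>2 * ?L. \<phi> q n * (\<Prod>p\<in>T. \<phi> p n)) = (\<Sum>n<q\<^sup>2. \<phi> q n) * (\<Sum>n<?L. \<Prod>p\<in>T. \<phi> p n)"
    by (intro sum_lessThan_coprime_periodic perT) (use insert.prems in auto)
  moreover have "(\<Sum>n<?L. \<Prod>p\<in>T. \<phi> p n) = (\<Prod>p\<in>T. \<Sum>n<p\<^sup>2. \<phi> p n)" using insert by auto
  moreover have "(\<Prod>p\<in>insert q T. \<phi> p (n mod (\<Prod>p\<in>insert q T. p\<^sup>2))) = (\<Prod>p\<in>insert q T. \<phi> p n)" for n
    by (rule prod.cong[OF refl], rule per, assumption, rule dvd_prodI) (use insert.hyps in auto)
  ultimately show ?case using insert by simp
qed simp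

lemma sum_lessThan_add: "(\<Sum>n<a + b. f n) = (\<Sum>n<a. f n) + (\<Sum>n<b. f (n + a :: nat) :: real)"
  by (induction b) (simp_all add: add_ac)

lemma sum_lessThan_mult_periodic:
  fixes \<psi> :: "nat \<Rightarrow> real"
  assumes "\<And>n. \<psi> (n mod L) = \<psi> n"
  shows "(\<Sum>n<q * L + r. \<psi> n) = q * (\<Sum>n<L. \<psi> n) + (\<Sum>n<r. \<psi> n)"
proof (induction q)
  case (Suc q)
  have shift: "\<psi> (n + L) = \<psi> n" for n by (metis assms mod_add_self2)
  have "(\<Sum>n<Suc q * L + r. \<psi> n) = (\<Sum>n<L + (q * L + r). \<psi> n)" by (simp add: algebra_simps)
  also have "\<dots> = (\<Sum>n<L. \<psi> n) + (\<Sum>n<q * L + r. \<psi> (n + L))"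
    by (rule sum_lessThan_add)
  finally show ?case using Suc by (simp add: shift algebra_simps)
qed simp

text \<open>The interval is cut into full periods and a rest shorter than L. The rest itself and its
  share of the mean each cost at most L.\<close>

lemma sum_lessThan_periodic_approx:
  fixes \<psi> :: "nat \<Rightarrow> real"
  assumes per: "\<And>n. \<psi> (n mod L) = \<psi> n" and "L > 0" and bd: "\<And>n. \<bar>\<psi> n\<bar> \<le> 1"
  shows "(\<Sum>n<X. \<psi> n) \<le> real X * ((\<Sum>n<L. \<psi> n) / real L) + 2 * real L"
proof -
  define q r S where "q = X div L" and "r = X mod L" and "S = (\<Sum>n<L. \<psi> n)"
  have X: "X = q * L + r" "r < L" using assms(2) by (auto simp: q_def r_def)
  have b: "\<bar>\<Sum>n<m. \<psi> n\<bar> \<le> real m" for m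
    using order.trans[OF sum_abs[of \<psi> "{..<m}"] sum_mono[of "{..<m}" "\<lambda>n. \<bar>\<psi> n\<bar>" "\<lambda>_. 1"]] bd by simp
  have "(\<Sum>n<X. \<psi> n) = q * S + (\<Sum>n<r. \<psi> n)"
    unfolding X(1) S_def by (rule sum_lessThan_mult_periodic, rule per)
  also have "q * S = real X * (S / real L) - real r * (S / real L)"
    using X assms(2) by (simp add: field_simps)
  finally have eq: "(\<Sum>n<X. \<psi> n) = real X * (S / real L) - real r * (S / real L) + (\<Sum>n<r. \<psi> n)" .
  have "(\<Sum>n<r. \<psi> n) \<le> real L" using b[of r] X(2) by simp
  moreover have "- (real r * (S / real L)) \<le> real L"
  proof -
    have "\<bar>S / real L\<bar> \<le> 1" using b[of L] assms(2) by (simp add: S_def)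
    then have "\<bar>real r * (S / real L)\<bar> \<le> real r * 1" unfolding abs_mult by (intro mult_mono) auto
    then show ?thesis using X(2) by linarith
  qed
  ultimately show ?thesis using eq unfolding S_def by linarith
qed

text \<open>A dual form of Selberg's sieve. The functions that equal \<open>-1\<close> on the excluded residues modulo
  \<open>p\<^sup>2\<close> and \<open>h p\<close> elsewhere have mean zero and mean square \<open>h p\<close>; hence the products
  over different sets of primes are nearly orthogonal, while on the sifted set their sum is the
  constant \<open>J\<close>.\<close>

lemma sifted_set_bound:
  fixes E :: "nat \<Rightarrow> nat \<Rightarrow> bool" and Q :: "nat set" and D :: real
  defines "g \<equiv> \<lambda>p. real (card {n. n < p\<^sup>2 \<and> E p n}) / real (p\<^sup>2)"
  defines "h \<equiv> \<lambda>p. g p / (1 - g p)"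
  defines "J \<equiv> (\<Sum>T\<in>{T\<in>Pow Q. real (\<Prod>T) \<le> D}. \<Prod>p\<in>T. h p)"
  assumes Q: "finite Q" "\<And>p. p \<in> Q \<Longrightarrow> prime p"
    and E: "\<And>p n. p \<in> Q \<Longrightarrow> E p (n mod p\<^sup>2) = E p n"
    and g: "\<And>p. p \<in> Q \<Longrightarrow> g p \<le> 1 / 2"
    and Y: "Y \<subseteq> {..<X}" "\<And>n p. n \<in> Y \<Longrightarrow> p \<in> Q \<Longrightarrow> \<not> E p n"
    and D: "D \<ge> 1"
  shows "real (card Y) * J\<^sup>2 \<le> real X * J + 2 * D ^ 6"
proof -
  define TT where "TT = {T\<in>Pow Q. real (\<Prod>T) \<le> D}"
  define f where "f p n = (if E p n then -1 else h p)" for p n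
  define F where "F T n = (\<Prod>p\<in>T. f p n)" for T n
  have finTT: "finite TT" unfolding TT_def using Q by simp
  have TTD: "finite T" "T \<subseteq> Q" "\<And>p. p \<in> T \<Longrightarrow> prime p" "real (\<Prod>T) \<le> D" if "T \<in> TT" for T
    using that Q finite_subset unfolding TT_def by auto
  have g0: "g p \<ge> 0" for p unfolding g_def by simp
  \<comment> \<open>Here g <= 1/2 matters: it keeps h, and with it every \<open>f p n\<close>, in
    [-1, 1], so that all products F are bounded by 1.\<close>
  have h01: "0 \<le> h p" "h p \<le> 1" if "p \<in> Q" for p
    using g[OF that] g0[of p] unfolding h_def by (auto simp: field_simps)
  have fbd: "\<bar>f p n\<bar> \<le> 1" if "p \<in> Q" for p n using h01[OF that] by (simp add: f_def)
  have fper: "f p (n mod p\<^sup>2) = f p n" if "p \<in> Q" for p n using E[OF that] by (simp add: f_def)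
  have p2: "real (p\<^sup>2) > 0" if "p \<in> Q" for p using Q(2)[OF that] by (simp add: prime_gt_0_nat)
  have cnt: "real (card {n\<in>{..<p\<^sup>2}. E p n}) = real (p\<^sup>2) * g p"
       "real (card {n\<in>{..<p\<^sup>2}. \<not> E p n}) = real (p\<^sup>2) * (1 - g p)" if "p \<in> Q" for p
  proof -
    have "{n\<in>{..<p\<^sup>2}. E p n} = {n. n < p\<^sup>2 \<and> E p n}" by auto
    then show 1: "real (card {n\<in>{..<p\<^sup>2}. E p n}) = real (p\<^sup>2) * g p"
      using p2[OF that] by (simp add: g_def)
    have "card ({n\<in>{..<p\<^sup>2}. E p n} \<union> {n\<in>{..<p\<^sup>2}. \<not> E p n})
        = card {n\<in>{..<p\<^sup>2}. E p n} + card {n\<in>{..<p\<^sup>2}. \<not> E p n}"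
      by (rule card_Un_disjoint) auto
    also have "{n\<in>{..<p\<^sup>2}. E p n} \<union> {n\<in>{..<p\<^sup>2}. \<not> E p n} = {..<p\<^sup>2}" by auto
    finally have "card {..<p\<^sup>2} = card {n\<in>{..<p\<^sup>2}. E p n} + card {n\<in>{..<p\<^sup>2}. \<not> E p n}" .
    then have "real (p\<^sup>2) = real (card {n\<in>{..<p\<^sup>2}. E p n}) + real (card {n\<in>{..<p\<^sup>2}. \<not> E p n})"
      by (metis card_lessThan of_nat_add)
    then show "real (card {n\<in>{..<p\<^sup>2}. \<not> E p n}) = real (p\<^sup>2) * (1 - g p)"
      using 1 by (simp add: algebra_simps)
  qed
  have split: "(\<Sum>n<p\<^sup>2. if E p n then a else b) = real (p\<^sup>2) * (g p * a + (1 - g p) * b)"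
    if "p \<in> Q" for p and a b :: real
  proof -
    have "(\<Sum>n<p\<^sup>2. if E p n then a else b)
        = real (card {n\<in>{..<p\<^sup>2}. E p n}) * a + real (card {n\<in>{..<p\<^sup>2}. \<not> E p n}) * b"
      by (simp add: sum.If_cases Int_def)
    then show ?thesis unfolding cnt[OF that] by (simp add: algebra_simps)
  qed
  \<comment> \<open>The value h = g / (1 - g) is the one that solves - g + (1 - g) h = 0.\<close>
  have mean0: "(\<Sum>n<p\<^sup>2. f p n) = 0" if "p \<in> Q" for p
    unfolding f_def split[OF that] using g[OF that] by (simp add: h_def)
  have mean2: "(\<Sum>n<p\<^sup>2. (f p n)\<^sup>2) = real (p\<^sup>2) * h p" if "p \<in> Q" for p
  proof -
    have "(\<Sum>n<p\<^sup>2. (f p n)\<^sup>2) = (\<Sum>n<p\<^sup>2. if E p n then 1 else (h p)\<^sup>2)"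
      by (rule sum.cong) (auto simp: f_def)
    also have "\<dots> = real (p\<^sup>2) * (g p * 1 + (1 - g p) * (h p)\<^sup>2)" by (rule split[OF that])
    also have "g p * 1 + (1 - g p) * (h p)\<^sup>2 = h p"
    proof -
      have "1 - g p \<noteq> 0" using g[OF that] by auto
      then have "(1 - g p) * (h p)\<^sup>2 = g p * h p" "(1 - g p) * h p = g p"
        by (simp_all add: h_def power2_eq_square)
      then show ?thesis by (simp add: algebra_simps)
    qed
    finally show ?thesis .
  qed
  \<comment> \<open>If S and T differ, a prime in just one of them contributes a factor of mean
    zero; if they agree, the mean squares multiply to the product of the h. The common period L
    divides the product of both squares, hence is at most D^4.\<close>
  have pair: "(\<Sum>n<X. F S n * F T n) \<le> (if S = T then real X * (\<Prod>p\<in>T. h p) else 0) + 2 * D ^ 4"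
    if S: "S \<in> TT" and T: "T \<in> TT" for S T
  proof -
    define \<phi> where "\<phi> p n = (if p \<in> S then f p n else 1) * (if p \<in> T then f p n else 1)" for p n
    define L where "L = (\<Prod>p\<in>S\<union>T. p\<^sup>2)"
    have U: "finite (S \<union> T)" "S \<union> T \<subseteq> Q" "\<And>p. p \<in> S \<union> T \<Longrightarrow> prime p"
      using TTD S T by blast+
    have FF: "F S n * F T n = (\<Prod>p\<in>S\<union>T. \<phi> p n)" for n
    proof -
      have "(\<Prod>p\<in>S\<union>T. if p \<in> S then f p n else 1) = F S n" "(\<Prod>p\<in>S\<union>T. if p \<in> T then f p n else 1) = F T n"
        unfolding F_def using U(1) by (subst prod.inter_restrict[symmetric]; simp add: Int_absorb1 Int_absorb2)+
      then show ?thesis unfolding \<phi>_def prod.distrib by simp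
    qed
    have per: "\<phi> p (n mod p\<^sup>2) = \<phi> p n" if "p \<in> S \<union> T" for p n
      using that U(2) by (auto simp: \<phi>_def fper)
    have perF: "F S (n mod L) * F T (n mod L) = F S n * F T n" for n
      unfolding FF L_def using sum_prod_periodic_primes[of "S \<union> T" \<phi>] U per by blast
    have L0: "L > 0" unfolding L_def using U by (intro prod_pos) (auto simp: prime_gt_0_nat)
    have b1: "\<bar>\<phi> p n\<bar> \<le> 1" if "p \<in> S \<union> T" for p n
    proof -
      have "\<bar>f p n\<bar> \<le> 1" using that U(2) by (intro fbd) auto
      then show ?thesis by (auto simp: \<phi>_def abs_mult mult_le_one)
    qed
    have bd: "\<bar>F S n * F T n\<bar> \<le> 1" for n
      unfolding FF abs_prod by (rule prod_le_1) (use b1 in auto)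
    have "L dvd (\<Prod>S)\<^sup>2 * (\<Prod>T)\<^sup>2"
    proof -
      have "L = (\<Prod>p\<in>S. p\<^sup>2) * (\<Prod>p\<in>T-S. p\<^sup>2)" unfolding L_def
        using TTD(1)[OF S] TTD(1)[OF T] by (subst prod.union_disjoint[symmetric]) auto
      also have "\<dots> dvd (\<Prod>p\<in>S. p\<^sup>2) * (\<Prod>p\<in>T. p\<^sup>2)"
        using TTD(1)[OF T] by (intro mult_dvd_mono dvd_refl, intro prod_dvd_prod_subset) auto
      finally show ?thesis by (simp add: prod_power_distrib)
    qed
    moreover have "(\<Prod>S)\<^sup>2 * (\<Prod>T)\<^sup>2 > 0"
      using TTD(3)[OF S] TTD(3)[OF T] by (auto intro!: prod_pos simp: prime_gt_0_nat)
    ultimately have "L \<le> (\<Prod>S)\<^sup>2 * (\<Prod>T)\<^sup>2" by (rule dvd_imp_le)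
    then have "real L \<le> real ((\<Prod>S)\<^sup>2 * (\<Prod>T)\<^sup>2)" using of_nat_le_iff by blast
    also have "\<dots> = (real (\<Prod>S))\<^sup>2 * (real (\<Prod>T))\<^sup>2" by simp
    also have "\<dots> \<le> D\<^sup>2 * D\<^sup>2"
      by (intro mult_mono power_mono TTD(4)[OF S] TTD(4)[OF T]) (auto intro!: prod_nonneg)
    finally have LD: "real L \<le> D ^ 4" by (simp flip: power_add)
    have "(\<Sum>n<X. F S n * F T n) \<le> real X * ((\<Sum>n<L. F S n * F T n) / real L) + 2 * real L"
      by (rule sum_lessThan_periodic_approx[where \<psi> = "\<lambda>n. F S n * F T n", OF perF L0 bd])
    also have "(\<Sum>n<L. F S n * F T n) = (\<Prod>p\<in>S\<union>T. \<Sum>n<p\<^sup>2. \<phi> p n)"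
      unfolding FF L_def using sum_prod_periodic_primes[of "S \<union> T" \<phi>] U per by blast
    also have "\<dots> / real L = (if S = T then (\<Prod>p\<in>T. h p) else 0)"
    proof (cases "S = T")
      case True
      have "(\<Prod>p\<in>T. \<Sum>n<p\<^sup>2. \<phi> p n) = (\<Prod>p\<in>T. real (p\<^sup>2) * h p)"
      proof (rule prod.cong[OF refl])
        fix p assume p: "p \<in> T"
        then have "p \<in> Q" using TTD(2)[OF T] by auto
        from mean2[OF this] show "(\<Sum>n<p\<^sup>2. \<phi> p n) = real (p\<^sup>2) * h p"
          using p True by (simp add: \<phi>_def power2_eq_square)
      qed
      also have "\<dots> = real L * (\<Prod>p\<in>T. h p)" by (simp add: L_def True prod.distrib)
      finally show ?thesis using True L0 by simp
    next
      case False
      then obtain p where p: "p \<in> S \<union> T" "\<not> (p \<in> S \<and> p \<in> T)" by blast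
      then have "\<phi> p n = f p n" for n by (auto simp: \<phi>_def)
      then have "(\<Sum>n<p\<^sup>2. \<phi> p n) = 0" using p(1) U(2) mean0[of p] by auto
      then have "(\<Prod>p\<in>S\<union>T. \<Sum>n<p\<^sup>2. \<phi> p n) = 0"
        by (intro prod_zero[OF U(1)] bexI[OF _ p(1)])
      then show ?thesis using False by simp
    qed
    finally show ?thesis using LD by (cases "S = T") auto
  qed
  \<comment> \<open>A set of primes is recovered from its product, and the product is a positive
    integer up to D.\<close>
  have cardTT: "real (card TT) \<le> D"
  proof -
    have inj: "inj_on (\<lambda>T. \<Prod>T) TT"
    proof (rule inj_onI)
      fix S T assume *: "S \<in> TT" "T \<in> TT" "\<Prod>S = \<Prod>T"
      have pf: "prime_factors (\<Prod>T) = T" if "T \<in> TT" for T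
      proof -
        have "prime_factors (\<Prod>T) = (\<Union>p\<in>T. prime_factors p)"
          using TTD(1,3)[OF that] prime_factors_prod[of T "\<lambda>p. p"] by (auto dest: prime_gt_0_nat)
        also have "\<dots> = (\<Union>p\<in>T. {p})"
          using TTD(3)[OF that] by (intro SUP_cong) (auto simp: prime_prime_factors)
        finally show ?thesis by simp
      qed
      have "prime_factors (\<Prod>S) = prime_factors (\<Prod>T)" by (simp only: *(3))
      then show "S = T" unfolding pf[OF *(1)] pf[OF *(2)] .
    qed
    have "(\<lambda>T. \<Prod>T) ` TT \<subseteq> {1..nat \<lfloor>D\<rfloor>}"
    proof (rule image_subsetI)
      fix T assume T: "T \<in> TT"
      have "\<Prod>T > 0" using TTD(3)[OF T] by (intro prod_pos) (auto simp: prime_gt_0_nat)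
      then show "\<Prod>T \<in> {1..nat \<lfloor>D\<rfloor>}" using TTD(4)[OF T] by (auto simp: le_nat_floor)
    qed
    then have "card TT \<le> card {1..nat \<lfloor>D\<rfloor>}" by (rule card_inj_on_le[OF inj]) simp
    then show ?thesis using D by simp linarith
  qed
  have J: "J = (\<Sum>T\<in>TT. \<Prod>p\<in>T. h p)" by (simp add: J_def TT_def)
  have "real (card Y) * J\<^sup>2 = (\<Sum>n\<in>Y. (\<Sum>T\<in>TT. F T n)\<^sup>2)"
  proof -
    have "(\<Sum>T\<in>TT. F T n) = J" if "n \<in> Y" for n
      unfolding J F_def
    proof (intro sum.cong prod.cong refl)
      fix T p assume "T \<in> TT" "p \<in> T"
      then show "f p n = h p" using Y(2)[OF that, of p] TTD(2) by (auto simp: f_def)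
    qed
    then show ?thesis by simp
  qed
  \<comment> \<open>Squares are nonnegative, so the sum may be extended from the sifted set to the
    whole interval, where near orthogonality applies.\<close>
  also have "\<dots> \<le> (\<Sum>n<X. (\<Sum>T\<in>TT. F T n)\<^sup>2)" by (rule sum_mono2) (use Y in auto)
  also have "\<dots> = (\<Sum>n<X. \<Sum>S\<in>TT. \<Sum>T\<in>TT. F S n * F T n)"
    by (simp add: power2_eq_square sum_product)
  also have "\<dots> = (\<Sum>S\<in>TT. \<Sum>T\<in>TT. \<Sum>n<X. F S n * F T n)"
    by (subst sum.swap, rule sum.cong[OF refl], subst sum.swap, rule refl)
  also have "\<dots> \<le> (\<Sum>S\<in>TT. \<Sum>T\<in>TT. (if S = T then real X * (\<Prod>p\<in>T. h p) else 0) + 2 * D ^ 4)"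
    by (intro sum_mono pair)
  also have "\<dots> = real X * J + (real (card TT))\<^sup>2 * (2 * D ^ 4)"
    using finTT by (simp add: sum.distrib J sum_distrib_left power2_eq_square algebra_simps)
  \<comment> \<open>There are at most D^2 pairs (S, T), each with error 2 D^4.\<close>
  also have "(real (card TT))\<^sup>2 * (2 * D ^ 4) \<le> D\<^sup>2 * (2 * D ^ 4)"
    using cardTT D by (intro mult_right_mono power_mono) auto
  also have "D\<^sup>2 * (2 * D ^ 4) = 2 * D ^ 6" by (simp flip: power_add)
  finally show ?thesis by simp
qed

text \<open>Rankin's trick with exponent \<open>1 / ln z\<close>.\<close>

lemma truncated_sum_ge_half_prod:
  fixes h :: "nat \<Rightarrow> real" and B z D :: real
  assumes Q: "finite Q" "\<And>p. p \<in> Q \<Longrightarrow> prime p \<and> real p \<le> z"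
    and h: "\<And>p. p \<in> Q \<Longrightarrow> 0 \<le> h p" "\<And>p. p \<in> Q \<Longrightarrow> h p \<le> B / real p"
    and z: "z \<ge> 2" and B: "B \<ge> 0"
    and D: "D \<ge> 1" "ln D \<ge> (9 * B + 1) * ln z"
  shows "(\<Sum>T\<in>{T\<in>Pow Q. real (\<Prod>T) \<le> D}. \<Prod>p\<in>T. h p) \<ge> (1 / 2) * (\<Prod>p\<in>Q. 1 + h p)"
proof -
  define e where "e = 1 / ln z"
  have lz: "ln z > 0" using z by simp
  have e: "e > 0" using lz by (simp add: e_def)
  let ?H = "\<lambda>T. \<Prod>p\<in>T. h p"
  have H0: "?H T \<ge> 0" if "T \<subseteq> Q" for T using that h(1) by (intro prod_nonneg) auto
  have P0: "\<Prod>T > 0" if "T \<subseteq> Q" for T using that Q by (intro prod_pos) (auto simp: prime_gt_0_nat)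
  have "(\<Sum>T\<in>{T\<in>Pow Q. \<not> real (\<Prod>T) \<le> D}. ?H T)
      \<le> (\<Sum>T\<in>{T\<in>Pow Q. \<not> real (\<Prod>T) \<le> D}. D powr (-e) * (\<Prod>p\<in>T. h p * real p powr e))"
  proof (rule sum_mono)
    fix T assume T: "T \<in> {T\<in>Pow Q. \<not> real (\<Prod>T) \<le> D}"
    then have TQ: "T \<subseteq> Q" by auto
    have "D powr (-e) * (\<Prod>p\<in>T. h p * real p powr e) = D powr (-e) * (?H T * real (\<Prod>T) powr e)"
      by (simp add: prod.distrib prod_powr_distrib)
    also have "\<dots> = ?H T * (real (\<Prod>T) / D) powr e"
      using D(1) P0[OF TQ] by (simp add: powr_divide powr_minus field_simps)
    finally have eq: "D powr (-e) * (\<Prod>p\<in>T. h p * real p powr e) = ?H T * (real (\<Prod>T) / D) powr e" .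
    have "(real (\<Prod>T) / D) \<ge> 1" using T D(1) by (auto simp del: of_nat_prod)
    then have "(real (\<Prod>T) / D) powr e \<ge> 1" using e by (intro ge_one_powr_ge_zero) auto
    then show "?H T \<le> D powr (-e) * (\<Prod>p\<in>T. h p * real p powr e)"
      unfolding eq using H0[OF TQ] by (simp add: mult_le_cancel_left1)
  qed
  also have "\<dots> \<le> (\<Sum>T\<in>Pow Q. D powr (-e) * (\<Prod>p\<in>T. h p * real p powr e))"
    using Q h by (intro sum_mono2 mult_nonneg_nonneg prod_nonneg) auto
  also have "\<dots> = D powr (-e) * (\<Prod>p\<in>Q. 1 + h p * real p powr e)"
    by (simp add: prod_one_plus[OF Q(1)] sum_distrib_left)
  also have "\<dots> \<le> D powr (-e) * ((\<Prod>p\<in>Q. 1 + h p) * exp (9 * B))"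
  proof (rule mult_left_mono)
    \<comment> \<open>Splits off the untwisted factor 1 + h, so that only the increments p^e - 1
      remain to be bounded, by a constant independent of z.\<close>
    have "(\<Prod>p\<in>Q. 1 + h p * real p powr e) \<le> (\<Prod>p\<in>Q. (1 + h p) * (1 + h p * (real p powr e - 1)))"
    proof (rule prod_mono)
      fix p assume p: "p \<in> Q"
      have "real p powr e \<ge> 1" using Q(2)[OF p] e prime_gt_1_real[of p] by (intro ge_one_powr_ge_zero) auto
      then have "(h p)\<^sup>2 * (real p powr e - 1) \<ge> 0" by simp
      then show "0 \<le> 1 + h p * real p powr e \<and>
         1 + h p * real p powr e \<le> (1 + h p) * (1 + h p * (real p powr e - 1))"
        using h(1)[OF p] by (auto simp: algebra_simps power2_eq_square)
    qed
    also have "\<dots> = (\<Prod>p\<in>Q. 1 + h p) * (\<Prod>p\<in>Q. 1 + h p * (real p powr e - 1))"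
      by (simp add: prod.distrib)
    also have "\<dots> \<le> (\<Prod>p\<in>Q. 1 + h p) * exp (9 * B)"
    proof (rule mult_left_mono)
      have q1: "real p powr e - 1 \<le> 3 * e * ln p" "real p powr e \<ge> 1" if "p \<in> Q" for p
      proof -
        have p1: "real p > 1" "real p \<le> z" using Q(2)[OF that] prime_gt_1_real by auto
        then have l: "0 \<le> ln p" "ln p \<le> ln z" by auto
        have t: "0 \<le> e * ln p" "e * ln p \<le> 1" using l lz e by (auto simp: e_def)
        have "real p powr e = exp (e * ln p)" using p1 by (simp add: powr_def)
        \<comment> \<open>The choice e = 1 / ln z gives e ln p <= 1 for all p <= z, the range in
          which the exponential is bounded linearly.\<close>
        moreover have "exp (e * ln p) \<le> 1 + 3 * (e * ln p)"
        proof -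
          have "exp (e * ln p) \<le> 1 + e * ln p + (e * ln p)\<^sup>2" using t by (intro exp_bound) auto
          moreover have "(e * ln p)\<^sup>2 \<le> e * ln p" using t by (simp add: power2_eq_square mult_left_le)
          ultimately show ?thesis using t by linarith
        qed
        ultimately show "real p powr e - 1 \<le> 3 * e * ln p" by simp
        show "real p powr e \<ge> 1" using p1 e by (intro ge_one_powr_ge_zero) auto
      qed
      have "(\<Prod>p\<in>Q. 1 + h p * (real p powr e - 1)) \<le> exp (\<Sum>p\<in>Q. h p * (real p powr e - 1))"
        using h q1 by (intro prod_one_plus_le_exp) auto
      also have "(\<Sum>p\<in>Q. h p * (real p powr e - 1)) \<le> (\<Sum>p\<in>Q. (B / real p) * (3 * e * ln p))"
        using h q1 B by (intro sum_mono mult_mono) auto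
      also have "\<dots> = 3 * B * e * (\<Sum>p\<in>Q. ln p / real p)"
        by (simp add: sum_distrib_left mult_ac)
      also have "\<dots> \<le> 3 * B * e * (\<Sum>p\<in>{p::nat. prime p \<and> p \<le> nat \<lfloor>z\<rfloor>}. ln p / real p)"
      proof (intro mult_left_mono sum_mono2)
        show "Q \<subseteq> {p. prime p \<and> p \<le> nat \<lfloor>z\<rfloor>}" using Q(2) by (auto simp: le_nat_floor)
      qed (use B e in \<open>auto dest: prime_gt_1_nat\<close>)
      \<comment> \<open>One factor 3 comes from the linear bound for exp, the other from ln z + ln 4
        <= 3 ln z for z >= 2. This is the origin of 9 B.\<close>
      also have "\<dots> \<le> 3 * B * e * (3 * ln z)"
      proof (rule mult_left_mono)
        have "(\<Sum>p\<in>{p::nat. prime p \<and> p \<le> nat \<lfloor>z\<rfloor>}. ln p / real p) \<le> ln (real (nat \<lfloor>z\<rfloor>)) + ln 4"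
          using z by (intro sum_ln_primes_over_primes_le) (simp add: le_nat_floor)
        also have "ln (real (nat \<lfloor>z\<rfloor>)) \<le> ln z" using z by (intro ln_mono) auto
        also have "ln 4 = 2 * ln (2::real)" using ln_realpow[of 2 2] by simp
        also have "2 * ln 2 \<le> 2 * ln z" using z by simp
        finally show "(\<Sum>p\<in>{p::nat. prime p \<and> p \<le> nat \<lfloor>z\<rfloor>}. ln p / real p) \<le> 3 * ln z" by simp
      qed (use B e in auto)
      also have "\<dots> = 9 * B" using lz by (simp add: e_def)
      finally show "(\<Prod>p\<in>Q. 1 + h p * (real p powr e - 1)) \<le> exp (9 * B)" by simp
    qed (use h in \<open>auto intro!: prod_nonneg add_nonneg_nonneg\<close>)
    finally show "(\<Prod>p\<in>Q. 1 + h p * real p powr e) \<le> (\<Prod>p\<in>Q. 1 + h p) * exp (9 * B)" .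
  qed simp
  also have "\<dots> = (D powr (-e) * exp (9 * B)) * (\<Prod>p\<in>Q. 1 + h p)" by simp
  also have "\<dots> \<le> (1 / 2) * (\<Prod>p\<in>Q. 1 + h p)"
  proof (rule mult_right_mono)
    \<comment> \<open>The hypothesis on ln D exceeds 9 B ln z by one further ln z, which turns into
      exp (-1) <= 1/2.\<close>
    have "D powr (-e) * exp (9 * B) = exp (9 * B - ln D / ln z)"
      using D by (simp add: powr_def e_def exp_diff exp_minus field_simps)
    also have "\<dots> \<le> exp (-1)" using D(2) lz by (simp add: field_simps)
    also have "\<dots> \<le> 1 / 2"
      using exp_ge_add_one_self[of 1] by (simp add: exp_minus field_simps)
    finally show "D powr (-e) * exp (9 * B) \<le> 1 / 2" .
  qed (use h in \<open>auto intro!: prod_nonneg add_nonneg_nonneg\<close>)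
  finally have tail: "(\<Sum>T\<in>{T\<in>Pow Q. \<not> real (\<Prod>T) \<le> D}. ?H T) \<le> (1 / 2) * (\<Prod>p\<in>Q. 1 + h p)" .
  have "(\<Prod>p\<in>Q. 1 + h p) = (\<Sum>T\<in>Pow Q. ?H T)" by (rule prod_one_plus[OF Q(1)])
  also have "\<dots> = (\<Sum>T\<in>{T\<in>Pow Q. real (\<Prod>T) \<le> D}. ?H T) + (\<Sum>T\<in>{T\<in>Pow Q. \<not> real (\<Prod>T) \<le> D}. ?H T)"
    using Q(1) by (subst sum.union_disjoint[symmetric]) (auto intro!: sum.cong)
  finally show ?thesis using tail by simp
qed

section \<open>Subfields of the complex numbers\<close>

lemma subfield_CD:
  assumes "subfield_C K"
  shows "0 \<in> K" "1 \<in> K" "\<And>x y. x \<in> K \<Longrightarrow> y \<in> K \<Longrightarrow> x + y \<in> K"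
    "\<And>x y. x \<in> K \<Longrightarrow> y \<in> K \<Longrightarrow> x * y \<in> K" "\<And>x. x \<in> K \<Longrightarrow> - x \<in> K"
    "\<And>x. x \<in> K \<Longrightarrow> inverse x \<in> K" "\<And>x y. x \<in> K \<Longrightarrow> y \<in> K \<Longrightarrow> x - y \<in> K"
    "\<And>x y. x \<in> K \<Longrightarrow> y \<in> K \<Longrightarrow> x / y \<in> K"
proof -
  show 0: "0 \<in> K" "1 \<in> K" "\<And>x y. x \<in> K \<Longrightarrow> y \<in> K \<Longrightarrow> x + y \<in> K"
    "\<And>x y. x \<in> K \<Longrightarrow> y \<in> K \<Longrightarrow> x * y \<in> K" "\<And>x. x \<in> K \<Longrightarrow> - x \<in> K"
    using assms unfolding subfield_C_def by blast+
  show i: "inverse x \<in> K" if "x \<in> K" for x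
    using assms that unfolding subfield_C_def by (cases "x = 0") auto
  show "x - y \<in> K" if "x \<in> K" "y \<in> K" for x y using 0(3)[OF that(1) 0(5)[OF that(2)]] by simp
  show "x / y \<in> K" if "x \<in> K" "y \<in> K" for x y
    using 0(4)[OF that(1) i[OF that(2)]] by (simp add: divide_inverse)
qed

lemma subfield_C_sum:
  assumes "subfield_C K" "\<And>i. i \<in> A \<Longrightarrow> f i \<in> K"
  shows "sum f A \<in> K"
  using assms(2) by (induction A rule: infinite_finite_induct) (auto intro: subfield_CD[OF assms(1)])

lemma subfield_C_prod:
  assumes "subfield_C K" "\<And>i. i \<in> A \<Longrightarrow> f i \<in> K"
  shows "prod f A \<in> K"
  using assms(2) by (induction A rule: infinite_finite_induct) (auto intro: subfield_CD[OF assms(1)])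

lemma subfield_C_of_int: assumes "subfield_C K" shows "of_int n \<in> K"
proof -
  have *: "of_nat n \<in> K" for n by (induction n) (auto intro: subfield_CD[OF assms])
  show ?thesis by (cases n rule: int_cases2) (auto intro: * subfield_CD(5)[OF assms])
qed

lemma subfield_C_of_rat: assumes "subfield_C K" shows "of_rat q \<in> K"
proof (cases q)
  case (Fract a b)
  then show ?thesis
    by (auto simp: of_rat_rat intro!: subfield_CD(8)[OF assms] subfield_C_of_int[OF assms])
qed

text \<open>A subfield is a set of complex numbers here, so F[X] is carved out of the complex
  polynomials by a condition on coefficients.\<close>

definition coeffs_in :: "complex set \<Rightarrow> complex poly \<Rightarrow> bool" where
  "coeffs_in F p \<longleftrightarrow> (\<forall>i. coeff p i \<in> F)"

lemma coeffs_in_arith: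
  assumes "subfield_C F" "coeffs_in F p" "coeffs_in F q"
  shows "coeffs_in F (p + q)" "coeffs_in F (p - q)" "coeffs_in F (p * q)"
  using assms unfolding coeffs_in_def
  by (auto simp: coeff_mult intro!: subfield_CD[OF assms(1)] subfield_C_sum[OF assms(1)])

lemma coeffs_in_pCons:
  assumes "c \<in> F" "coeffs_in F p" shows "coeffs_in F (pCons c p)"
  using assms by (auto simp: coeffs_in_def coeff_pCons split: nat.split)

lemma coeffs_in_0: "subfield_C F \<Longrightarrow> coeffs_in F 0"
  by (simp add: coeffs_in_def subfield_CD)

lemma coeffs_in_monom: "subfield_C F \<Longrightarrow> c \<in> F \<Longrightarrow> coeffs_in F (monom c n)"
  by (simp add: coeffs_in_def subfield_CD)

lemma coeffs_in_pcompose: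
  assumes F: "subfield_C F" and p: "coeffs_in F p" and q: "coeffs_in F q"
  shows "coeffs_in F (pcompose p q)"
  using p
proof (induction p)
  case (pCons a p)
  have "a \<in> F" "coeffs_in F p" using pCons.prems by (auto simp: coeffs_in_def coeff_pCons split: nat.splits)
  then show ?case using pCons.IH F q
    by (auto simp: pcompose_pCons intro!: coeffs_in_arith coeffs_in_pCons coeffs_in_0)
qed (simp add: coeffs_in_0 F)

text \<open>Long division: subtracting a monomial multiple of q, with coefficient in F, cancels the
  leading term of p and never leaves F[X].\<close>

lemma coeffs_in_division:
  assumes F: "subfield_C F" and q: "coeffs_in F q" "q \<noteq> 0" and p: "coeffs_in F p"
  shows "\<exists>s r. coeffs_in F r \<and> p = s * q + r \<and> (r = 0 \<or> degree r < degree q)"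
  using p
proof (induction "degree p" arbitrary: p rule: less_induct)
  case less
  show ?case
  proof (cases "p = 0 \<or> degree p < degree q")
    case True then show ?thesis using less.prems by (intro exI[of _ 0] exI[of _ p]) auto
  next
    case False
    define c where "c = lead_coeff p / lead_coeff q"
    define t where "t = monom c (degree p - degree q)"
    have c: "c \<in> F" "c \<noteq> 0" using less.prems q False
      by (auto simp: c_def coeffs_in_def intro!: subfield_CD(8)[OF F])
    have deg: "degree (t * q) = degree p"
      using c False q by (simp add: t_def degree_mult_eq degree_monom_eq monom_eq_0_iff)
    have lc: "lead_coeff (t * q) = lead_coeff p"
    proof -
      have "lead_coeff t = c" using c(2) by (simp add: t_def degree_monom_eq)
      then show ?thesis using q by (simp add: lead_coeff_mult c_def)
    qed
    have pr: "coeffs_in F (p - t * q)" using less.prems q c F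
      by (auto simp: t_def intro!: coeffs_in_arith coeffs_in_monom)
    show ?thesis
    proof (cases "p - t * q = 0")
      case True
      then show ?thesis using F by (intro exI[of _ t] exI[of _ 0]) (auto intro: coeffs_in_0)
    next
      case nz: False
      have "degree (p - t * q) < degree p"
      proof (rule le_neq_trans)
        show "degree (p - t * q) \<le> degree p" using degree_diff_le[of p "degree p" "t * q"] deg by simp
        show "degree (p - t * q) \<noteq> degree p"
        proof
          assume "degree (p - t * q) = degree p"
          moreover have "coeff (p - t * q) (degree p) = 0" using lc deg by simp
          ultimately show False using nz by (metis leading_coeff_0_iff)
        qed
      qed
      from less.hyps[OF this pr] obtain s r where "coeffs_in F r" "p - t * q = s * q + r"
        "r = 0 \<or> degree r < degree q" by blast
      then show ?thesis by (intro exI[of _ "s + t"] exI[of _ r]) (auto simp: algebra_simps)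
    qed
  qed
qed

lemma minimal_poly_over_subfield:
  assumes F: "subfield_C F" and "\<exists>p. coeffs_in F p \<and> p \<noteq> 0 \<and> poly p x = 0"
  obtains m where "coeffs_in F m" "m \<noteq> 0" "poly m x = 0"
    "\<And>p. coeffs_in F p \<Longrightarrow> poly p x = 0 \<Longrightarrow> m dvd p"
proof -
  obtain m where m: "coeffs_in F m \<and> m \<noteq> 0 \<and> poly m x = 0"
    and min: "\<And>p. coeffs_in F p \<and> p \<noteq> 0 \<and> poly p x = 0 \<Longrightarrow> degree m \<le> degree p"
    using exists_least_lemma ex_has_least_nat[of "\<lambda>p. coeffs_in F p \<and> p \<noteq> 0 \<and> poly p x = 0" _ degree]
      assms(2) by metis
  show ?thesis
  proof
    fix p assume p: "coeffs_in F p" "poly p x = 0"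
    obtain s r where sr: "coeffs_in F r" "p = s * m + r" "r = 0 \<or> degree r < degree m"
      using coeffs_in_division[OF F _ _ p(1), of m] m by blast
    have "poly r x = 0" using sr(2) p(2) m by simp
    moreover have "degree m \<le> degree r" if "r \<noteq> 0" "poly r x = 0" using min[of r] sr(1) that by auto
    ultimately have "r = 0" using sr(3) by fastforce
    then show "m dvd p" using sr by simp
  qed (use m in auto)
qed

section \<open>Evaluation of rational polynomials\<close>

text \<open>Rational polynomials keep their own type, so that irreducibility and divisibility are
  those of \<open>rat poly\<close>; complex numbers enter only through evaluation.\<close>

definition qeval :: "rat poly \<Rightarrow> complex \<Rightarrow> complex" where
  "qeval h z = poly (map_poly of_rat h) z"

interpretation of_rat_poly: map_poly_inj_idom_hom "of_rat :: rat \<Rightarrow> complex" ..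

lemma qeval_simps [simp]:
  "qeval (g + h) z = qeval g z + qeval h z" "qeval (g - h) z = qeval g z - qeval h z"
  "qeval (g * h) z = qeval g z * qeval h z" "qeval 0 z = 0" "qeval 1 z = 1"
  "qeval (pCons c h) z = of_rat c + z * qeval h z"
  by (simp_all add: qeval_def hom_distribs)

lemma coeffs_in_map_of_rat: "subfield_C F \<Longrightarrow> coeffs_in F (map_poly of_rat h)"
  by (simp add: coeffs_in_def subfield_C_of_rat)

lemma map_poly_of_rat_eq_0_iff [simp]: "map_poly (of_rat :: rat \<Rightarrow> complex) h = 0 \<longleftrightarrow> h = 0"
  by (simp add: poly_eq_iff)

lemma qeval_in_subfield:
  assumes "subfield_C K" "z \<in> K" shows "qeval h z \<in> K"
proof (induction h)
  case (pCons c h)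
  then show ?case using assms by (auto intro!: subfield_CD[OF assms(1)] subfield_C_of_rat)
qed (use assms in \<open>simp add: subfield_CD\<close>)

lemma minimal_rat_annihilator:
  assumes "h \<noteq> 0" "qeval h x = 0"
  obtains f where "f \<noteq> 0" "qeval f x = 0" "\<And>g. qeval g x = 0 \<Longrightarrow> f dvd g"
proof -
  obtain f where f: "f \<noteq> 0 \<and> qeval f x = 0"
    and min: "\<And>h. h \<noteq> 0 \<and> qeval h x = 0 \<Longrightarrow> degree f \<le> degree h"
    using ex_has_least_nat[of "\<lambda>h. h \<noteq> 0 \<and> qeval h x = 0" h degree] assms by metis
  show ?thesis
  proof
    fix g assume g: "qeval g x = 0"
    have "qeval (g div f * f + g mod f) x = 0" using g by (simp only: div_mult_mod_eq)
    then have "qeval (g mod f) x = 0" using f by (simp only: qeval_simps) simp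
    moreover have "g mod f = 0 \<or> degree (g mod f) < degree f" using f by (intro degree_mod_less) auto
    ultimately have "g mod f = 0" using min[of "g mod f"] by fastforce
    then show "f dvd g" by (simp add: dvd_eq_mod_eq_0)
  qed (use f in auto)
qed

lemma qeval_unit_nonzero: assumes "f dvd 1" shows "qeval f x \<noteq> 0"
proof
  assume "qeval f x = 0"
  obtain g where "1 = f * g" using assms by (elim dvdE)
  then have "qeval (f * g) x = 1" by (metis qeval_simps(5))
  with \<open>qeval f x = 0\<close> show False by simp
qed

text \<open>A minimal annihilator of z divides f and, having a zero, is not a unit. By
  irreducibility it is associated to f, and it divides h.\<close>

lemma irreducible_dvd_of_common_root:
  fixes f h :: "rat poly"
  assumes f: "irreducible f" "qeval f z = 0" and h: "qeval h z = 0"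
  shows "f dvd h"
proof -
  have "f \<noteq> 0" using f by auto
  then obtain m where m: "m \<noteq> 0" "qeval m z = 0" "\<And>g. qeval g z = 0 \<Longrightarrow> m dvd g"
    using minimal_rat_annihilator[OF _ f(2)] by blast
  obtain g where g: "f = m * g" using m(3)[OF f(2)] by (elim dvdE)
  have "\<not> m dvd 1" using qeval_unit_nonzero m(2) by blast
  then have "g dvd 1" using irreducibleD[OF f(1) g] by blast
  then have "f dvd m" unfolding g by (simp add: mult_unit_dvd_iff)
  also have "m dvd h" by (rule m(3)[OF h])
  finally show ?thesis .
qed

lemma exists_irreducible_annihilator:
  assumes "\<exists>h. h \<noteq> 0 \<and> qeval h x = 0"
  obtains f where "irreducible f" "qeval f x = 0"
proof -
  obtain f where f: "f \<noteq> 0" "qeval f x = 0" "\<And>g. qeval g x = 0 \<Longrightarrow> f dvd g"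
    using minimal_rat_annihilator assms by metis
  have "irreducible f"
  proof (rule irreducibleI)
    show "\<not> f dvd 1" using qeval_unit_nonzero f(2) by blast
    fix a b assume ab: "f = a * b"
    then have ab0: "a \<noteq> 0" "b \<noteq> 0" using f by auto
    have unit: "c dvd 1" if "d \<noteq> 0" "qeval d x = 0" "f = c * d" "c \<noteq> 0" for c d
    proof -
      have "degree f \<le> degree d" using f(3)[OF that(2)] that(1) by (rule dvd_imp_degree_le)
      then have "degree c = 0" using that by (simp add: degree_mult_eq)
      then show ?thesis using that by (simp add: is_unit_iff_degree)
    qed
    have "qeval a x = 0 \<or> qeval b x = 0" using f ab by simp
    then show "a dvd 1 \<or> b dvd 1" using unit[of b a] unit[of a b] ab ab0 by (auto simp: mult.commute)
  qed (use f in auto)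
  then show ?thesis using f that by blast
qed

lemma irreducible_pderiv_root:
  assumes f: "irreducible f" "qeval f z = 0"
  shows "qeval (pderiv f) z \<noteq> 0"
proof
  assume "qeval (pderiv f) z = 0"
  then have "f dvd pderiv f" using f by (intro irreducible_dvd_of_common_root)
  moreover have "degree f \<noteq> 0"
    using f(1) by (metis irreducible_not_unit is_unit_iff_degree irreducible_def)
  ultimately show False by (meson not_dvd_pderiv)
qed

lemma irreducible_rsquarefree:
  assumes "irreducible f" shows "rsquarefree (map_poly (of_rat :: rat \<Rightarrow> complex) f)"
  unfolding rsquarefree_roots
proof safe
  fix a :: complex assume "poly (map_poly of_rat f) a = 0" "poly (pderiv (map_poly of_rat f)) a = 0"
  then have "qeval f a = 0" "qeval (pderiv f) a = 0" by (simp_all add: qeval_def of_rat_hom.map_poly_pderiv)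
  then show False using irreducible_pderiv_root assms by blast
qed

text \<open>By separability the complex factorisation of f has distinct linear factors only.\<close>

lemma card_roots_irreducible:
  assumes "irreducible f"
  shows "card {z. qeval f z = 0} = degree f" "finite {z. qeval f z = 0}"
proof -
  let ?p = "map_poly of_rat f :: complex poly"
  have nz: "?p \<noteq> 0" using assms by auto
  show fin: "finite {z. qeval f z = 0}" unfolding qeval_def using nz by (rule poly_roots_finite)
  have "Polynomial.smult (lead_coeff ?p) (\<Prod>z|poly ?p z = 0. [:-z, 1:]) = ?p"
    by (rule complex_poly_decompose_rsquarefree[OF irreducible_rsquarefree[OF assms]])
  then have "degree ?p = degree (Polynomial.smult (lead_coeff ?p) (\<Prod>z|poly ?p z = 0. [:-z, 1:]))" by simp
  also have "\<dots> = degree (\<Prod>z|poly ?p z = 0. [:-z, 1:])" using nz by simp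
  also have "\<dots> = card {z. poly ?p z = 0}"
    by (subst degree_prod_eq_sum_degree) auto
  finally show "card {z. qeval f z = 0} = degree f" by (simp add: qeval_def)
qed

section \<open>The primitive element theorem\<close>

lemma qeval_qeval: "qeval g (qeval h z) = qeval (pcompose g h) z"
  by (simp add: qeval_def of_rat_hom.map_poly_pcompose poly_pcompose)

text \<open>For y nonzero an irreducible annihilator has a nonzero constant coefficient; solving the
  relation for that coefficient writes the inverse as a polynomial in y.\<close>

lemma inverse_eq_qeval:
  assumes "\<exists>h. h \<noteq> 0 \<and> qeval h y = 0"
  shows "\<exists>v. inverse y = qeval v y"
proof (cases "y = 0")
  case False
  obtain g where g: "irreducible g" "qeval g y = 0" using exists_irreducible_annihilator[OF assms] .
  obtain a g' where g': "g = pCons a g'" by (cases g)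
  have "a \<noteq> 0"
  proof
    assume "a = 0"
    then have "qeval g' y = 0" "g' \<noteq> 0" using g False g' by auto
    then have "degree g \<le> degree g'" using irreducible_dvd_of_common_root[OF g] by (intro dvd_imp_degree_le)
    then show False using \<open>g' \<noteq> 0\<close> by (simp add: g')
  qed
  moreover have "of_rat a + y * qeval g' y = 0" using g by (simp add: g')
  ultimately have "inverse y = qeval g' y * of_rat (- 1 / a)"
    using False by (simp add: field_simps of_rat_divide of_rat_minus eq_neg_iff_add_eq_0)
  then have "inverse y = qeval (g' * [:- 1 / a:]) y" by (simp only: qeval_simps) simp
  then show ?thesis by blast
qed (auto intro!: exI[of _ 0])

lemma subfield_range_qeval:
  assumes "\<And>h. \<exists>g. g \<noteq> 0 \<and> qeval g (qeval h x) = 0"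
  shows "subfield_C (range (\<lambda>h. qeval h x))"
proof -
  have "inverse (qeval h x) \<in> range (\<lambda>h. qeval h x)" for h
    using inverse_eq_qeval[OF assms[of h]] qeval_qeval by (metis rangeI)
  moreover have "qeval g x + qeval h x \<in> range (\<lambda>h. qeval h x)" for g h
    by (metis qeval_simps(1) rangeI)
  moreover have "qeval g x * qeval h x \<in> range (\<lambda>h. qeval h x)" for g h
    by (metis qeval_simps(3) rangeI)
  moreover have "- qeval g x \<in> range (\<lambda>h. qeval h x)" for g
    by (metis qeval_simps(2,4) rangeI diff_0)
  moreover have "0 \<in> range (\<lambda>h. qeval h x)" "1 \<in> range (\<lambda>h. qeval h x)"
    by (metis qeval_simps(4) rangeI, metis qeval_simps(5) rangeI)
  ultimately show ?thesis unfolding subfield_C_def by auto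
qed

lemma exists_rat_notin_finite:
  fixes S :: "complex set" assumes "finite S" shows "\<exists>c::rat. of_rat c \<notin> S"
proof (rule ccontr)
  assume "\<not> ?thesis"
  then have "range (of_rat :: rat \<Rightarrow> complex) \<subseteq> S" by auto
  then have "finite (range (of_rat :: rat \<Rightarrow> complex))" using assms finite_subset by blast
  then have "finite (UNIV :: rat set)" by (rule finite_imageD) (simp add: inj_def)
  then show False using infinite_UNIV_char_0 by blast
qed

text \<open>The classical \<gamma> = \<alpha> + c \<beta>. The minimal polynomial of \<beta> over
  Q(\<gamma>) divides both g and f(\<gamma> - c X). The choice of c leaves \<beta> as their only
  common zero, and g has simple zeros, so this minimal polynomial is linear and its coefficients
  place \<beta> in Q(\<gamma>).\<close>

lemma primitive_element_two:
  assumes K: "subfield_C K" and alg: "\<And>x. x \<in> K \<Longrightarrow> \<exists>h. h \<noteq> 0 \<and> qeval h x = 0"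
    and ab: "\<alpha> \<in> K" "\<beta> \<in> K"
  shows "\<exists>\<gamma>\<in>K. (\<exists>h. \<alpha> = qeval h \<gamma>) \<and> (\<exists>h. \<beta> = qeval h \<gamma>)"
proof -
  obtain f where f: "irreducible f" "qeval f \<alpha> = 0" using exists_irreducible_annihilator[OF alg[OF ab(1)]] .
  obtain g where g: "irreducible g" "qeval g \<beta> = 0" using exists_irreducible_annihilator[OF alg[OF ab(2)]] .
  \<comment> \<open>For b = \<beta> the quotient is 0 by convention; that c avoids this value as
    well does no harm.\<close>
  have "finite ((\<lambda>(a, b). (a - \<alpha>) / (\<beta> - b)) ` ({z. qeval f z = 0} \<times> {z. qeval g z = 0}))"
    using card_roots_irreducible f g by blast
  then obtain c :: rat where c0: "of_rat c \<notin> (\<lambda>(a, b). (a - \<alpha>) / (\<beta> - b)) ` ({z. qeval f z = 0} \<times> {z. qeval g z = 0})"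
    using exists_rat_notin_finite by blast
  have c: "of_rat c * (\<beta> - b) \<noteq> a - \<alpha>" if "qeval f a = 0" "qeval g b = 0" "b \<noteq> \<beta>" for a b
  proof
    assume "of_rat c * (\<beta> - b) = a - \<alpha>"
    then have "of_rat c = (a - \<alpha>) / (\<beta> - b)" using that(3) by (simp add: field_simps)
    then show False using c0 that by (auto simp: image_iff)
  qed
  define \<gamma> where "\<gamma> = \<alpha> + of_rat c * \<beta>"
  have \<gamma>: "\<gamma> \<in> K" unfolding \<gamma>_def by (intro subfield_CD[OF K] ab subfield_C_of_rat K)
  define F where "F = range (\<lambda>h. qeval h \<gamma>)"
  have F: "subfield_C F" unfolding F_def by (intro subfield_range_qeval alg qeval_in_subfield K \<gamma>)
  have \<gamma>F: "\<gamma> \<in> F" unfolding F_def by (rule range_eqI[of _ _ "[:0, 1:]"]) simp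
  define p1 where "p1 = (map_poly of_rat g :: complex poly)"
  define p2 where "p2 = pcompose (map_poly of_rat f) [:\<gamma>, - of_rat c:]"
  have p1: "coeffs_in F p1" "p1 \<noteq> 0" "poly p1 \<beta> = 0"
    using F g by (auto simp: p1_def qeval_def coeffs_in_map_of_rat)
  have "coeffs_in F [:\<gamma>, - of_rat c:]"
    by (intro coeffs_in_pCons coeffs_in_0 F \<gamma>F subfield_CD[OF F] subfield_C_of_rat)
  then have p2: "coeffs_in F p2" unfolding p2_def
    by (intro coeffs_in_pcompose F coeffs_in_map_of_rat)
  have p2b: "poly p2 b = qeval f (\<gamma> - of_rat c * b)" for b
    by (simp add: p2_def poly_pcompose qeval_def algebra_simps)
  have p2\<beta>: "poly p2 \<beta> = 0" using f by (simp add: p2b \<gamma>_def)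
  obtain m where m: "coeffs_in F m" "m \<noteq> 0" "poly m \<beta> = 0"
    "\<And>p. coeffs_in F p \<Longrightarrow> poly p \<beta> = 0 \<Longrightarrow> m dvd p"
    using minimal_poly_over_subfield[OF F, of \<beta>] p1 by metis
  have dv: "m dvd p1" "m dvd p2" using m(4) p1 p2 p2\<beta> by auto
  have root: "b = \<beta>" if "poly m b = 0" for b
  proof (rule ccontr)
    assume "b \<noteq> \<beta>"
    have "poly p1 b = 0" "poly p2 b = 0" using dv that by (auto elim!: dvdE)
    then have "qeval g b = 0" "qeval f (\<gamma> - of_rat c * b) = 0" by (simp_all add: p1_def qeval_def p2b[unfolded qeval_def])
    then show False using c[of "\<gamma> - of_rat c * b" b] \<open>b \<noteq> \<beta>\<close> by (simp add: \<gamma>_def algebra_simps)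
  qed
  obtain m' where m': "m = [:-\<beta>, 1:] * m'" using m(3) by (auto simp: poly_eq_0_iff_dvd)
  \<comment> \<open>A further zero of m could only be \<beta> again, and a double zero of g
    contradicts separability.\<close>
  have "degree m' = 0"
  proof (rule ccontr)
    assume "degree m' \<noteq> 0"
    then have "\<not> constant (poly m')" by (simp add: constant_degree)
    then obtain b where "poly m' b = 0" using fundamental_theorem_of_algebra by blast
    moreover from this have "b = \<beta>" using root[of b] by (simp add: m')
    ultimately obtain m'' where "m' = [:-\<beta>, 1:] * m''" by (auto simp: poly_eq_0_iff_dvd)
    then obtain r where "p1 = [:-\<beta>, 1:] * ([:-\<beta>, 1:] * r)" using dv(1) m' by (metis dvdE mult.assoc)
    then have "poly (pderiv p1) \<beta> = 0" by (simp only: pderiv_mult poly_add poly_mult) simp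
    then have "qeval (pderiv g) \<beta> = 0" by (simp add: p1_def qeval_def of_rat_hom.map_poly_pderiv)
    then show False using irreducible_pderiv_root[OF g] by blast
  qed
  then obtain e where e: "m' = [:e:]" by (rule degree_eq_zeroE)
  have "e \<noteq> 0" using m(2) m' e by auto
  moreover have "coeff m 0 = - \<beta> * e" "coeff m 1 = e" by (simp_all add: m' e)
  ultimately have "\<beta> = - coeff m 0 / coeff m 1" by simp
  moreover have "- coeff m 0 / coeff m 1 \<in> F" using m(1) unfolding coeffs_in_def by (intro subfield_CD[OF F]) auto
  ultimately have \<beta>F: "\<beta> \<in> F" by simp
  moreover have "\<alpha> \<in> F"
  proof -
    have "\<gamma> - of_rat c * \<beta> \<in> F" by (intro subfield_CD[OF F] \<gamma>F \<beta>F subfield_C_of_rat F)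
    then show ?thesis by (simp add: \<gamma>_def)
  qed
  ultimately show ?thesis using \<gamma> unfolding F_def by blast
qed

section \<open>Eigenvalues of multiplication matrices\<close>

text \<open>The hypothesis says that the vector of the list \<open>ws\<close> is an eigenvector of A
  with eigenvalue x. Over the integers this proves integrality, over the rationals
  algebraicity.\<close>

lemma char_poly_root_of_multiplication:
  fixes A :: "complex mat" and ws :: "complex list"
  assumes A: "A \<in> carrier_mat (length ws) (length ws)"
    and mult: "\<And>i. i < length ws \<Longrightarrow> x * ws ! i = (\<Sum>j<length ws. A $$ (i, j) * ws ! j)"
    and nz: "\<exists>w\<in>set ws. w \<noteq> 0"
  shows "poly (char_poly A) x = 0"
proof -
  define v where "v = vec_of_list ws"
  have "A *\<^sub>v v = x \<cdot>\<^sub>v v"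
  proof (rule eq_vecI)
    fix i assume "i < dim_vec (x \<cdot>\<^sub>v v)"
    then have i: "i < length ws" by (simp add: v_def)
    have "(A *\<^sub>v v) $ i = (\<Sum>j<length ws. A $$ (i, j) * ws ! j)"
      using A i by (simp add: v_def scalar_prod_def vec_of_list_index atLeast0LessThan)
    then show "(A *\<^sub>v v) $ i = (x \<cdot>\<^sub>v v) $ i" using mult[OF i] i by (simp add: v_def vec_of_list_index)
  qed (use A in \<open>simp add: v_def\<close>)
  moreover have "v \<noteq> 0\<^sub>v (length ws)"
  proof
    assume "v = 0\<^sub>v (length ws)"
    then have "ws ! i = 0" if "i < length ws" for i using that by (metis v_def vec_of_list_index index_zero_vec(1))
    then show False using nz by (auto simp: in_set_conv_nth)
  qed
  moreover have "v \<in> carrier_vec (length ws)" by (auto simp: v_def intro!: carrier_vecI)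
  ultimately have "eigenvector A v x" using A by (simp add: eigenvector_def)
  then have "eigenvalue A x" by (auto simp: eigenvalue_def)
  then show ?thesis using eigenvalue_root_char_poly[OF A] by simp
qed

lemma algebraic_int_of_multiplication:
  fixes c :: "nat \<Rightarrow> nat \<Rightarrow> int"
  assumes mult: "\<And>i. i < length ws \<Longrightarrow> x * ws ! i = (\<Sum>j<length ws. of_int (c i j) * ws ! j)"
    and nz: "\<exists>w\<in>set ws. w \<noteq> 0"
  shows "algebraic_int (x :: complex)"
proof -
  define B where "B = mat (length ws) (length ws) (\<lambda>(i, j). c i j)"
  have B: "B \<in> carrier_mat (length ws) (length ws)" by (simp add: B_def)
  have "poly (char_poly (map_mat of_int B)) x = 0"
    by (rule char_poly_root_of_multiplication[OF _ _ nz]) (auto simp: B_def mult)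
  then have "poly (map_poly of_int (char_poly B)) x = 0"
    by (simp add: of_int_hom.char_poly_hom[OF B])
  moreover have "lead_coeff (char_poly B) = 1" using degree_monic_char_poly[OF B] by simp
  ultimately show ?thesis unfolding algebraic_int_altdef_ipoly by blast
qed

lemma common_denominator:
  assumes "finite (S :: rat set)"
  shows "\<exists>D::int. D > 0 \<and> (\<forall>q\<in>S. of_int D * q \<in> \<int>)"
  using assms
proof (induction S rule: finite_induct)
  case empty then show ?case by (intro exI[of _ 1]) auto
next
  case (insert q S)
  then obtain D where D: "D > 0" "\<forall>q\<in>S. of_int D * q \<in> \<int>" by blast
  obtain a b where ab: "q = Rat.Fract a b" "b > 0" by (cases q)
  show ?case
  proof (intro exI[of _ "b * D"] conjI ballI)
    show "b * D > 0" using ab D by simp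
    fix r assume "r \<in> insert q S"
    then show "of_int (b * D) * r \<in> \<int>"
    proof
      assume "r = q"
      then have "of_int (b * D) * r = of_int (D * a)" using ab by (simp add: Fract_of_int_quotient)
      then show ?thesis by (metis Ints_of_int)
    next
      assume "r \<in> S"
      then have "of_int D * r \<in> \<int>" using D by blast
      from Ints_mult[OF Ints_of_int this, of b] show ?thesis by (simp add: mult.assoc)
    qed
  qed
qed

lemma rat_basis_multiplication_matrix:
  assumes K: "subfield_C K" and ws: "rat_basis K ws" and x: "x \<in> K"
  obtains a :: "nat \<Rightarrow> nat \<Rightarrow> rat" where
    "\<And>i. i < length ws \<Longrightarrow> x * ws ! i = (\<Sum>j<length ws. of_rat (a i j) * ws ! j)"
proof -
  have "\<forall>i. \<exists>c::nat \<Rightarrow> rat. i < length ws \<longrightarrow> x * ws ! i = (\<Sum>j<length ws. of_rat (c j) * ws ! j)"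
  proof
    fix i
    show "\<exists>c::nat \<Rightarrow> rat. i < length ws \<longrightarrow> x * ws ! i = (\<Sum>j<length ws. of_rat (c j) * ws ! j)"
    proof (cases "i < length ws")
      case True
      then have "ws ! i \<in> K" using ws by (auto simp: rat_basis_def)
      then have "x * ws ! i \<in> K" using x subfield_CD(4)[OF K] by blast
      then show ?thesis using ws by (auto simp: rat_basis_def)
    qed auto
  qed
  then obtain a where "\<And>i. i < length ws \<longrightarrow> x * ws ! i = (\<Sum>j<length ws. of_rat (a i j :: rat) * ws ! j)"
    by metis
  then show ?thesis using that by blast
qed

lemma rat_basis_nonzero:
  assumes K: "subfield_C K" and ws: "rat_basis K ws"
  shows "\<exists>w\<in>set ws. w \<noteq> 0"
proof (rule ccontr)
  assume "\<not> ?thesis"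
  then have z: "ws ! i = 0" if "i < length ws" for i using that by auto
  obtain c :: "nat \<Rightarrow> rat" where "1 = (\<Sum>i<length ws. of_rat (c i) * ws ! i)"
    using ws subfield_CD(2)[OF K] unfolding rat_basis_def by blast
  then show False using z by simp
qed

text \<open>Multiplication by x has a rational matrix in the basis; a common denominator D of its
  entries makes the matrix of D x integral.\<close>

lemma exists_integral_multiple:
  assumes K: "subfield_C K" and ws: "rat_basis K ws" and x: "x \<in> K"
  shows "\<exists>D::int. D > 0 \<and> algebraic_int (of_int D * x)"
proof -
  obtain a :: "nat \<Rightarrow> nat \<Rightarrow> rat" where
    a: "\<And>i. i < length ws \<Longrightarrow> x * ws ! i = (\<Sum>j<length ws. of_rat (a i j) * ws ! j)"
    using rat_basis_multiplication_matrix[OF assms] by blast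
  have "finite ((\<lambda>(i,j). a i j) ` ({..<length ws} \<times> {..<length ws}))" by simp
  then obtain D :: int where D: "D > 0"
    "\<forall>q\<in>(\<lambda>(i,j). a i j) ` ({..<length ws} \<times> {..<length ws}). of_int D * q \<in> \<int>"
    using common_denominator by blast
  define c where "c i j = \<lfloor>of_int D * a i j\<rfloor>" for i j
  have c: "of_int (c i j) = (of_int D * of_rat (a i j) :: complex)" if "i < length ws" "j < length ws" for i j
  proof -
    have "of_int D * a i j \<in> \<int>" using D(2) that by auto
    then have "of_int (c i j) = of_int D * a i j" by (simp add: c_def)
    then have "of_rat (of_int (c i j)) = (of_rat (of_int D * a i j) :: complex)" by simp
    then show ?thesis by (simp add: of_rat_mult)
  qed
  have "algebraic_int (of_int D * x)"
  proof (rule algebraic_int_of_multiplication[where ws = ws and c = c])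
    fix i assume i: "i < length ws"
    have "of_int D * x * ws ! i = of_int D * (\<Sum>j<length ws. of_rat (a i j) * ws ! j)"
      using a[OF i] by (simp add: mult.assoc)
    also have "\<dots> = (\<Sum>j<length ws. of_int (c i j) * ws ! j)"
      unfolding sum_distrib_left using i by (intro sum.cong) (auto simp: c mult_ac)
    finally show "of_int D * x * ws ! i = (\<Sum>j<length ws. of_int (c i j) * ws ! j)" .
  qed (rule rat_basis_nonzero[OF K ws])
  with D show ?thesis by blast
qed

lemma rat_basis_algebraic:
  assumes K: "subfield_C K" and ws: "rat_basis K ws" and x: "x \<in> K"
  shows "\<exists>h. h \<noteq> 0 \<and> qeval h x = 0"
proof -
  obtain a :: "nat \<Rightarrow> nat \<Rightarrow> rat" where
    a: "\<And>i. i < length ws \<Longrightarrow> x * ws ! i = (\<Sum>j<length ws. of_rat (a i j) * ws ! j)"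
    using rat_basis_multiplication_matrix[OF assms] by blast
  define B where "B = mat (length ws) (length ws) (\<lambda>(i, j). a i j)"
  have B: "B \<in> carrier_mat (length ws) (length ws)" by (simp add: B_def)
  have "poly (char_poly (map_mat of_rat B)) x = 0"
    by (rule char_poly_root_of_multiplication[OF _ _ rat_basis_nonzero[OF K ws]]) (auto simp: B_def a)
  then have "qeval (char_poly B) x = 0"
    by (simp add: of_rat_hom.char_poly_hom[OF B] qeval_def)
  moreover have "char_poly B \<noteq> 0" using degree_monic_char_poly[OF B] by auto
  ultimately show ?thesis by blast
qed

text \<open>Absorbs the elements of a rational basis one after the other by
  \<open>primitive_element_two\<close>.\<close>

theorem primitive_element:
  assumes "number_field K"
  shows "\<exists>\<theta>\<in>K. \<forall>x\<in>K. \<exists>h. x = qeval h \<theta>"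
proof -
  obtain ws where K: "subfield_C K" and ws: "rat_basis K ws" using assms unfolding number_field_def by blast
  note alg = rat_basis_algebraic[OF K ws]
  have "k \<le> length ws \<Longrightarrow> \<exists>\<theta>\<in>K. \<forall>i<k. \<exists>h. ws ! i = qeval h \<theta>" for k
  proof (induction k)
    case 0 then show ?case using subfield_CD(1)[OF K] by auto
  next
    case (Suc k)
    then obtain \<theta> where \<theta>: "\<theta> \<in> K" "\<And>i. i < k \<Longrightarrow> \<exists>h. ws ! i = qeval h \<theta>" by auto
    have "ws ! k \<in> K" using ws Suc.prems by (auto simp: rat_basis_def)
    from primitive_element_two[OF K alg \<theta>(1) this] obtain \<gamma> g h
      where \<gamma>: "\<gamma> \<in> K" "\<theta> = qeval g \<gamma>" "ws ! k = qeval h \<gamma>" by blast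
    have "\<exists>h. ws ! i = qeval h \<gamma>" if i: "i < Suc k" for i
    proof (cases "i = k")
      case False
      then obtain h where "ws ! i = qeval h \<theta>" using \<theta>(2)[of i] i by auto
      then show ?thesis using \<gamma>(2) qeval_qeval by metis
    qed (use \<gamma> in auto)
    then show ?case using \<gamma>(1) by blast
  qed
  from this[of "length ws"] obtain \<theta> where \<theta>: "\<theta> \<in> K" "\<And>i. i < length ws \<Longrightarrow> \<exists>h. ws ! i = qeval h \<theta>" by auto
  have F: "subfield_C (range (\<lambda>h. qeval h \<theta>))" by (intro subfield_range_qeval alg qeval_in_subfield K \<theta>(1))
  have "x \<in> range (\<lambda>h. qeval h \<theta>)" if x: "x \<in> K" for x
  proof -
    obtain c :: "nat \<Rightarrow> rat" where c: "x = (\<Sum>i<length ws. of_rat (c i) * ws ! i)"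
      using ws x unfolding rat_basis_def by blast
    show ?thesis unfolding c
      using \<theta>(2) by (intro subfield_C_sum[OF F] subfield_CD(4)[OF F] subfield_C_of_rat[OF F]) auto
  qed
  then show ?thesis using \<theta>(1) by blast
qed

section \<open>Algebraic integers\<close>

definition zspan :: "complex set \<Rightarrow> complex set" where
  "zspan W = {\<Sum>w\<in>W. of_int (c w) * w | c. True}"

lemma zspanI: "x = (\<Sum>w\<in>W. of_int (c w) * w) \<Longrightarrow> x \<in> zspan W"
  unfolding zspan_def by blast

lemma zspan_0: "0 \<in> zspan W"
  by (rule zspanI[where c = "\<lambda>_. 0"]) simp

lemma zspan_add: "x \<in> zspan W \<Longrightarrow> y \<in> zspan W \<Longrightarrow> x + y \<in> zspan W"
proof -
  assume "x \<in> zspan W" "y \<in> zspan W"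
  then obtain c d where "x = (\<Sum>w\<in>W. of_int (c w) * w)" "y = (\<Sum>w\<in>W. of_int (d w) * w)"
    unfolding zspan_def by blast
  then show "x + y \<in> zspan W"
    by (intro zspanI[where c = "\<lambda>w. c w + d w"]) (simp add: sum.distrib algebra_simps)
qed

lemma zspan_scale: "x \<in> zspan W \<Longrightarrow> of_int n * x \<in> zspan W"
proof -
  assume "x \<in> zspan W"
  then obtain c where "x = (\<Sum>w\<in>W. of_int (c w) * w)" unfolding zspan_def by blast
  then show "of_int n * x \<in> zspan W"
    by (intro zspanI[where c = "\<lambda>w. n * c w"]) (simp add: sum_distrib_left mult_ac)
qed

lemma zspan_sum: "(\<And>i. i \<in> A \<Longrightarrow> f i \<in> zspan W) \<Longrightarrow> sum f A \<in> zspan W"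
  by (induction A rule: infinite_finite_induct) (auto intro: zspan_0 zspan_add)

lemma zspan_base: "finite W \<Longrightarrow> w \<in> W \<Longrightarrow> w \<in> zspan W"
  by (rule zspanI[where c = "\<lambda>v. if v = w then 1 else 0"])
     (simp add: if_distrib[of of_int] if_distrib[of "\<lambda>t. t * _"] cong: if_cong)

lemma zspan_mult_closed:
  assumes "\<And>w. w \<in> W \<Longrightarrow> x * w \<in> zspan W" "y \<in> zspan W"
  shows "x * y \<in> zspan W"
proof -
  obtain c where "y = (\<Sum>w\<in>W. of_int (c w) * w)" using assms(2) unfolding zspan_def by blast
  then have "x * y = (\<Sum>w\<in>W. of_int (c w) * (x * w))" by (simp add: sum_distrib_left mult_ac)
  then show ?thesis using assms(1) by (auto intro!: zspan_sum zspan_scale)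
qed

lemma algebraic_int_of_zspan_stable:
  assumes W: "finite W" "w0 \<in> W" "w0 \<noteq> 0" and st: "\<And>w. w \<in> W \<Longrightarrow> x * w \<in> zspan W"
  shows "algebraic_int x"
proof -
  obtain ws where ws: "set ws = W" "distinct ws" using finite_distinct_list[OF W(1)] by blast
  have "\<forall>i. \<exists>c. i < length ws \<longrightarrow> x * ws ! i = (\<Sum>w\<in>W. of_int (c w) * w)"
    using st ws unfolding zspan_def by (auto simp: set_conv_nth)
  then obtain c where c: "\<And>i. i < length ws \<Longrightarrow> x * ws ! i = (\<Sum>w\<in>W. of_int (c i w) * w)" by metis
  have bij: "bij_betw ((!) ws) {..<length ws} W" using ws by (simp add: bij_betw_nth)
  show ?thesis
  proof (rule algebraic_int_of_multiplication[where ws = ws and c = "\<lambda>i j. c i (ws ! j)"])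
    fix i assume "i < length ws"
    then show "x * ws ! i = (\<Sum>j<length ws. of_int (c i (ws ! j)) * ws ! j)"
      by (simp add: c sum.reindex_bij_betw[OF bij, of "\<lambda>w. of_int (c i w) * w"])
  qed (use W ws in auto)
qed

lemma algebraic_int_power_eq:
  assumes "algebraic_int (x :: complex)"
  obtains n and c :: "nat \<Rightarrow> int" where "n > 0" "x ^ n = (\<Sum>k<n. of_int (c k) * x ^ k)"
proof -
  obtain p where p: "poly (map_poly of_int p) x = 0" "lead_coeff p = 1"
    using assms unfolding algebraic_int_altdef_ipoly by blast
  let ?n = "degree p"
  have "poly (map_poly of_int p) x = (\<Sum>k\<le>?n. of_int (coeff p k) * x ^ k)"
    by (simp add: poly_altdef)
  also have "\<dots> = (\<Sum>k<?n. of_int (coeff p k) * x ^ k) + x ^ ?n"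
    using p(2) by (simp add: lessThan_Suc_atMost[symmetric])
  finally have "x ^ ?n = (\<Sum>k<?n. of_int (- coeff p k) * x ^ k)"
    using p(1) by (simp add: sum_negf eq_neg_iff_add_eq_0 add.commute)
  moreover have "?n > 0"
  proof (rule ccontr)
    assume "\<not> ?n > 0"
    then have "p = 1" using p(2) by (metis degree_0_id gr0I lead_coeff_1 one_pCons)
    then show False using p(1) by simp
  qed
  ultimately show ?thesis by (intro that[of ?n "\<lambda>k. - coeff p k"])
qed

text \<open>The module generated by the x^i y^j below the degrees of the two monic equations is
  stable under x and under y, hence under their sum and product.\<close>

lemma algebraic_int_add_mult:
  assumes "algebraic_int (x :: complex)" "algebraic_int y"
  shows "algebraic_int (x + y)" "algebraic_int (x * y)"
proof -
  obtain m c where m: "m > 0" "x ^ m = (\<Sum>k<m. of_int (c k) * x ^ k)" using algebraic_int_power_eq[OF assms(1)] by blast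
  obtain n d where n: "n > 0" "y ^ n = (\<Sum>k<n. of_int (d k) * y ^ k)" using algebraic_int_power_eq[OF assms(2)] by blast
  define W where "W = (\<lambda>(i, j). x ^ i * y ^ j) ` ({..<m} \<times> {..<n})"
  have fin: "finite W" by (simp add: W_def)
  have base: "x ^ i * y ^ j \<in> zspan W" if "i < m" "j < n" for i j
    by (rule zspan_base[OF fin]) (use that in \<open>auto simp: W_def\<close>)
  have one: "1 \<in> W" unfolding W_def using m(1) n(1) by (auto intro!: image_eqI[of _ _ "(0, 0)"])
  have X: "x * w \<in> zspan W" if "w \<in> W" for w
  proof -
    obtain i j where ij: "i < m" "j < n" "w = x ^ i * y ^ j" using \<open>w \<in> W\<close> by (auto simp: W_def)
    show ?thesis
    proof (cases "Suc i < m")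
      case True then show ?thesis using base[of "Suc i" j] ij by (simp add: mult.assoc)
    next
      case False
      then have "Suc i = m" using ij by simp
      then have "x * w = x ^ m * y ^ j" by (auto simp: ij mult.assoc)
      also have "\<dots> = (\<Sum>k<m. of_int (c k) * (x ^ k * y ^ j))" unfolding m(2) by (simp add: sum_distrib_right mult.assoc)
      finally show ?thesis using ij by (auto intro!: zspan_sum zspan_scale base)
    qed
  qed
  have Y: "y * w \<in> zspan W" if "w \<in> W" for w
  proof -
    obtain i j where ij: "i < m" "j < n" "w = x ^ i * y ^ j" using \<open>w \<in> W\<close> by (auto simp: W_def)
    show ?thesis
    proof (cases "Suc j < n")
      case True then show ?thesis using base[of i "Suc j"] ij by (simp add: mult_ac)
    next
      case False
      then have "Suc j = n" using ij by simp
      then have "y * w = x ^ i * y ^ n" by (auto simp: ij mult_ac)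
      also have "\<dots> = (\<Sum>k<n. of_int (d k) * (x ^ i * y ^ k))" unfolding n(2) by (simp add: sum_distrib_left mult_ac)
      finally show ?thesis using ij by (auto intro!: zspan_sum zspan_scale base)
    qed
  qed
  show "algebraic_int (x + y)"
    by (rule algebraic_int_of_zspan_stable[OF fin one]) (auto simp: distrib_right intro!: zspan_add X Y)
  show "algebraic_int (x * y)"
    by (rule algebraic_int_of_zspan_stable[OF fin one])
       (simp_all add: mult.assoc zspan_mult_closed[OF X] Y)
qed

section \<open>Normal number fields and their automorphisms\<close>

text \<open>Normality makes the complex embeddings self-maps of K, so that
  \<open>embeddings K\<close> serves as the Galois group.\<close>

locale normal_number_field =
  fixes K :: "complex set"
  assumes nf: "number_field K" and normal: "normal_ext K"
begin

abbreviation "G \<equiv> embeddings K"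
abbreviation "OK \<equiv> ring_of_integers K"

lemma K: "subfield_C K" using nf unfolding number_field_def by blast

lemmas K_closed = subfield_CD[OF K]

lemma algebraic_K: "x \<in> K \<Longrightarrow> \<exists>h. h \<noteq> 0 \<and> qeval h x = 0"
  using nf rat_basis_algebraic K unfolding number_field_def by blast

context
  fixes \<sigma> assumes \<sigma>: "\<sigma> \<in> G"
begin

lemma emb_add: "x \<in> K \<Longrightarrow> y \<in> K \<Longrightarrow> \<sigma> (x + y) = \<sigma> x + \<sigma> y"
  and emb_mult: "x \<in> K \<Longrightarrow> y \<in> K \<Longrightarrow> \<sigma> (x * y) = \<sigma> x * \<sigma> y"
  and emb_1: "\<sigma> 1 = 1" and emb_outside: "x \<notin> K \<Longrightarrow> \<sigma> x = 0"
  using \<sigma> unfolding embeddings_def by auto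

lemma emb_0: "\<sigma> 0 = 0" using emb_add[of 0 0] K_closed(1) by simp

lemma emb_uminus: "x \<in> K \<Longrightarrow> \<sigma> (- x) = - \<sigma> x"
  using emb_add[of x "- x"] K_closed(5) emb_0 by (simp add: eq_neg_iff_add_eq_0 add.commute)

lemma emb_diff: "x \<in> K \<Longrightarrow> y \<in> K \<Longrightarrow> \<sigma> (x - y) = \<sigma> x - \<sigma> y"
  using emb_add[of x "- y"] K_closed(5) emb_uminus by simp

lemma emb_of_nat: "\<sigma> (of_nat n) = of_nat n"
proof (induction n)
  case (Suc n)
  have "of_nat n \<in> K" using subfield_C_of_int[OF K, of "int n"] by simp
  then show ?case using emb_add[of 1 "of_nat n"] K_closed(2) Suc emb_1 by simp
qed (simp add: emb_0)

lemma emb_of_int: "\<sigma> (of_int n) = of_int n"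
proof (cases n rule: int_cases2)
  case (nonneg m) then show ?thesis using emb_of_nat by simp
next
  case (nonpos m)
  have "of_nat m \<in> K" using subfield_C_of_int[OF K, of "int m"] by simp
  then show ?thesis using emb_uminus[of "of_nat m"] emb_of_nat nonpos by simp
qed

lemma emb_of_rat: "\<sigma> (of_rat q) = of_rat q"
proof (cases q)
  case (Fract a b)
  then have e: "of_rat q * of_int b = (of_int a :: complex)" by (simp add: of_rat_rat)
  then have "\<sigma> (of_rat q) * of_int b = of_int a"
    using emb_mult[OF subfield_C_of_rat[OF K, of q] subfield_C_of_int[OF K, of b]] emb_of_int by simp
  then have "\<sigma> (of_rat q) * of_int b = of_rat q * of_int b" using e by simp
  then show ?thesis using Fract by simp
qed

lemma emb_qeval: "x \<in> K \<Longrightarrow> \<sigma> (qeval h x) = qeval h (\<sigma> x)"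
proof (induction h)
  case (pCons c h)
  then show ?case
    using emb_add[OF subfield_C_of_rat[OF K, of c] K_closed(4)[OF pCons.prems qeval_in_subfield[OF K pCons.prems]], of h]
      emb_mult[OF pCons.prems qeval_in_subfield[OF K pCons.prems], of h] emb_of_rat by simp
qed (simp add: emb_0)

text \<open>Normality enters here: the image of x is another zero of the irreducible polynomial of
  x.\<close>

lemma emb_in_K: "\<sigma> x \<in> K"
proof (cases "x \<in> K")
  case True
  obtain f where f: "irreducible f" "qeval f x = 0" using exists_irreducible_annihilator[OF algebraic_K[OF True]] .
  have "qeval f (\<sigma> x) = 0" using emb_qeval[OF True, of f] f emb_0 by simp
  then show ?thesis using normal f True unfolding normal_ext_def qeval_def by blast
qed (simp add: emb_outside K_closed)

lemma emb_nonzero: "x \<in> K \<Longrightarrow> x \<noteq> 0 \<Longrightarrow> \<sigma> x \<noteq> 0"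
  using emb_mult[of x "inverse x"] K_closed(6)[of x] emb_1 by auto

lemma emb_inj: "x \<in> K \<Longrightarrow> y \<in> K \<Longrightarrow> \<sigma> x = \<sigma> y \<Longrightarrow> x = y"
  using emb_nonzero[of "x - y"] emb_diff[of x y] K_closed(7)[of x y] by auto

lemma emb_sum: "(\<And>i. i \<in> A \<Longrightarrow> f i \<in> K) \<Longrightarrow> \<sigma> (sum f A) = (\<Sum>i\<in>A. \<sigma> (f i))"
  by (induction A rule: infinite_finite_induct) (auto simp: emb_0 emb_add subfield_C_sum[OF K])

lemma emb_prod: "(\<And>i. i \<in> A \<Longrightarrow> f i \<in> K) \<Longrightarrow> \<sigma> (prod f A) = (\<Prod>i\<in>A. \<sigma> (f i))"
  by (induction A rule: infinite_finite_induct) (auto simp: emb_1 emb_mult subfield_C_prod[OF K])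

lemma emb_algebraic_int: "x \<in> K \<Longrightarrow> algebraic_int x \<Longrightarrow> algebraic_int (\<sigma> x)"
proof -
  assume x: "x \<in> K" and "algebraic_int x"
  then obtain p where p: "poly (map_poly of_int p) x = 0" "lead_coeff p = 1"
    unfolding algebraic_int_altdef_ipoly by blast
  define h where "h = (map_poly of_int p :: rat poly)"
  have h: "qeval h z = poly (map_poly of_int p) z" for z
    by (simp add: h_def qeval_def map_poly_map_poly o_def)
  have "qeval h (\<sigma> x) = 0" using emb_qeval[OF x, of h] h p(1) emb_0 by simp
  then show ?thesis unfolding algebraic_int_altdef_ipoly using h p(2) by auto
qed

end

lemma G_eqI:
  assumes "\<sigma> \<in> G" "\<tau> \<in> G" "\<And>x. x \<in> K \<Longrightarrow> \<sigma> x = \<tau> x" shows "\<sigma> = \<tau>"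
proof
  fix x show "\<sigma> x = \<tau> x" using assms(3)[of x] emb_outside[OF assms(1), of x] emb_outside[OF assms(2), of x] by (cases "x \<in> K") auto
qed

text \<open>Embeddings are normalised to vanish outside K, so the neutral element is the identity
  cut off there.\<close>

definition idK :: "complex \<Rightarrow> complex" where "idK x = (if x \<in> K then x else 0)"

lemma idK_in_G: "idK \<in> G"
  unfolding embeddings_def idK_def by (auto simp: K_closed)

lemma comp_in_G: "\<sigma> \<in> G \<Longrightarrow> \<tau> \<in> G \<Longrightarrow> \<sigma> \<circ> \<tau> \<in> G"
proof -
  assume s: "\<sigma> \<in> G" and t: "\<tau> \<in> G"
  show ?thesis
    unfolding embeddings_def mem_Collect_eq comp_def
    by (auto simp: emb_add[OF s] emb_add[OF t] emb_mult[OF s] emb_mult[OF t] emb_1[OF s] emb_1[OF t]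
        emb_outside[OF t] emb_0[OF s] emb_in_K[OF t])
qed

definition \<theta> where "\<theta> = (SOME \<theta>. \<theta> \<in> K \<and> (\<forall>x\<in>K. \<exists>h. x = qeval h \<theta>))"

lemma \<theta>: "\<theta> \<in> K" "x \<in> K \<Longrightarrow> \<exists>h. x = qeval h \<theta>"
  using someI_ex[of "\<lambda>\<theta>. \<theta> \<in> K \<and> (\<forall>x\<in>K. \<exists>h. x = qeval h \<theta>)"] primitive_element[OF nf]
  unfolding \<theta>_def by blast+

text \<open>Sends \<open>qeval h \<theta>\<close> to \<open>qeval h z\<close>. Two representations
  of the same element differ by a multiple of f, which also vanishes at z, so the choice of
  representation does not matter.\<close>

lemma exists_emb:
  assumes f: "irreducible f" "qeval f \<theta> = 0" and z: "qeval f z = 0"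
  shows "\<exists>\<sigma>\<in>G. \<sigma> \<theta> = z"
proof -
  define rep where "rep x = (SOME h. x = qeval h \<theta>)" for x
  define \<sigma> where "\<sigma> x = (if x \<in> K then qeval (rep x) z else 0)" for x
  have rep: "qeval (rep x) \<theta> = x" if "x \<in> K" for x
    using someI_ex[OF \<theta>(2)[OF that]] unfolding rep_def by simp
  have \<sigma>: "\<sigma> x = qeval h z" if "qeval h \<theta> = x" for x h
  proof -
    have xK: "x \<in> K" using that qeval_in_subfield[OF K \<theta>(1)] by blast
    have "f dvd (rep x - h)"
      using rep[OF xK] that by (intro irreducible_dvd_of_common_root[OF f]) simp
    then have "qeval (rep x - h) z = 0" using z by (auto elim!: dvdE simp del: qeval_simps(2))
    then show ?thesis using xK by (simp add: \<sigma>_def)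
  qed
  have "\<sigma> \<in> G" unfolding embeddings_def mem_Collect_eq
  proof (intro conjI ballI allI impI)
    show "\<sigma> 1 = 1" using \<sigma>[of 1 1] by simp
    fix x assume x: "x \<in> K"
    fix y assume y: "y \<in> K"
    show "\<sigma> (x + y) = \<sigma> x + \<sigma> y" using \<sigma>[of "rep x + rep y"] rep x y by (simp add: \<sigma>_def)
    show "\<sigma> (x * y) = \<sigma> x * \<sigma> y" using \<sigma>[of "rep x * rep y"] rep x y by (simp add: \<sigma>_def)
  qed (simp add: \<sigma>_def)
  moreover have "\<sigma> \<theta> = z" using \<sigma>[of "[:0, 1:]"] by simp
  ultimately show ?thesis by blast
qed

lemma finite_G: "finite G"
proof -
  obtain f where f: "irreducible f" "qeval f \<theta> = 0" using exists_irreducible_annihilator[OF algebraic_K[OF \<theta>(1)]] .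
  have "inj_on (\<lambda>\<sigma>. \<sigma> \<theta>) G"
  proof (rule inj_onI)
    fix \<sigma> \<tau> assume *: "\<sigma> \<in> G" "\<tau> \<in> G" "\<sigma> \<theta> = \<tau> \<theta>"
    show "\<sigma> = \<tau>"
    proof (rule G_eqI[OF *(1,2)])
      fix x assume "x \<in> K"
      then obtain h where "x = qeval h \<theta>" using \<theta>(2) by blast
      then show "\<sigma> x = \<tau> x" using emb_qeval[OF *(1) \<theta>(1)] emb_qeval[OF *(2) \<theta>(1)] *(3) by simp
    qed
  qed
  moreover have "(\<lambda>\<sigma>. \<sigma> \<theta>) ` G \<subseteq> {z. qeval f z = 0}"
  proof (rule image_subsetI)
    fix \<sigma> assume s: "\<sigma> \<in> G"
    show "\<sigma> \<theta> \<in> {z. qeval f z = 0}" using emb_qeval[OF s \<theta>(1), of f] f emb_0[OF s] by simp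
  qed
  ultimately show ?thesis
    using card_roots_irreducible(2)[OF f(1)] by (meson finite_imageD finite_subset)
qed

text \<open>Write x = g(\<theta>) with deg g < deg f. Every zero of f is a conjugate of \<theta>, so
  g takes the value x at deg f points; hence g - x vanishes identically and x is the constant
  coefficient of g.\<close>

lemma fixed_imp_rational:
  assumes x: "x \<in> K" and fx: "\<And>\<sigma>. \<sigma> \<in> G \<Longrightarrow> \<sigma> x = x"
  shows "x \<in> \<rat>"
proof -
  obtain f where f: "irreducible f" "qeval f \<theta> = 0" using exists_irreducible_annihilator[OF algebraic_K[OF \<theta>(1)]] .
  have f0: "f \<noteq> 0" using f by auto
  have fpos: "degree f > 0" using f(1) f0 irreducible_not_unit[OF f(1)] by (simp add: is_unit_iff_degree)
  obtain h where h: "x = qeval h \<theta>" using \<theta>(2)[OF x] by blast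
  define g where "g = h mod f"
  have "qeval (h div f * f + g) \<theta> = x" unfolding g_def h by (simp only: div_mult_mod_eq)
  then have g: "x = qeval g \<theta>" using f by (simp only: qeval_simps) simp
  have deg: "degree g < degree f" using degree_mod_less[OF f0, of h] fpos unfolding g_def by auto
  have gz: "qeval g z = x" if z: "qeval f z = 0" for z
  proof -
    obtain \<sigma> where s: "\<sigma> \<in> G" "\<sigma> \<theta> = z" using exists_emb[OF f z] by blast
    have "qeval g z = \<sigma> (qeval g \<theta>)" using emb_qeval[OF s(1) \<theta>(1)] s(2) by simp
    then show ?thesis using fx[OF s(1)] g by simp
  qed
  define q where "q = map_poly of_rat g - [:x:]"
  have "q = 0"
  proof (rule ccontr)
    assume q0: "q \<noteq> 0"
    have "{z. qeval f z = 0} \<subseteq> {z. poly q z = 0}" using gz by (auto simp: q_def qeval_def)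
    then have "card {z. qeval f z = 0} \<le> card {z. poly q z = 0}" using q0 by (intro card_mono poly_roots_finite)
    also have "\<dots> \<le> degree q" using q0 by (rule card_poly_roots_bound)
    also have "\<dots> \<le> degree g" unfolding q_def by (rule degree_diff_le) auto
    finally show False using deg card_roots_irreducible(1)[OF f(1)] by simp
  qed
  then have "coeff (map_poly of_rat g) 0 = coeff [:x:] 0" by (simp add: q_def)
  then have "x = of_rat (coeff g 0)" by simp
  then show ?thesis by simp
qed

lemma inj_comp: assumes "\<sigma> \<in> G" shows "inj_on (\<lambda>\<tau>. \<sigma> \<circ> \<tau>) G"
proof (rule inj_onI)
  fix \<tau> \<rho> assume *: "\<tau> \<in> G" "\<rho> \<in> G" "\<sigma> \<circ> \<tau> = \<sigma> \<circ> \<rho>"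
  show "\<tau> = \<rho>"
  proof (rule G_eqI[OF *(1,2)])
    fix x assume "x \<in> K"
    have "\<sigma> (\<tau> x) = \<sigma> (\<rho> x)" using *(3) by (metis comp_apply)
    then show "\<tau> x = \<rho> x" using emb_inj[OF assms] emb_in_K *(1,2) by blast
  qed
qed

lemma bij_comp: assumes "\<sigma> \<in> G" shows "bij_betw (\<lambda>\<tau>. \<sigma> \<circ> \<tau>) G G"
  using inj_comp[OF assms] comp_in_G[OF assms] finite_G
  by (simp add: bij_betw_def endo_inj_surj image_subsetI)

lemma inverse_in_G:
  assumes "\<sigma> \<in> G"
  obtains \<tau> where "\<tau> \<in> G" "\<And>x. x \<in> K \<Longrightarrow> \<sigma> (\<tau> x) = x" "\<And>x. x \<in> K \<Longrightarrow> \<tau> (\<sigma> x) = x"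
proof -
  obtain \<tau> where t: "\<tau> \<in> G" "idK = \<sigma> \<circ> \<tau>"
    using bij_comp[OF assms] idK_in_G by (metis (no_types, lifting) bij_betw_imp_surj_on imageE)
  have 1: "\<sigma> (\<tau> x) = x" if "x \<in> K" for x using fun_cong[OF t(2), of x] that by (simp add: idK_def)
  have "\<tau> (\<sigma> x) = x" if "x \<in> K" for x
    using emb_inj[OF assms, of "\<tau> (\<sigma> x)" x] 1[of "\<sigma> x"] emb_in_K[OF assms, of x] emb_in_K[OF t(1)] that by auto
  with 1 t(1) that show ?thesis by blast
qed

definition norm_el :: "complex \<Rightarrow> complex" where "norm_el x = (\<Prod>\<sigma>\<in>G. \<sigma> x)"

lemma trace_norm_fixed:
  assumes s: "\<sigma> \<in> G"
  shows "\<sigma> (field_trace K x) = field_trace K x" "\<sigma> (norm_el x) = norm_el x"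
proof -
  have "\<sigma> (field_trace K x) = (\<Sum>\<tau>\<in>G. (\<sigma> \<circ> \<tau>) x)"
    unfolding field_trace_def using emb_in_K by (simp add: emb_sum[OF s])
  also have "\<dots> = field_trace K x" unfolding field_trace_def
    by (rule sum.reindex_bij_betw[OF bij_comp[OF s], of "\<lambda>\<tau>. \<tau> x"])
  finally show "\<sigma> (field_trace K x) = field_trace K x" .
  have "\<sigma> (norm_el x) = (\<Prod>\<tau>\<in>G. (\<sigma> \<circ> \<tau>) x)"
    unfolding norm_el_def using emb_in_K by (simp add: emb_prod[OF s])
  also have "\<dots> = norm_el x" unfolding norm_el_def
    by (rule prod.reindex_bij_betw[OF bij_comp[OF s], of "\<lambda>\<tau>. \<tau> x"])
  finally show "\<sigma> (norm_el x) = norm_el x" .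
qed

lemma OK_D: "x \<in> OK \<Longrightarrow> x \<in> K" "x \<in> OK \<Longrightarrow> algebraic_int x"
  by (auto simp: ring_of_integers_def)

lemma OK_closed: "0 \<in> OK" "1 \<in> OK" "x \<in> OK \<Longrightarrow> y \<in> OK \<Longrightarrow> x + y \<in> OK"
  "x \<in> OK \<Longrightarrow> y \<in> OK \<Longrightarrow> x * y \<in> OK" "x \<in> OK \<Longrightarrow> - x \<in> OK"
  "x \<in> OK \<Longrightarrow> y \<in> OK \<Longrightarrow> x - y \<in> OK" "of_int n \<in> OK" "of_nat k \<in> OK"
proof -
  show 1: "0 \<in> OK" "1 \<in> OK" "x \<in> OK \<Longrightarrow> y \<in> OK \<Longrightarrow> x * y \<in> OK" "x \<in> OK \<Longrightarrow> - x \<in> OK"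
     "of_int n \<in> OK" for x y n
    by (auto simp: ring_of_integers_def K_closed algebraic_int_add_mult int_imp_algebraic_int subfield_C_of_int[OF K])
  show a: "x \<in> OK \<Longrightarrow> y \<in> OK \<Longrightarrow> x + y \<in> OK" for x y
    by (auto simp: ring_of_integers_def K_closed algebraic_int_add_mult)
  show "x \<in> OK \<Longrightarrow> y \<in> OK \<Longrightarrow> x - y \<in> OK" using a[of x "- y"] 1 by simp
  show "of_nat k \<in> OK" using 1(5)[of "int k"] by simp
qed

lemma OK_sum: "(\<And>i. i \<in> A \<Longrightarrow> f i \<in> OK) \<Longrightarrow> sum f A \<in> OK"
  by (induction A rule: infinite_finite_induct) (auto intro: OK_closed)

lemma OK_prod: "(\<And>i. i \<in> A \<Longrightarrow> f i \<in> OK) \<Longrightarrow> prod f A \<in> OK"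
  by (induction A rule: infinite_finite_induct) (auto intro: OK_closed)

lemma emb_OK: "\<sigma> \<in> G \<Longrightarrow> x \<in> OK \<Longrightarrow> \<sigma> x \<in> OK"
  by (auto simp: ring_of_integers_def emb_in_K emb_algebraic_int)

lemma rational_OK_int: "x \<in> OK \<Longrightarrow> x \<in> \<rat> \<Longrightarrow> \<exists>n. x = of_int n"
  using rational_algebraic_int_is_int[of x] by (auto simp: ring_of_integers_def elim: Ints_cases)

lemma trace_int: "x \<in> OK \<Longrightarrow> \<exists>n. field_trace K x = of_int n"
proof (rule rational_OK_int)
  assume x: "x \<in> OK"
  show "field_trace K x \<in> OK" unfolding field_trace_def by (rule OK_sum, rule emb_OK[OF _ x])
  then show "field_trace K x \<in> \<rat>" using fixed_imp_rational[OF OK_D(1)] trace_norm_fixed(1) by blast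
qed

lemma norm_int: "x \<in> OK \<Longrightarrow> \<exists>n. norm_el x = of_int n"
proof (rule rational_OK_int)
  assume x: "x \<in> OK"
  show "norm_el x \<in> OK" unfolding norm_el_def by (rule OK_prod, rule emb_OK[OF _ x])
  then show "norm_el x \<in> \<rat>" using fixed_imp_rational[OF OK_D(1)] trace_norm_fixed(2) by blast
qed

lemma trace_add: "x \<in> K \<Longrightarrow> y \<in> K \<Longrightarrow> field_trace K (x + y) = field_trace K x + field_trace K y"
  by (simp add: field_trace_def emb_add sum.distrib)

lemma trace_sum: "(\<And>i. i \<in> A \<Longrightarrow> f i \<in> K) \<Longrightarrow> field_trace K (sum f A) = (\<Sum>i\<in>A. field_trace K (f i))"
  unfolding field_trace_def by (simp add: emb_sum) (rule sum.swap)

lemma trace_scale_rat: "x \<in> K \<Longrightarrow> field_trace K (of_rat q * x) = of_rat q * field_trace K x"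
  by (simp add: field_trace_def emb_mult emb_of_rat subfield_C_of_rat[OF K] sum_distrib_left)

text \<open>The trace of 1 is the number of automorphisms, which is nonzero.\<close>

lemma trace_nondegenerate:
  assumes "x \<in> K" "x \<noteq> 0" shows "field_trace K (x * inverse x) \<noteq> 0"
proof -
  have "field_trace K (x * inverse x) = of_nat (card G)" using assms by (simp add: field_trace_def emb_1)
  moreover have "card G \<noteq> 0" using finite_G idK_in_G by auto
  ultimately show ?thesis by simp
qed

end

section \<open>Integral bases and the discriminant\<close>

lemma sum_nth_append1:
  "(\<Sum>i<length (hs @ [h]). of_int (c i) * (hs @ [h]) ! i)
     = (\<Sum>i<length hs. of_int (c i) * hs ! i) + of_int (c (length hs)) * (h :: complex)"
proof -
  have "(\<Sum>i<length hs. of_int (c i) * (hs @ [h]) ! i) = (\<Sum>i<length hs. of_int (c i) * hs ! i)"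
    by (rule sum.cong) (auto simp: nth_append)
  then show ?thesis by simp
qed

text \<open>An abstract form of the freeness of subgroups of Z^n, with integer functionals in place
  of coordinates. H is filtered by the vanishing of the functionals of index at least m; each step
  of the filtration needs at most one new generator, found by division with remainder.\<close>

lemma subgroup_has_basis:
  fixes H :: "complex set" and \<kappa> :: "nat \<Rightarrow> complex \<Rightarrow> int"
  assumes H0: "0 \<in> H" and H: "\<And>x y k. x \<in> H \<Longrightarrow> y \<in> H \<Longrightarrow> x + of_int k * y \<in> H"
    and \<kappa>: "\<And>i x y k. i < n \<Longrightarrow> x \<in> H \<Longrightarrow> y \<in> H \<Longrightarrow> \<kappa> i (x + of_int k * y) = \<kappa> i x + k * \<kappa> i y"
    and inj: "\<And>x. x \<in> H \<Longrightarrow> (\<And>i. i < n \<Longrightarrow> \<kappa> i x = 0) \<Longrightarrow> x = 0"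
  shows "\<exists>hs. set hs \<subseteq> H \<and>
     (\<forall>c::nat \<Rightarrow> int. (\<Sum>i<length hs. of_int (c i) * hs ! i) = 0 \<longrightarrow> (\<forall>i<length hs. c i = 0)) \<and>
     (\<forall>x\<in>H. \<exists>c::nat \<Rightarrow> int. x = (\<Sum>i<length hs. of_int (c i) * hs ! i))"
proof -
  define Hm where "Hm m = {x\<in>H. \<forall>i. m \<le> i \<and> i < n \<longrightarrow> \<kappa> i x = 0}" for m
  have \<kappa>0: "\<kappa> i 0 = 0" if "i < n" for i using \<kappa>[OF that H0 H0, of 1] by simp
  have Hm0: "0 \<in> Hm m" for m using H0 \<kappa>0 by (auto simp: Hm_def)
  have Hm: "x + of_int k * y \<in> Hm m" if "x \<in> Hm m" "y \<in> Hm m" for x y k m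
    using that H \<kappa> by (auto simp: Hm_def)
  have comb: "(\<Sum>i<l. of_int (c i) * hs ! i) \<in> Hm m" if "l \<le> length hs" "set hs \<subseteq> Hm m" for hs m l and c :: "nat \<Rightarrow> int"
    using that(1)
  proof (induction l)
    case (Suc l)
    then have "hs ! l \<in> Hm m" using that(2) by auto
    with Suc show ?case using Hm by simp
  qed (simp add: Hm0)
  have "m \<le> n \<Longrightarrow> \<exists>hs. set hs \<subseteq> Hm m \<and>
     (\<forall>c::nat \<Rightarrow> int. (\<Sum>i<length hs. of_int (c i) * hs ! i) = 0 \<longrightarrow> (\<forall>i<length hs. c i = 0)) \<and>
     (\<forall>x\<in>Hm m. \<exists>c::nat \<Rightarrow> int. x = (\<Sum>i<length hs. of_int (c i) * hs ! i))" for m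
  proof (induction m)
    case 0
    have "x = 0" if "x \<in> Hm 0" for x using that inj by (auto simp: Hm_def)
    then show ?case by (intro exI[of _ "[]"]) auto
  next
    case (Suc m)
    then obtain hs where hs: "set hs \<subseteq> Hm m"
      "\<And>c::nat \<Rightarrow> int. (\<Sum>i<length hs. of_int (c i) * hs ! i) = 0 \<Longrightarrow> \<forall>i<length hs. c i = 0"
      "\<And>x. x \<in> Hm m \<Longrightarrow> \<exists>c::nat \<Rightarrow> int. x = (\<Sum>i<length hs. of_int (c i) * hs ! i)"
      by (metis Suc_leD)
    have m: "m < n" using Suc by simp
    have mono: "x \<in> Hm (Suc m)" if "x \<in> Hm m" for x using that by (auto simp: Hm_def)
    have down: "x \<in> Hm m" if "x \<in> Hm (Suc m)" "\<kappa> m x = 0" for x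
      using that unfolding Hm_def by (auto simp: Suc_le_eq) (metis le_neq_implies_less)
    show ?case
    proof (cases "\<exists>x\<in>Hm (Suc m). \<kappa> m x \<noteq> 0")
      case False
      then have "Hm (Suc m) = Hm m" using mono down by blast
      then show ?thesis using hs by (intro exI[of _ hs]) auto
    next
      case True
      then obtain x where x: "x \<in> Hm (Suc m)" "\<kappa> m x \<noteq> 0" by blast
      have "\<exists>y\<in>Hm (Suc m). \<kappa> m y > 0"
      proof (cases "\<kappa> m x > 0")
        case False
        have "\<kappa> m (0 + of_int (-1) * x) = - \<kappa> m x"
          using \<kappa>[OF m H0, of x "-1"] x \<kappa>0[OF m] by (simp add: Hm_def)
        moreover have "0 + of_int (-1) * x \<in> Hm (Suc m)" using Hm[OF Hm0 x(1)] .
        ultimately show ?thesis using False x(2) by (intro bexI[of _ "0 + of_int (-1) * x"]) linarith+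
      qed (use x in auto)
      \<comment> \<open>An element with the least positive value of the functional generates the
        image of that functional.\<close>
      then obtain h where h: "h \<in> Hm (Suc m)" "\<kappa> m h > 0"
        and min: "\<And>y. y \<in> Hm (Suc m) \<Longrightarrow> \<kappa> m y > 0 \<Longrightarrow> nat (\<kappa> m h) \<le> nat (\<kappa> m y)"
        using ex_has_least_nat[of "\<lambda>y. y \<in> Hm (Suc m) \<and> \<kappa> m y > 0" _ "\<lambda>y. nat (\<kappa> m y)"] by blast
      have hH: "h \<in> H" using h by (simp add: Hm_def)
      show ?thesis
      proof (intro exI[of _ "hs @ [h]"] conjI allI impI ballI)
        show "set (hs @ [h]) \<subseteq> Hm (Suc m)" using hs(1) h(1) mono by auto
      next
        fix c :: "nat \<Rightarrow> int" and i
        assume s0: "(\<Sum>i<length (hs @ [h]). of_int (c i) * (hs @ [h]) ! i) = 0" and i: "i < length (hs @ [h])"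
        have eq: "(\<Sum>i<length hs. of_int (c i) * hs ! i) + of_int (c (length hs)) * h = 0"
          using s0 unfolding sum_nth_append1 .
        let ?y = "\<Sum>i<length hs. of_int (c i) * hs ! i"
        have y: "?y \<in> Hm m" by (rule comb[OF _ hs(1)]) simp
        have "\<kappa> m (?y + of_int (c (length hs)) * h) = \<kappa> m ?y + c (length hs) * \<kappa> m h"
          using y hH by (intro \<kappa>[OF m]) (auto simp: Hm_def)
        then have "c (length hs) * \<kappa> m h = 0" unfolding eq using \<kappa>0[OF m] y m by (simp add: Hm_def)
        then have c0: "c (length hs) = 0" using h(2) by simp
        then have "\<forall>i<length hs. c i = 0" using eq by (intro hs(2)) simp
        with c0 i show "c i = 0" by (cases "i = length hs") auto
      next
        fix x assume x: "x \<in> Hm (Suc m)"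
        let ?k = "\<kappa> m x div \<kappa> m h"
        let ?y = "x + of_int (- ?k) * h"
        have y: "?y \<in> Hm (Suc m)" using x h by (intro Hm)
        have "\<kappa> m ?y = \<kappa> m x + (- ?k) * \<kappa> m h" using x hH by (intro \<kappa>[OF m]) (auto simp: Hm_def)
        then have ky: "\<kappa> m ?y = \<kappa> m x mod \<kappa> m h" by (simp add: minus_div_mult_eq_mod)
        have "\<kappa> m ?y = 0"
        proof (rule ccontr)
          assume "\<kappa> m ?y \<noteq> 0"
          then have "\<kappa> m ?y > 0" using ky h(2) by (metis pos_mod_sign order_le_less)
          then have "nat (\<kappa> m h) \<le> nat (\<kappa> m ?y)" by (rule min[OF y])
          moreover have "\<kappa> m ?y < \<kappa> m h" using ky h(2) by simp
          ultimately show False using h(2) by linarith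
        qed
        then obtain c :: "nat \<Rightarrow> int" where c: "?y = (\<Sum>i<length hs. of_int (c i) * hs ! i)"
          using hs(3)[OF down[OF y]] by blast
        define c' where "c' i = (if i = length hs then ?k else c i)" for i
        have "x = (\<Sum>i<length hs. of_int (c' i) * hs ! i) + of_int (c' (length hs)) * h"
        proof -
          have "(\<Sum>i<length hs. of_int (c' i) * hs ! i) = ?y" unfolding c by (rule sum.cong) (auto simp: c'_def)
          then show ?thesis by (simp add: c'_def)
        qed
        then show "\<exists>c::nat \<Rightarrow> int. x = (\<Sum>i<length (hs @ [h]). of_int (c i) * (hs @ [h]) ! i)"
          unfolding sum_nth_append1 by blast
      qed
    qed
  qed
  from this[of n] have "\<exists>hs. set hs \<subseteq> Hm n \<and>
     (\<forall>c::nat \<Rightarrow> int. (\<Sum>i<length hs. of_int (c i) * hs ! i) = 0 \<longrightarrow> (\<forall>i<length hs. c i = 0)) \<and>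
     (\<forall>x\<in>Hm n. \<exists>c::nat \<Rightarrow> int. x = (\<Sum>i<length hs. of_int (c i) * hs ! i))" by simp
  moreover have "Hm n = H" by (auto simp: Hm_def)
  ultimately show ?thesis by simp
qed

interpretation qv: vector_space "\<lambda>(q::rat) (z::complex). of_rat q * z"
  by unfold_locales (auto simp: algebra_simps of_rat_add of_rat_mult)

lemma rat_basis_distinct:
  assumes "rat_basis K ws" shows "distinct ws"
proof (rule ccontr)
  assume "\<not> distinct ws"
  then obtain i j where ij: "i < length ws" "j < length ws" "i \<noteq> j" "ws ! i = ws ! j"
    by (auto simp: distinct_conv_nth)
  define c :: "nat \<Rightarrow> rat" where "c k = (if k = i then 1 else if k = j then -1 else 0)" for k
  have "(\<Sum>k<length ws. of_rat (c k) * ws ! k) = (\<Sum>k\<in>{i, j}. of_rat (c k) * ws ! k)"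
    using ij by (intro sum.mono_neutral_right) (auto simp: c_def)
  also have "\<dots> = 0" using ij by (simp add: c_def)
  finally have "c i = 0" using assms ij(1) unfolding rat_basis_def by blast
  then show False by (simp add: c_def)
qed

text \<open>The degree and the integral basis come from independent choices; invariance of the
  dimension over Q makes their lengths agree.\<close>

lemma rat_basis_length:
  assumes "rat_basis K ws" shows "length ws = qv.dim K"
proof -
  have d: "distinct ws" by (rule rat_basis_distinct[OF assms])
  have bij: "bij_betw ((!) ws) {..<length ws} (set ws)" using d by (simp add: bij_betw_nth)
  have sum: "(\<Sum>w\<in>set ws. of_rat (f w) * w) = (\<Sum>i<length ws. of_rat (f (ws ! i)) * ws ! i)" for f :: "complex \<Rightarrow> rat"
    by (rule sum.reindex_bij_betw[OF bij, symmetric])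
  have "qv.independent (set ws)"
  proof (rule qv.independent_if_scalars_zero)
    fix f :: "complex \<Rightarrow> rat" and w
    assume "(\<Sum>w\<in>set ws. of_rat (f w) * w) = 0" "w \<in> set ws"
    then obtain i where i: "i < length ws" "w = ws ! i" "(\<Sum>i<length ws. of_rat (f (ws ! i)) * ws ! i) = 0"
      unfolding sum by (auto simp: in_set_conv_nth)
    have "\<forall>i<length ws. f (ws ! i) = 0"
      using assms i(3) unfolding rat_basis_def by (elim conjE allE[of _ "\<lambda>i. f (ws ! i)"]) simp
    then have "f (ws ! i) = 0" using i(1) by blast
    then show "f w = 0" using i by simp
  qed simp
  moreover have "K \<subseteq> qv.span (set ws)"
  proof
    fix x assume "x \<in> K"
    then obtain c :: "nat \<Rightarrow> rat" where "x = (\<Sum>i<length ws. of_rat (c i) * ws ! i)"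
      using assms unfolding rat_basis_def by blast
    then show "x \<in> qv.span (set ws)" by (simp only:) (rule qv.span_sum, rule qv.span_scale, rule qv.span_base, simp)
  qed
  moreover have "set ws \<subseteq> K" using assms unfolding rat_basis_def by blast
  ultimately have "card (set ws) = qv.dim K" by (intro qv.basis_card_eq_dim)
  then show ?thesis using distinct_card[OF d] by simp
qed

context normal_number_field
begin

definition tr :: "complex \<Rightarrow> int" where "tr x = (THE n. field_trace K x = of_int n)"

lemma tr: assumes "x \<in> OK" shows "field_trace K x = of_int (tr x)"
proof -
  obtain n where "field_trace K x = of_int n" using trace_int[OF assms] by blast
  then have "\<exists>!n. field_trace K x = of_int n" by auto
  then show ?thesis unfolding tr_def by (rule theI')
qed

lemma trace_zero_imp_zero:
  assumes x: "x \<in> K" and ws: "set ws \<subseteq> K" "\<And>y. y \<in> K \<Longrightarrow> \<exists>c::nat \<Rightarrow> rat. y = (\<Sum>i<length ws. of_rat (c i) * ws ! i)"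
    and z: "\<And>i. i < length ws \<Longrightarrow> field_trace K (x * ws ! i) = 0"
  shows "x = 0"
proof (rule ccontr)
  assume "x \<noteq> 0"
  obtain c :: "nat \<Rightarrow> rat" where c: "inverse x = (\<Sum>i<length ws. of_rat (c i) * ws ! i)"
    using ws(2) K_closed(6)[OF x] by blast
  have wK: "ws ! i \<in> K" if "i < length ws" for i using ws(1) that by auto
  have "field_trace K (x * inverse x) = field_trace K (\<Sum>i<length ws. of_rat (c i) * (x * ws ! i))"
    unfolding c by (simp add: sum_distrib_left mult_ac)
  also have "\<dots> = (\<Sum>i<length ws. of_rat (c i) * field_trace K (x * ws ! i))"
    using wK x by (subst trace_sum) (auto simp: trace_scale_rat K_closed subfield_C_of_rat[OF K])
  also have "\<dots> = 0" using z by simp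
  finally show False using trace_nondegenerate[OF x \<open>x \<noteq> 0\<close>] by blast
qed

text \<open>A rational basis is scaled to algebraic integers e_i. The functionals x to tr(x e_i) are
  integer valued on O_K and separate its elements by nondegeneracy of the trace form.\<close>

lemma exists_integral_basis: "\<exists>ws. integral_basis K ws"
proof -
  obtain ws where ws: "rat_basis K ws" using nf unfolding number_field_def by blast
  have wK: "ws ! i \<in> K" if "i < length ws" for i using ws that unfolding rat_basis_def by auto
  have "\<forall>i. \<exists>D::int. i < length ws \<longrightarrow> D > 0 \<and> algebraic_int (of_int D * ws ! i)"
    using exists_integral_multiple[OF K ws wK] by blast
  then obtain D :: "nat \<Rightarrow> int" where D: "\<And>i. i < length ws \<Longrightarrow> D i > 0"
    "\<And>i. i < length ws \<Longrightarrow> algebraic_int (of_int (D i) * ws ! i)" by metis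
  define e where "e i = of_int (D i) * ws ! i" for i
  have e: "e i \<in> OK" if "i < length ws" for i
    using D(2)[OF that] wK[OF that] by (simp add: e_def ring_of_integers_def K_closed subfield_C_of_int[OF K])
  show ?thesis unfolding integral_basis_def
  proof (rule subgroup_has_basis[where n = "length ws" and \<kappa> = "\<lambda>i x. tr (x * e i)"])
    show "0 \<in> OK" by (rule OK_closed)
    show "x + of_int k * y \<in> OK" if "x \<in> OK" "y \<in> OK" for x y k using that by (intro OK_closed)
    fix i x y k assume i: "i < length ws" and x: "x \<in> OK" and y: "y \<in> OK"
    have "of_int (tr ((x + of_int k * y) * e i)) = field_trace K ((x + of_int k * y) * e i)"
      by (rule tr[symmetric]) (use x y e[OF i] in \<open>intro OK_closed\<close>)
    also have "\<dots> = field_trace K (x * e i + of_rat (of_int k) * (y * e i))" by (simp add: algebra_simps)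
    also have "\<dots> = field_trace K (x * e i) + of_int k * field_trace K (y * e i)"
      using x y e[OF i] by (subst trace_add) (auto simp: trace_scale_rat[where q = "of_int k", simplified] K_closed OK_D subfield_C_of_int[OF K])
    also have "\<dots> = of_int (tr (x * e i) + k * tr (y * e i))"
      using x y e[OF i] by (simp add: tr OK_closed)
    finally show "tr ((x + of_int k * y) * e i) = tr (x * e i) + k * tr (y * e i)" by (simp only: of_int_eq_iff)
  next
    fix x assume x: "x \<in> OK" and z: "\<And>i. i < length ws \<Longrightarrow> tr (x * e i) = 0"
    show "x = 0"
    proof (rule trace_zero_imp_zero[where ws = ws])
      fix i assume i: "i < length ws"
      have "field_trace K (x * e i) = 0" using tr[of "x * e i"] z[OF i] OK_closed(4)[OF x e[OF i]] by simp
      moreover have "x * e i = of_rat (of_int (D i)) * (x * ws ! i)" by (simp add: e_def mult_ac)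
      ultimately have "of_rat (of_int (D i)) * field_trace K (x * ws ! i) = 0"
        using trace_scale_rat[of "x * ws ! i" "of_int (D i)"] x wK[OF i] by (simp add: K_closed OK_D)
      then show "field_trace K (x * ws ! i) = 0" using D(1)[OF i] by simp
    qed (use x ws in \<open>auto simp: OK_D rat_basis_def\<close>)
  qed
qed

lemma integral_basis_imp_rat_basis:
  assumes "integral_basis K ws" shows "rat_basis K ws"
  unfolding rat_basis_def
proof (intro conjI allI impI ballI)
  show "set ws \<subseteq> K" using assms OK_D unfolding integral_basis_def by blast
next
  fix c :: "nat \<Rightarrow> rat" and i
  assume z: "(\<Sum>i<length ws. of_rat (c i) * ws ! i) = 0" and i: "i < length ws"
  obtain D :: int where D: "D > 0" "\<forall>q\<in>c ` {..<length ws}. of_int D * q \<in> \<int>"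
    using common_denominator[of "c ` {..<length ws}"] by auto
  define b where "b i = \<lfloor>of_int D * c i\<rfloor>" for i
  have b: "of_int (b i) = of_int D * c i" if "i < length ws" for i using D(2) that by (simp add: b_def)
  have bc: "of_int (b i) = (of_int D * of_rat (c i) :: complex)" if "i < length ws" for i
    using arg_cong[OF b[OF that], of "of_rat :: rat \<Rightarrow> complex"] by (simp add: of_rat_mult)
  have "(\<Sum>i<length ws. of_int (b i) * ws ! i) = of_int D * (\<Sum>i<length ws. of_rat (c i) * ws ! i)"
    unfolding sum_distrib_left by (intro sum.cong) (auto simp: bc mult_ac)
  then have "(\<Sum>i<length ws. of_int (b i) * ws ! i) = 0" using z by simp
  then have "b i = 0" using assms i unfolding integral_basis_def by blast
  then show "c i = 0" using b[OF i] D(1) by simp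
next
  fix x assume x: "x \<in> K"
  obtain vs where vs: "rat_basis K vs" using nf unfolding number_field_def by blast
  obtain D :: int where D: "D > 0" "algebraic_int (of_int D * x)"
    using exists_integral_multiple[OF K vs x] by blast
  then have "of_int D * x \<in> OK" using x by (simp add: ring_of_integers_def K_closed subfield_C_of_int[OF K])
  then obtain c :: "nat \<Rightarrow> int" where c: "of_int D * x = (\<Sum>i<length ws. of_int (c i) * ws ! i)"
    using assms unfolding integral_basis_def by blast
  have "x = (of_int D * x) / of_int D" using D by simp
  also have "\<dots> = (\<Sum>i<length ws. of_rat (of_int (c i) / of_int D) * ws ! i)"
    unfolding c by (simp add: sum_divide_distrib of_rat_divide)
  finally show "\<exists>c::nat \<Rightarrow> rat. x = (\<Sum>i<length ws. of_rat (c i) * ws ! i)"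
    by (intro exI[of _ "\<lambda>i. of_int (c i) / of_int D"])
qed

text \<open>The same choice term as in the definition of the discriminant, so that both refer to one
  basis.\<close>

definition int_basis :: "complex list" where "int_basis = (SOME ws. integral_basis K ws)"
definition dimK :: nat where "dimK = length int_basis"

lemma int_basis: "integral_basis K int_basis" unfolding int_basis_def by (rule someI_ex[OF exists_integral_basis])

lemma field_degree_eq: "field_degree K = dimK"
proof -
  have "rat_basis K (SOME ws. rat_basis K ws)"
    by (rule someI_ex) (use nf in \<open>simp add: number_field_def\<close>)
  then show ?thesis
    using rat_basis_length rat_basis_length[OF integral_basis_imp_rat_basis[OF int_basis]]
    unfolding field_degree_def dimK_def by simp
qed

definition elt :: "(nat \<Rightarrow> int) \<Rightarrow> complex" where "elt c = (\<Sum>i<dimK. of_int (c i) * int_basis ! i)"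

lemma int_basis_OK: "i < dimK \<Longrightarrow> int_basis ! i \<in> OK"
  using int_basis unfolding integral_basis_def dimK_def by auto

lemma elt_OK: "elt c \<in> OK"
  unfolding elt_def by (intro OK_sum OK_closed) (simp add: int_basis_OK)

lemma elt_surj: "x \<in> OK \<Longrightarrow> \<exists>c. x = elt c"
  using int_basis unfolding integral_basis_def dimK_def elt_def by blast

lemma elt_eq_0: "elt c = 0 \<Longrightarrow> i < dimK \<Longrightarrow> c i = 0"
  using int_basis unfolding integral_basis_def dimK_def elt_def by blast

lemma elt_diff: "elt (\<lambda>i. c i - d i) = elt c - elt d"
  by (simp add: elt_def sum_subtractf left_diff_distrib)

lemma elt_scale: "elt (\<lambda>i. k * c i) = of_int k * elt c"
  by (simp add: elt_def sum_distrib_left mult_ac)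

lemma elt_inj: "elt c = elt d \<Longrightarrow> i < dimK \<Longrightarrow> c i = d i"
  using elt_eq_0[of "\<lambda>i. c i - d i" i] by (simp add: elt_diff)

definition trace_mat :: "int mat" where "trace_mat = mat dimK dimK (\<lambda>(i, j). tr (int_basis ! i * int_basis ! j))"

lemma trace_mat: "trace_mat \<in> carrier_mat dimK dimK" by (simp add: trace_mat_def)

lemma discriminant_eq_det: "discriminant K = det trace_mat"
proof -
  have "discriminant_C K = (\<Sum>\<pi> | \<pi> permutes {..<dimK}. of_int (sign \<pi>) *
        (\<Prod>i<dimK. field_trace K (int_basis ! i * int_basis ! (\<pi> i))))"
    unfolding discriminant_C_def Let_def int_basis_def[symmetric] dimK_def[symmetric] ..
  also have "\<dots> = (\<Sum>\<pi> | \<pi> permutes {..<dimK}. of_int (sign \<pi> * (\<Prod>i<dimK. trace_mat $$ (i, \<pi> i))))"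
  proof (rule sum.cong[OF refl])
    fix \<pi> assume "\<pi> \<in> {\<pi>. \<pi> permutes {..<dimK}}"
    then have \<pi>: "\<pi> i < dimK" if "i < dimK" for i using that permutes_in_image[of \<pi> "{..<dimK}" i] by simp
    have "(\<Prod>i<dimK. field_trace K (int_basis ! i * int_basis ! (\<pi> i))) = (\<Prod>i<dimK. of_int (trace_mat $$ (i, \<pi> i)))"
      using \<pi> by (intro prod.cong) (auto simp: trace_mat_def tr OK_closed int_basis_OK)
    then show "of_int (sign \<pi>) * (\<Prod>i<dimK. field_trace K (int_basis ! i * int_basis ! (\<pi> i)))
        = of_int (sign \<pi> * (\<Prod>i<dimK. trace_mat $$ (i, \<pi> i)))" by simp
  qed
  also have "\<dots> = of_int (det trace_mat)"
    unfolding det_def'[OF trace_mat] by (simp add: atLeast0LessThan)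
  finally have "discriminant_C K = of_int (det trace_mat)" .
  then show ?thesis unfolding discriminant_def by simp
qed

lemma trace_mat_mult:
  assumes "i < dimK"
  shows "(trace_mat *\<^sub>v vec dimK c) $ i = tr (elt c * int_basis ! i)"
proof -
  have "of_int ((trace_mat *\<^sub>v vec dimK c) $ i) = (\<Sum>j<dimK. of_int (tr (int_basis ! i * int_basis ! j)) * of_int (c j) :: complex)"
    using assms by (simp add: trace_mat_def scalar_prod_def atLeast0LessThan)
  also have "\<dots> = (\<Sum>j<dimK. field_trace K (of_rat (of_int (c j)) * (int_basis ! i * int_basis ! j)))"
    using assms by (intro sum.cong) (auto simp: tr[symmetric] OK_closed int_basis_OK trace_scale_rat[where q = "of_int _", simplified] K_closed OK_D)
  also have "\<dots> = field_trace K (\<Sum>j<dimK. of_rat (of_int (c j)) * (int_basis ! i * int_basis ! j))"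
    using assms by (subst trace_sum) (auto simp: K_closed OK_D int_basis_OK subfield_C_of_int[OF K])
  also have "\<dots> = field_trace K (elt c * int_basis ! i)" by (simp add: elt_def sum_distrib_left mult_ac)
  also have "\<dots> = of_int (tr (elt c * int_basis ! i))" using assms by (simp add: tr OK_closed elt_OK int_basis_OK)
  finally show ?thesis by (simp only: of_int_eq_iff)
qed

text \<open>A kernel vector of the trace matrix would give an element orthogonal to all of K. The
  result makes the set of primes dividing the discriminant finite.\<close>

lemma discriminant_nonzero: "discriminant K \<noteq> 0"
proof
  assume "discriminant K = 0"
  then obtain v where v: "v \<in> carrier_vec dimK" "v \<noteq> 0\<^sub>v dimK" "trace_mat *\<^sub>v v = 0\<^sub>v dimK"
    using det_0_iff_vec_prod_zero[OF trace_mat] unfolding discriminant_eq_det by auto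
  define c where "c i = v $ i" for i
  have vc: "v = vec dimK c" using v(1) by (auto simp: c_def)
  have "elt c = 0"
  proof (rule trace_zero_imp_zero[where ws = int_basis])
    fix i assume "i < length int_basis"
    then have i: "i < dimK" by (simp add: dimK_def)
    then have "tr (elt c * int_basis ! i) = 0" using trace_mat_mult[OF i, of c] v(3) vc by simp
    then show "field_trace K (elt c * int_basis ! i) = 0" using i by (simp add: tr OK_closed elt_OK int_basis_OK)
  qed (use integral_basis_imp_rat_basis[OF int_basis] elt_OK OK_D in \<open>auto simp: rat_basis_def\<close>)
  then have "c i = 0" if "i < dimK" for i using elt_eq_0 that by blast
  then have "v = 0\<^sub>v dimK" unfolding vc by auto
  with v(2) show False by blast
qed

text \<open>The trace form stays nondegenerate modulo p: multiplying the trace matrix by its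
  adjugate recovers det times the coordinates, and p does not divide det.\<close>

lemma trace_divisible_imp_divisible:
  assumes p: "prime p" "\<not> p dvd discriminant K"
    and t: "\<And>y. y \<in> OK \<Longrightarrow> p dvd tr (elt c * y)" and j: "j < dimK"
  shows "p dvd c j"
proof -
  have adj: "adj_mat trace_mat \<in> carrier_mat dimK dimK" "adj_mat trace_mat * trace_mat = det trace_mat \<cdot>\<^sub>m 1\<^sub>m dimK"
    using adj_mat[OF trace_mat] by auto
  let ?v = "vec dimK c"
  have "adj_mat trace_mat *\<^sub>v (trace_mat *\<^sub>v ?v) = (adj_mat trace_mat * trace_mat) *\<^sub>v ?v"
    using adj(1) trace_mat by (simp add: assoc_mult_mat_vec[of _ dimK dimK _ dimK])
  also have "\<dots> $ j = det trace_mat * c j" unfolding adj(2) using j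
    by (simp add: scalar_prod_def atLeast0LessThan if_distrib[of "\<lambda>t. det trace_mat * t"] if_distrib[of "\<lambda>t. t * c _"]
        cong: if_cong)
  finally have "(adj_mat trace_mat *\<^sub>v (trace_mat *\<^sub>v ?v)) $ j = det trace_mat * c j" .
  moreover have "(adj_mat trace_mat *\<^sub>v (trace_mat *\<^sub>v ?v)) $ j = (\<Sum>i<dimK. adj_mat trace_mat $$ (j, i) * tr (elt c * int_basis ! i))"
  proof -
    define w where "w = trace_mat *\<^sub>v ?v"
    have w: "dim_vec w = dimK" "\<And>i. i < dimK \<Longrightarrow> w $ i = tr (elt c * int_basis ! i)"
      using trace_mat_mult trace_mat by (auto simp: w_def)
    have "(adj_mat trace_mat *\<^sub>v w) $ j = (\<Sum>i<dimK. adj_mat trace_mat $$ (j, i) * w $ i)"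
      using adj(1) w(1) j by (simp add: scalar_prod_def atLeast0LessThan)
    then show ?thesis unfolding w_def[symmetric] by (simp add: w(2))
  qed
  moreover have "p dvd (\<Sum>i<dimK. adj_mat trace_mat $$ (j, i) * tr (elt c * int_basis ! i))"
    by (intro dvd_sum dvd_mult t int_basis_OK) simp
  ultimately have "p dvd det trace_mat * c j" by simp
  then show ?thesis using p by (simp add: discriminant_eq_det prime_dvd_mult_iff)
qed

end

section \<open>Ideals and their norms\<close>

text \<open>The size of a quotient depends only on the equivalence relation. This is how norms of
  different ideals are compared without building quotient rings.\<close>

lemma card_image_eq_if_same_fibres:
  assumes "\<And>x y. x \<in> S \<Longrightarrow> y \<in> S \<Longrightarrow> f x = f y \<longleftrightarrow> g x = g y"
  shows "card (f ` S) = card (g ` S)"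
proof -
  have "bij_betw (\<lambda>v. g (inv_into S f v)) (f ` S) (g ` S)"
  proof (rule bij_betw_imageI)
    have inv: "inv_into S f (f x) \<in> S" "f (inv_into S f (f x)) = f x" if "x \<in> S" for x
      using that by (auto intro: inv_into_into f_inv_into_f)
    show "inj_on (\<lambda>v. g (inv_into S f v)) (f ` S)"
    proof (rule inj_onI)
      fix u v assume "u \<in> f ` S" "v \<in> f ` S" and e: "g (inv_into S f u) = g (inv_into S f v)"
      then obtain x y where xy: "x \<in> S" "y \<in> S" "u = f x" "v = f y" by blast
      then show "u = v" using e assms[OF inv(1)[OF xy(1)] inv(1)[OF xy(2)]] inv(2) by auto
    qed
    show "(\<lambda>v. g (inv_into S f v)) ` f ` S = g ` S"
    proof -
      have "g (inv_into S f (f x)) = g x" if "x \<in> S" for x using assms[OF inv(1)[OF that] that] inv(2)[OF that] by simp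
      then show ?thesis by (auto simp: image_image)
    qed
  qed
  then show ?thesis by (rule bij_betw_same_card)
qed

context normal_number_field
begin

definition cls :: "complex set \<Rightarrow> complex \<Rightarrow> complex set" where
  "cls A x = {y \<in> OK. x - y \<in> A}"

lemma ideal_norm_cls: "ideal_norm K A = card (cls A ` OK)"
  by (simp add: ideal_norm_def cls_def)

lemma ideal_D:
  assumes "is_ideal K A"
  shows "A \<subseteq> OK" "0 \<in> A" "\<And>x y. x \<in> A \<Longrightarrow> y \<in> A \<Longrightarrow> x + y \<in> A"
    "\<And>x r. x \<in> A \<Longrightarrow> r \<in> OK \<Longrightarrow> r * x \<in> A" "\<And>x r. x \<in> A \<Longrightarrow> r \<in> OK \<Longrightarrow> x * r \<in> A"
    "\<And>x. x \<in> A \<Longrightarrow> - x \<in> A" "\<And>x y. x \<in> A \<Longrightarrow> y \<in> A \<Longrightarrow> x - y \<in> A"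
proof -
  show 1: "A \<subseteq> OK" "0 \<in> A" "\<And>x y. x \<in> A \<Longrightarrow> y \<in> A \<Longrightarrow> x + y \<in> A"
    "\<And>x r. x \<in> A \<Longrightarrow> r \<in> OK \<Longrightarrow> r * x \<in> A" using assms unfolding is_ideal_def by auto
  show "\<And>x r. x \<in> A \<Longrightarrow> r \<in> OK \<Longrightarrow> x * r \<in> A" using 1(4) by (metis mult.commute)
  show 2: "\<And>x. x \<in> A \<Longrightarrow> - x \<in> A" using 1(4)[of _ "-1"] OK_closed(7)[of "-1"] by simp
  show "\<And>x y. x \<in> A \<Longrightarrow> y \<in> A \<Longrightarrow> x - y \<in> A" using 1(3) 2 by (metis diff_conv_add_uminus)
qed

lemma cls_eq_iff:
  assumes A: "is_ideal K A" and "x \<in> OK" "y \<in> OK"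
  shows "cls A x = cls A y \<longleftrightarrow> x - y \<in> A"
proof
  assume "cls A x = cls A y"
  moreover have "y \<in> cls A y" using assms ideal_D(2)[OF A] by (simp add: cls_def)
  ultimately have "y \<in> cls A x" by simp
  then show "x - y \<in> A" by (simp add: cls_def)
next
  assume xy: "x - y \<in> A"
  have "x - z \<in> A \<longleftrightarrow> y - z \<in> A" for z
    using ideal_D(3)[OF A xy, of "y - z"] ideal_D(7)[OF A _ xy, of "x - z"] by auto
  then show "cls A x = cls A y" by (auto simp: cls_def)
qed

lemma cls_finite_mono:
  assumes A: "is_ideal K A" and B: "is_ideal K B" and "A \<subseteq> B" "finite (cls A ` OK)"
  shows "finite (cls B ` OK)"
proof -
  have "cls B ` OK \<subseteq> (\<lambda>C. cls B (SOME x. x \<in> C)) ` (cls A ` OK)"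
  proof
    fix D assume "D \<in> cls B ` OK"
    then obtain x where x: "x \<in> OK" "D = cls B x" by blast
    have "x \<in> cls A x" using x ideal_D(2)[OF A] by (simp add: cls_def)
    then have "(SOME y. y \<in> cls A x) \<in> cls A x" by (rule someI)
    then have "cls B (SOME y. y \<in> cls A x) = D" using x cls_eq_iff[OF B x(1)] assms(3) by (auto simp: cls_def)
    then show "D \<in> (\<lambda>C. cls B (SOME x. x \<in> C)) ` (cls A ` OK)" using x by blast
  qed
  then show ?thesis using assms(4) finite_subset by blast
qed

text \<open>Lagrange's theorem: every coset of B consists of equally many cosets of A.\<close>

lemma ideal_norm_dvd_mono:
  assumes A: "is_ideal K A" and B: "is_ideal K B" and AB: "A \<subseteq> B" and fin: "finite (cls A ` OK)"
  shows "ideal_norm K B dvd ideal_norm K A"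
proof -
  have BO: "B \<subseteq> OK" by (rule ideal_D[OF B])
  have union: "cls A ` OK = (\<Union>D\<in>cls B ` OK. cls A ` D)"
  proof
    show "cls A ` OK \<subseteq> (\<Union>D\<in>cls B ` OK. cls A ` D)"
      using ideal_D(2)[OF B] by (auto simp: cls_def)
    show "(\<Union>D\<in>cls B ` OK. cls A ` D) \<subseteq> cls A ` OK" by (auto simp: cls_def)
  qed
  have finB: "finite (cls B ` OK)" by (rule cls_finite_mono[OF A B AB fin])
  have card: "card (cls A ` D) = card (cls A ` B)" if D: "D \<in> cls B ` OK" for D
  proof -
    obtain z where z: "z \<in> OK" "D = cls B z" using D by blast
    have "D = (\<lambda>b. z - b) ` B"
    proof
      show "D \<subseteq> (\<lambda>b. z - b) ` B"
      proof
        fix y assume "y \<in> D"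
        then have "z - y \<in> B" "y = z - (z - y)" by (auto simp: z cls_def)
        then show "y \<in> (\<lambda>b. z - b) ` B" by blast
      qed
      show "(\<lambda>b. z - b) ` B \<subseteq> D" using z BO by (auto simp: cls_def intro: OK_closed)
    qed
    then have "cls A ` D = (\<lambda>b. cls A (z - b)) ` B" by (simp add: image_image)
    moreover have "card ((\<lambda>b. cls A (z - b)) ` B) = card (cls A ` B)"
    proof (rule card_image_eq_if_same_fibres)
      fix b c assume "b \<in> B" "c \<in> B"
      then have "b \<in> OK" "c \<in> OK" using BO by auto
      then show "(cls A (z - b) = cls A (z - c)) = (cls A b = cls A c)"
        using z(1) ideal_D(6)[OF A, of "b - c"] ideal_D(6)[OF A, of "c - b"]
        by (auto simp: cls_eq_iff[OF A] OK_closed)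
    qed
    ultimately show ?thesis by simp
  qed
  have "ideal_norm K A = (\<Sum>D\<in>cls B ` OK. card (cls A ` D))"
    unfolding ideal_norm_cls union
  proof (rule card_UN_disjoint[OF finB])
    show "\<forall>D\<in>cls B ` OK. finite (cls A ` D)"
    proof
      fix D assume "D \<in> cls B ` OK"
      then have "D \<subseteq> OK" by (auto simp: cls_def)
      then have "cls A ` D \<subseteq> cls A ` OK" by (rule image_mono)
      then show "finite (cls A ` D)" using fin by (rule finite_subset)
    qed
    show "\<forall>D\<in>cls B ` OK. \<forall>E\<in>cls B ` OK. D \<noteq> E \<longrightarrow> cls A ` D \<inter> cls A ` E = {}"
    proof (intro ballI impI)
      fix D E assume DE: "D \<in> cls B ` OK" "E \<in> cls B ` OK" "D \<noteq> E"
      then obtain z w where zw: "z \<in> OK" "w \<in> OK" "D = cls B z" "E = cls B w" by blast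
      show "cls A ` D \<inter> cls A ` E = {}"
      proof (rule ccontr)
        assume "cls A ` D \<inter> cls A ` E \<noteq> {}"
        then obtain x y where xy: "x \<in> D" "y \<in> E" "cls A x = cls A y" by blast
        then have O: "x \<in> OK" "y \<in> OK" and b: "z - x \<in> B" "w - y \<in> B" by (auto simp: zw cls_def)
        have "x - y \<in> B" using xy(3) O AB by (auto simp: cls_eq_iff[OF A])
        from ideal_D(7)[OF B ideal_D(3)[OF B b(1) this] b(2)]
        have "(z - x) + (x - y) - (w - y) \<in> B" .
        then have "z - w \<in> B" by simp
        then show False using DE(3) zw cls_eq_iff[OF B] by blast
      qed
    qed
  qed
  also have "\<dots> = ideal_norm K B * card (cls A ` B)" using card by (simp add: ideal_norm_cls)
  finally show ?thesis by simp
qed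

definition comaximal :: "complex set \<Rightarrow> complex set \<Rightarrow> bool" where
  "comaximal A B \<longleftrightarrow> (\<exists>a\<in>A. \<exists>b\<in>B. a + b = 1)"

lemma ideal_inter: "is_ideal K A \<Longrightarrow> is_ideal K B \<Longrightarrow> is_ideal K (A \<inter> B)"
  unfolding is_ideal_def by blast

lemma ideal_OK: "is_ideal K OK"
  unfolding is_ideal_def by (auto intro: OK_closed)

text \<open>The Chinese remainder theorem: with a + b = 1 the element x b + y a solves the two
  congruences.\<close>

lemma ideal_norm_inter:
  assumes A: "is_ideal K A" and B: "is_ideal K B" and "comaximal A B"
  shows "ideal_norm K (A \<inter> B) = ideal_norm K A * ideal_norm K B"
proof -
  obtain a b where ab: "a \<in> A" "b \<in> B" "a + b = 1" using assms(3) unfolding comaximal_def by blast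
  have O: "a \<in> OK" "b \<in> OK" using ab ideal_D(1)[OF A] ideal_D(1)[OF B] by auto
  have "ideal_norm K (A \<inter> B) = card ((\<lambda>x. (cls A x, cls B x)) ` OK)"
    unfolding ideal_norm_cls
    by (rule card_image_eq_if_same_fibres) (simp add: cls_eq_iff[OF A] cls_eq_iff[OF B] cls_eq_iff[OF ideal_inter[OF A B]])
  also have "(\<lambda>x. (cls A x, cls B x)) ` OK = cls A ` OK \<times> cls B ` OK"
  proof
    show "cls A ` OK \<times> cls B ` OK \<subseteq> (\<lambda>x. (cls A x, cls B x)) ` OK"
    proof safe
      fix x y assume xy: "x \<in> OK" "y \<in> OK"
      define z where "z = x * b + y * a"
      have z: "z \<in> OK" unfolding z_def by (intro OK_closed xy O)
      have ba: "b = 1 - a" using ab by (simp add: algebra_simps)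
      have "x - z = (x - y) * a" unfolding z_def ba by (simp add: algebra_simps)
      moreover have "y - z = (y - x) * b" unfolding z_def ba by (simp add: algebra_simps)
      ultimately have "x - z \<in> A" "y - z \<in> B"
        using ab xy ideal_D(4)[OF A] ideal_D(4)[OF B] OK_closed(6) by metis+
      then have "cls A x = cls A z" "cls B y = cls B z"
        using cls_eq_iff[OF A xy(1) z] cls_eq_iff[OF B xy(2) z] by auto
      then show "(cls A x, cls B y) \<in> (\<lambda>x. (cls A x, cls B x)) ` OK" using z by auto
    qed
  qed auto
  finally show ?thesis by (simp add: ideal_norm_cls card_cartesian_product)
qed

lemma ideal_mult_eq_inter:
  assumes A: "is_ideal K A" and B: "is_ideal K B" and "comaximal A B"
  shows "ideal_mult A B = A \<inter> B"
proof
  obtain a b where ab: "a \<in> A" "b \<in> B" "a + b = 1" using assms(3) unfolding comaximal_def by blast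
  show "ideal_mult A B \<subseteq> A \<inter> B"
  proof
    fix z assume "z \<in> ideal_mult A B"
    then obtain xs ys where "set xs \<subseteq> A" "set ys \<subseteq> B" "length xs = length ys" "z = sum_list (map2 (*) xs ys)"
      unfolding ideal_mult_def by blast
    then show "z \<in> A \<inter> B"
    proof (induction xs arbitrary: ys z)
      case Nil then show ?case using ideal_D(2)[OF A] ideal_D(2)[OF B] by simp
    next
      case (Cons x xs)
      then obtain y ys' where ys: "ys = y # ys'" by (cases ys) auto
      have "sum_list (map2 (*) xs ys') \<in> A \<inter> B" using Cons.IH[of ys'] Cons.prems ys by auto
      moreover have "x * y \<in> A" "x * y \<in> B"
        using Cons.prems ys ideal_D(5)[OF A, of x y] ideal_D(4)[OF B, of y x] ideal_D(1)[OF A] ideal_D(1)[OF B] by auto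
      ultimately show ?case using Cons.prems ys ideal_D(3)[OF A] ideal_D(3)[OF B] by auto
    qed
  qed
  show "A \<inter> B \<subseteq> ideal_mult A B"
  proof
    fix x assume x: "x \<in> A \<inter> B"
    have "x = a * x + x * b" using ab(3) by (metis distrib_right mult.commute mult_1)
    then have "x = sum_list (map2 (*) [a, x] [x, b])" by simp
    moreover have "set [a, x] \<subseteq> A" "set [x, b] \<subseteq> B" using x ab by auto
    ultimately show "x \<in> ideal_mult A B" unfolding ideal_mult_def mem_Collect_eq
      by (intro exI[of _ "[a, x]"] exI[of _ "[x, b]"]) auto
  qed
qed

lemma ideal_sum:
  assumes I: "is_ideal K I" and "\<And>i. i \<in> A \<Longrightarrow> f i \<in> I" shows "sum f A \<in> I"
  using assms(2) by (induction A rule: infinite_finite_induct) (auto intro: ideal_D(2,3)[OF I])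

lemma ideal_one_minus_prod:
  assumes I: "is_ideal K I" and "\<And>i. i \<in> A \<Longrightarrow> f i \<in> OK" "\<And>i. i \<in> A \<Longrightarrow> 1 - f i \<in> I"
  shows "1 - prod f A \<in> I"
  using assms(2,3)
proof (induction A rule: infinite_finite_induct)
  case (insert j A)
  have e: "1 - prod f (insert j A) = (1 - f j) + f j * (1 - prod f A)" using insert.hyps by (simp add: algebra_simps)
  have "f j * (1 - prod f A) \<in> I" using insert by (intro ideal_D(4)[OF I]) auto
  moreover have "1 - f j \<in> I" using insert.prems by simp
  ultimately show ?case unfolding e by (intro ideal_D(3)[OF I])
qed (use ideal_D(2)[OF I] in auto)

lemma ideal_prod_mem:
  assumes I: "is_ideal K I" and "finite A" "j \<in> A" "f j \<in> I" "\<And>i. i \<in> A \<Longrightarrow> f i \<in> OK"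
  shows "prod f A \<in> I"
proof -
  have "prod f A = f j * prod f (A - {j})" using assms by (simp add: prod.remove)
  moreover have "prod f (A - {j}) \<in> OK" using assms by (intro OK_prod) auto
  ultimately show ?thesis using ideal_D(5)[OF I assms(4)] by simp
qed

section \<open>Principal ideals generated by integers\<close>

lemma ideal_principal: "is_ideal K (principal_nat K m)"
  unfolding is_ideal_def principal_nat_def
proof (intro conjI ballI)
  show "{of_nat m * x |x. x \<in> OK} \<subseteq> OK" by (auto intro: OK_closed)
  show "0 \<in> {of_nat m * x |x. x \<in> OK}" using OK_closed(1) by (auto intro!: exI[of _ 0])
  fix x assume "x \<in> {of_nat m * x |x. x \<in> OK}"
  then obtain x' where x': "x = of_nat m * x'" "x' \<in> OK" by blast
  show "x + y \<in> {of_nat m * x |x. x \<in> OK}" if y: "y \<in> {of_nat m * x |x. x \<in> OK}" for y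
  proof -
    obtain y' where "y = of_nat m * y'" "y' \<in> OK" using y by blast
    then show ?thesis using x' by (auto intro!: exI[of _ "x' + y'"] simp: distrib_left OK_closed)
  qed
  show "r * x \<in> {of_nat m * x |x. x \<in> OK}" if "r \<in> OK" for r
    using that x' by (auto intro!: exI[of _ "r * x'"] simp: OK_closed)
qed

lemma principal_subset:
  assumes "is_ideal K A" "of_nat m \<in> A" shows "principal_nat K m \<subseteq> A"
  using ideal_D(5)[OF assms(1) assms(2)] by (auto simp: principal_nat_def)

lemma of_nat_in_principal: "of_nat m \<in> principal_nat K m"
  unfolding principal_nat_def using OK_closed(2) by (auto intro!: exI[of _ 1])

lemma elt_in_principal:
  assumes "m > 0"
  shows "elt c \<in> principal_nat K m \<longleftrightarrow> (\<forall>i<dimK. int m dvd c i)"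
proof
  assume "elt c \<in> principal_nat K m"
  then obtain d where "elt c = of_nat m * elt d" unfolding principal_nat_def using elt_surj by blast
  then have "elt c = elt (\<lambda>i. int m * d i)" by (simp add: elt_scale)
  then show "\<forall>i<dimK. int m dvd c i" using elt_inj by fastforce
next
  assume d: "\<forall>i<dimK. int m dvd c i"
  have "elt c = elt (\<lambda>i. int m * (c i div int m))" unfolding elt_def using d by (intro sum.cong) auto
  then have "elt c = of_nat m * elt (\<lambda>i. c i div int m)" by (simp add: elt_scale)
  then show "elt c \<in> principal_nat K m" unfolding principal_nat_def using elt_OK by blast
qed

text \<open>In the integral basis, reducing every coordinate modulo m selects exactly one
  representative of each class.\<close>

lemma ideal_norm_principal:
  assumes "m > 0"
  shows "finite (cls (principal_nat K m) ` OK)" "ideal_norm K (principal_nat K m) = m ^ dimK"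
proof -
  let ?P = "PiE {..<dimK} (\<lambda>_. {..<m})"
  let ?f = "\<lambda>c. cls (principal_nat K m) (elt (\<lambda>i. int (c i)))"
  note I = ideal_principal[of m]
  have im: "?f ` ?P = cls (principal_nat K m) ` OK"
  proof
    show "cls (principal_nat K m) ` OK \<subseteq> ?f ` ?P"
    proof
      fix C assume "C \<in> cls (principal_nat K m) ` OK"
      then obtain c where c: "C = cls (principal_nat K m) (elt c)" using elt_surj by blast
      define d where "d = (\<lambda>i\<in>{..<dimK}. nat (c i mod int m))"
      have "d \<in> ?P" using assms by (auto simp: d_def nat_less_iff)
      moreover have "C = ?f d"
      proof -
        have "elt c - elt (\<lambda>i. int (d i)) \<in> principal_nat K m"
          unfolding elt_diff[symmetric] elt_in_principal[OF assms] using assms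
          by (auto simp: d_def dvd_eq_mod_eq_0 mod_diff_right_eq)
        then show ?thesis unfolding c using cls_eq_iff[OF I elt_OK elt_OK] by blast
      qed
      ultimately show "C \<in> ?f ` ?P" by blast
    qed
  qed (auto intro: elt_OK)
  have inj: "inj_on ?f ?P"
  proof (rule inj_onI)
    fix c d assume cd: "c \<in> ?P" "d \<in> ?P" "?f c = ?f d"
    then have "elt (\<lambda>i. int (c i)) - elt (\<lambda>i. int (d i)) \<in> principal_nat K m"
      using cls_eq_iff[OF I elt_OK elt_OK] by blast
    then have dv: "int m dvd int (c i) - int (d i)" if "i < dimK" for i
      using that unfolding elt_diff[symmetric] elt_in_principal[OF assms] by blast
    show "c = d"
    proof (rule PiE_ext[OF cd(1,2)])
      fix i assume i: "i \<in> {..<dimK}"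
      then have "c i < m" "d i < m" using cd(1,2) by auto
      moreover have "int (c i) mod int m = int (d i) mod int m" using dv[of i] i by (simp add: mod_eq_dvd_iff)
      ultimately show "c i = d i" by simp
    qed
  qed
  show "finite (cls (principal_nat K m) ` OK)" unfolding im[symmetric] by (intro finite_imageI finite_PiE) auto
  show "ideal_norm K (principal_nat K m) = m ^ dimK"
    unfolding ideal_norm_cls im[symmetric] card_image[OF inj] by (simp add: card_PiE)
qed

section \<open>Maximal ideals over a prime\<close>

text \<open>Maximality is phrased as invertibility modulo P of everything outside P, the form in
  which primality and comaximality follow at once.\<close>

definition maximal :: "complex set \<Rightarrow> bool" where
  "maximal P \<longleftrightarrow> is_ideal K P \<and> 1 \<notin> P \<and> (\<forall>x\<in>OK. x \<notin> P \<longrightarrow> (\<exists>y\<in>OK. 1 - x * y \<in> P))"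

definition primes_over :: "nat \<Rightarrow> complex set set" where "primes_over p = {P. maximal P \<and> of_nat p \<in> P}"

lemma maximal_ideal: "maximal P \<Longrightarrow> is_ideal K P" and maximal_1: "maximal P \<Longrightarrow> 1 \<notin> P"
  by (auto simp: maximal_def)

lemma maximal_prime: "maximal P \<Longrightarrow> x \<in> OK \<Longrightarrow> y \<in> OK \<Longrightarrow> x * y \<in> P \<Longrightarrow> x \<in> P \<or> y \<in> P"
proof (rule ccontr)
  assume P: "maximal P" and xy: "x \<in> OK" "y \<in> OK" "x * y \<in> P" and n: "\<not> (x \<in> P \<or> y \<in> P)"
  note I = maximal_ideal[OF P]
  obtain z where z: "z \<in> OK" "1 - x * z \<in> P" using P xy n unfolding maximal_def by blast
  have "y = y * (1 - x * z) + z * (x * y)" by (simp add: algebra_simps)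
  moreover have "y * (1 - x * z) \<in> P" "z * (x * y) \<in> P" using z xy by (auto intro: ideal_D(4)[OF I])
  ultimately have "y \<in> P" using ideal_D(3)[OF I] by metis
  with n show False by blast
qed

lemma maximal_prod:
  assumes P: "maximal P" and "\<And>i. i \<in> A \<Longrightarrow> f i \<in> OK" "\<And>i. i \<in> A \<Longrightarrow> f i \<notin> P"
  shows "prod f A \<notin> P"
  using assms(2,3)
proof (induction A rule: infinite_finite_induct)
  case (insert j A)
  have "prod f A \<in> OK" using insert by (intro OK_prod) auto
  then show ?case using insert maximal_prime[OF P, of "f j" "prod f A"] by auto
qed (use maximal_1[OF P] in auto)

lemma maximal_prime_ideal: "maximal P \<Longrightarrow> prime_ideal K P"
  unfolding prime_ideal_def using maximal_ideal maximal_1 maximal_prime OK_closed(2) by blast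

lemma maximal_comaximal:
  assumes P: "maximal P" and Q: "maximal Q" and "P \<noteq> Q"
  shows "\<exists>a\<in>P. 1 - a \<in> Q"
proof -
  have "\<not> P \<subseteq> Q"
  proof
    assume PQ: "P \<subseteq> Q"
    then obtain q where q: "q \<in> Q" "q \<notin> P" using assms(3) by blast
    then have "q \<in> OK" using ideal_D(1)[OF maximal_ideal[OF Q]] by auto
    then obtain y where y: "y \<in> OK" "1 - q * y \<in> P" using P q unfolding maximal_def by blast
    then have "(1 - q * y) + q * y \<in> Q" using PQ q y by (intro ideal_D(3,5)[OF maximal_ideal[OF Q]]) auto
    then show False using maximal_1[OF Q] by simp
  qed
  then obtain x where x: "x \<in> P" "x \<notin> Q" by blast
  then have xO: "x \<in> OK" using ideal_D(1)[OF maximal_ideal[OF P]] by auto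
  then obtain y where y: "y \<in> OK" "1 - x * y \<in> Q" using Q x unfolding maximal_def by blast
  then show ?thesis using ideal_D(5)[OF maximal_ideal[OF P] x(1) y(1)] by blast
qed

lemma primes_over_int:
  assumes "prime p" "P \<in> primes_over p" shows "of_int m \<in> P \<longleftrightarrow> int p dvd m"
proof
  have I: "is_ideal K P" and pP: "of_nat p \<in> P" and 1: "1 \<notin> P" using assms unfolding primes_over_def maximal_def by auto
  show "of_int m \<in> P" if "int p dvd m"
  proof -
    obtain k where "m = int p * k" using \<open>int p dvd m\<close> by (elim dvdE)
    then have "of_int m = (of_nat p * of_int k :: complex)" by simp
    then show ?thesis using ideal_D(5)[OF I pP OK_closed(7)[of k]] by simp
  qed
  show "int p dvd m" if m: "of_int m \<in> P"
  proof (rule ccontr)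
    assume "\<not> int p dvd m"
    then have "coprime (int p) m" using assms(1) by (simp add: prime_imp_coprime)
    then obtain u v where "u * int p + v * m = 1" using bezout_int[of "int p" m] by auto
    then have "of_int (u * int p + v * m) = (1::complex)" by simp
    then have "of_int u * of_nat p + of_int v * of_int m = (1::complex)" by simp
    moreover have "of_int u * of_nat p + of_int v * of_int m \<in> P"
      using pP m by (intro ideal_D(3,4)[OF I] OK_closed)
    ultimately show False using 1 by simp
  qed
qed

text \<open>An ideal containing p is a union of classes modulo p O_K, and there are only finitely
  many classes.\<close>

lemma finite_ideals_containing:
  assumes "p > 0" shows "finite {I. is_ideal K I \<and> of_nat p \<in> I}"
proof -
  let ?A = "principal_nat K p"
  have "inj_on (\<lambda>I. cls ?A ` I) {I. is_ideal K I \<and> of_nat p \<in> I}"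
  proof (rule inj_on_inverseI[where g = Union])
    fix I assume "I \<in> {I. is_ideal K I \<and> of_nat p \<in> I}"
    then have I: "is_ideal K I" "?A \<subseteq> I" using principal_subset by auto
    show "\<Union> (cls ?A ` I) = I"
    proof
      show "\<Union> (cls ?A ` I) \<subseteq> I"
      proof
        fix y assume "y \<in> \<Union> (cls ?A ` I)"
        then obtain x where x: "x \<in> I" "x - y \<in> ?A" by (auto simp: cls_def)
        from ideal_D(7)[OF I(1) x(1) subsetD[OF I(2) x(2)]] have "x - (x - y) \<in> I" .
        then show "y \<in> I" by simp
      qed
      show "I \<subseteq> \<Union> (cls ?A ` I)" using ideal_D(1)[OF I(1)] ideal_D(2)[OF ideal_principal] by (auto simp: cls_def)
    qed
  qed
  moreover have "(\<lambda>I. cls ?A ` I) ` {I. is_ideal K I \<and> of_nat p \<in> I} \<subseteq> Pow (cls ?A ` OK)"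
    using ideal_D(1) by blast
  moreover have "finite (Pow (cls ?A ` OK))" using ideal_norm_principal(1)[OF assms] by simp
  ultimately show ?thesis by (meson finite_imageD finite_subset)
qed

lemma finite_primes_over: "p > 0 \<Longrightarrow> finite (primes_over p)"
  by (rule finite_subset[OF _ finite_ideals_containing[of p]]) (auto simp: primes_over_def maximal_def)

lemma ideal_plus_principal:
  assumes A: "is_ideal K A" and x: "x \<in> OK"
  shows "is_ideal K {a + x * y | a y. a \<in> A \<and> y \<in> OK}" (is "is_ideal K ?B")
    and "A \<subseteq> {a + x * y | a y. a \<in> A \<and> y \<in> OK}" and "x \<in> {a + x * y | a y. a \<in> A \<and> y \<in> OK}"
proof -
  have B: "a + x * y \<in> ?B" if "a \<in> A" "y \<in> OK" for a y using that by blast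
  show "is_ideal K ?B" unfolding is_ideal_def
  proof (intro conjI ballI)
    show "?B \<subseteq> OK" using x ideal_D(1)[OF A] by (auto intro!: OK_closed)
    show "0 \<in> ?B" using B[OF ideal_D(2)[OF A] OK_closed(1)] by simp
    fix u assume "u \<in> ?B"
    then obtain a y where u: "u = a + x * y" "a \<in> A" "y \<in> OK" by blast
    show "u + v \<in> ?B" if v: "v \<in> ?B" for v
    proof -
      obtain b z where "v = b + x * z" "b \<in> A" "z \<in> OK" using v by blast
      then show ?thesis using u B[of "a + b" "y + z"] ideal_D(3)[OF A] OK_closed(3) by (simp add: algebra_simps)
    qed
    show "r * u \<in> ?B" if "r \<in> OK" for r
      using u that B[of "r * a" "r * y"] ideal_D(4)[OF A] OK_closed(4) by (simp add: algebra_simps)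
  qed
  show "A \<subseteq> ?B" using B[OF _ OK_closed(1)] by auto
  show "x \<in> ?B" using B[OF ideal_D(2)[OF A] OK_closed(2)] by simp
qed

text \<open>A largest one among the finitely many proper ideals containing p is maximal: adjoining
  an element outside it yields the unit ideal.\<close>

lemma primes_over_nonempty:
  assumes p: "prime p" shows "primes_over p \<noteq> {}"
proof -
  let ?S = "{I. is_ideal K I \<and> of_nat p \<in> I \<and> 1 \<notin> I}"
  have p1: "p > 1" using p by (rule prime_gt_1_nat)
  have fin: "finite ?S" by (rule finite_subset[OF _ finite_ideals_containing[of p]]) (use p1 in auto)
  \<comment> \<open>Otherwise 1 / p would be a rational algebraic integer, hence an integer.\<close>
  have "1 \<notin> principal_nat K p"
  proof
    assume "1 \<in> principal_nat K p"
    then obtain x where x: "1 = of_nat p * x" "x \<in> OK" by (auto simp: principal_nat_def)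
    then have "x = of_rat (1 / of_nat p)" using p1 by (simp add: of_rat_divide field_simps)
    then have "x \<in> \<rat>" by simp
    then obtain k where "x = of_int k" using rational_OK_int[OF x(2)] by blast
    then have "of_int (int p * k) = (1::complex)" using x by simp
    then have "int p * k = 1" by (simp only: of_int_eq_1_iff)
    then have "int p dvd int 1" by (metis dvd_triv_left of_nat_1)
    then have "p dvd 1" by (simp only: int_dvd_int_iff)
    then show False using p1 by simp
  qed
  then have "?S \<noteq> {}" using ideal_principal of_nat_in_principal by blast
  then obtain P where P: "P \<in> ?S" "\<And>I. I \<in> ?S \<Longrightarrow> P \<subseteq> I \<Longrightarrow> P = I"
    using finite_has_maximal[OF fin] by blast
  have "maximal P" unfolding maximal_def
  proof (intro conjI ballI impI)
    fix x assume x: "x \<in> OK" "x \<notin> P"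
    let ?B = "{a + x * y | a y. a \<in> P \<and> y \<in> OK}"
    have B: "is_ideal K ?B" "P \<subseteq> ?B" "x \<in> ?B" using ideal_plus_principal[of P x] P(1) x by auto
    have "?B \<notin> ?S" using P(2)[of ?B] B x by blast
    then have "1 \<in> ?B" using B P(1) by blast
    then obtain a y where ay: "1 = a + x * y" "a \<in> P" "y \<in> OK" by blast
    then have "1 - x * y = a" by (simp add: algebra_simps)
    then show "\<exists>y\<in>OK. 1 - x * y \<in> P" using ay by auto
  qed (use P in auto)
  then show ?thesis using P(1) unfolding primes_over_def by blast
qed

section \<open>The Galois action on the primes over p and the splitting of p\<close>

definition preimage :: "(complex \<Rightarrow> complex) \<Rightarrow> complex set \<Rightarrow> complex set" where
  "preimage \<sigma> P = {x \<in> OK. \<sigma> x \<in> P}"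

lemma emb_image_OK: assumes s: "\<sigma> \<in> G" shows "\<sigma> ` OK = OK"
proof
  show "\<sigma> ` OK \<subseteq> OK" using emb_OK[OF s] by blast
  obtain \<tau> where t: "\<tau> \<in> G" "\<And>x. x \<in> K \<Longrightarrow> \<sigma> (\<tau> x) = x" using inverse_in_G[OF s] by metis
  show "OK \<subseteq> \<sigma> ` OK"
  proof
    fix x assume x: "x \<in> OK"
    have "\<sigma> (\<tau> x) = x" "\<tau> x \<in> OK" using t(2)[OF OK_D(1)[OF x]] emb_OK[OF t(1) x] by auto
    then show "x \<in> \<sigma> ` OK" by (metis imageI)
  qed
qed

lemma preimage_ideal:
  assumes s: "\<sigma> \<in> G" and P: "is_ideal K P" shows "is_ideal K (preimage \<sigma> P)"
  unfolding is_ideal_def preimage_def using ideal_D[OF P]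
  by (auto simp: emb_0[OF s] emb_add[OF s] emb_mult[OF s] OK_D OK_closed emb_OK[OF s])

lemma preimage_primes_over:
  assumes s: "\<sigma> \<in> G" and P: "P \<in> primes_over p" shows "preimage \<sigma> P \<in> primes_over p"
proof -
  have m: "maximal P" and pP: "of_nat p \<in> P" using P by (auto simp: primes_over_def)
  have "maximal (preimage \<sigma> P)" unfolding maximal_def
  proof (intro conjI ballI impI)
    show "is_ideal K (preimage \<sigma> P)" by (rule preimage_ideal[OF s maximal_ideal[OF m]])
    show "1 \<notin> preimage \<sigma> P" using maximal_1[OF m] emb_1[OF s] by (simp add: preimage_def)
    fix x assume x: "x \<in> OK" "x \<notin> preimage \<sigma> P"
    then have "\<sigma> x \<notin> P" "\<sigma> x \<in> OK" using emb_OK[OF s] by (auto simp: preimage_def)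
    then obtain y where y: "y \<in> OK" "1 - \<sigma> x * y \<in> P" using m unfolding maximal_def by blast
    obtain z where z: "z \<in> OK" "y = \<sigma> z" using y(1) emb_image_OK[OF s] by blast
    have "\<sigma> (1 - x * z) = 1 - \<sigma> x * y"
      using x z by (simp add: emb_diff[OF s] emb_mult[OF s] emb_1[OF s] OK_D K_closed)
    then show "\<exists>y\<in>OK. 1 - x * y \<in> preimage \<sigma> P" using x y z by (intro bexI[of _ z]) (auto simp: preimage_def OK_closed)
  qed
  moreover have "of_nat p \<in> preimage \<sigma> P" using pP emb_of_nat[OF s] by (simp add: preimage_def OK_closed)
  ultimately show ?thesis by (simp add: primes_over_def)
qed

lemma preimage_norm:
  assumes s: "\<sigma> \<in> G" and P: "is_ideal K P" shows "ideal_norm K (preimage \<sigma> P) = ideal_norm K P"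
proof -
  have "ideal_norm K (preimage \<sigma> P) = card ((\<lambda>x. cls P (\<sigma> x)) ` OK)"
    unfolding ideal_norm_cls
  proof (rule card_image_eq_if_same_fibres)
    fix x y assume x: "x \<in> OK" and y: "y \<in> OK"
    have "x - y \<in> preimage \<sigma> P \<longleftrightarrow> \<sigma> x - \<sigma> y \<in> P"
      using x y by (simp add: preimage_def emb_diff[OF s] OK_D OK_closed)
    then show "(cls (preimage \<sigma> P) x = cls (preimage \<sigma> P) y) = (cls P (\<sigma> x) = cls P (\<sigma> y))"
      using cls_eq_iff[OF preimage_ideal[OF s P] x y] cls_eq_iff[OF P emb_OK[OF s x] emb_OK[OF s y]] by simp
  qed
  also have "(\<lambda>x. cls P (\<sigma> x)) ` OK = cls P ` (\<sigma> ` OK)" by (simp add: image_image)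
  finally show ?thesis by (simp add: emb_image_OK[OF s] ideal_norm_cls)
qed

text \<open>If Q were no conjugate of P, comaximality would give an x in Q congruent to 1 modulo
  every conjugate of P. Its norm is then a rational integer in Q but not in P, although both contain
  the same integers, the multiples of p.\<close>

lemma primes_over_transitive:
  assumes p: "prime p" and P: "P \<in> primes_over p" and Q: "Q \<in> primes_over p"
  shows "\<exists>\<sigma>\<in>G. Q = preimage \<sigma> P"
proof (rule ccontr)
  assume n: "\<not> ?thesis"
  have mP: "maximal P" and mQ: "maximal Q" using P Q by (auto simp: primes_over_def)
  note IQ = maximal_ideal[OF mQ]
  have "\<exists>x\<in>Q. 1 - x \<in> preimage \<sigma> P" if "\<sigma> \<in> G" for \<sigma>
  proof (rule maximal_comaximal[OF mQ])
    show "maximal (preimage \<sigma> P)" using preimage_primes_over[OF that P] by (simp add: primes_over_def)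
    show "Q \<noteq> preimage \<sigma> P" using n that by auto
  qed
  then obtain f where f: "\<And>\<sigma>. \<sigma> \<in> G \<Longrightarrow> f \<sigma> \<in> Q" "\<And>\<sigma>. \<sigma> \<in> G \<Longrightarrow> 1 - f \<sigma> \<in> preimage \<sigma> P" by metis
  have fO: "f \<sigma> \<in> OK" if "\<sigma> \<in> G" for \<sigma> using f(1)[OF that] ideal_D(1)[OF IQ] by auto
  define x where "x = 1 - (\<Prod>\<sigma>\<in>G. 1 - f \<sigma>)"
  have xQ: "x \<in> Q" unfolding x_def by (rule ideal_one_minus_prod[OF IQ]) (auto simp: f fO OK_closed)
  have xO: "x \<in> OK" using xQ ideal_D(1)[OF IQ] by auto
  have notin: "\<sigma> x \<notin> P" if s: "\<sigma> \<in> G" for \<sigma>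
  proof
    assume "\<sigma> x \<in> P"
    then have "x \<in> preimage \<sigma> P" using xO by (simp add: preimage_def)
    moreover have I: "is_ideal K (preimage \<sigma> P)" by (rule preimage_ideal[OF s maximal_ideal[OF mP]])
    moreover have "(\<Prod>\<sigma>\<in>G. 1 - f \<sigma>) \<in> preimage \<sigma> P"
      by (rule ideal_prod_mem[OF I finite_G s]) (auto simp: f s fO OK_closed)
    ultimately have "x + (\<Prod>\<sigma>\<in>G. 1 - f \<sigma>) \<in> preimage \<sigma> P" by (intro ideal_D(3)[OF I])
    then show False using preimage_primes_over[OF s P] by (simp add: x_def primes_over_def maximal_def)
  qed
  have "norm_el x \<notin> P" unfolding norm_el_def by (rule maximal_prod[OF mP]) (auto simp: notin emb_OK xO)
  moreover have "norm_el x \<in> Q" unfolding norm_el_def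
    by (rule ideal_prod_mem[OF IQ finite_G idK_in_G]) (auto simp: idK_def xQ OK_D xO emb_OK)
  moreover obtain k where "norm_el x = of_int k" using norm_int[OF xO] by blast
  ultimately show False using primes_over_int[OF p P] primes_over_int[OF p Q] by simp
qed

text \<open>The discriminant enters here. If x lies in all primes over p, then all conjugates of x y
  lie in P, so the trace of x y is divisible by p for every integral y. Nondegeneracy modulo p then
  forces p to divide x.\<close>

lemma primes_over_inter:
  assumes p: "prime p" "\<not> int p dvd discriminant K"
  shows "OK \<inter> \<Inter>(primes_over p) = principal_nat K p"
proof
  show "principal_nat K p \<subseteq> OK \<inter> \<Inter>(primes_over p)"
    using principal_subset ideal_D(1)[OF ideal_principal] by (auto simp: primes_over_def maximal_def)
  show "OK \<inter> \<Inter>(primes_over p) \<subseteq> principal_nat K p"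
  proof
    fix x assume x: "x \<in> OK \<inter> \<Inter>(primes_over p)"
    then obtain c where c: "x = elt c" using elt_surj by blast
    obtain P where P: "P \<in> primes_over p" using primes_over_nonempty[OF p(1)] by blast
    then have I: "is_ideal K P" by (simp add: primes_over_def maximal_def)
    have sx: "\<sigma> x \<in> P" if "\<sigma> \<in> G" for \<sigma> using x preimage_primes_over[OF that P] by (auto simp: preimage_def)
    have "int p dvd tr (elt c * y)" if y: "y \<in> OK" for y
    proof -
      have "field_trace K (x * y) \<in> P" unfolding field_trace_def
      proof -
        have "\<sigma> (x * y) \<in> P" if s: "\<sigma> \<in> G" for \<sigma>
          using sx[OF s] x y by (simp add: emb_mult[OF s] OK_D ideal_D(5)[OF I] emb_OK[OF s])
        then show "(\<Sum>\<sigma>\<in>G. \<sigma> (x * y)) \<in> P" by (rule ideal_sum[OF I])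
      qed
      then have "of_int (tr (x * y)) \<in> P" using x y by (simp add: tr OK_closed)
      then show ?thesis using primes_over_int[OF p(1) P] c by simp
    qed
    then have "\<forall>i<dimK. int p dvd c i" using trace_divisible_imp_divisible[of "int p" c] p by auto
    then show "x \<in> principal_nat K p" unfolding c using elt_in_principal[of p c] prime_gt_0_nat[OF p(1)] by simp
  qed
qed

text \<open>Induction with the Chinese remainder theorem: multiplying suitable elements of the other
  primes gives an element of all of them that is 1 modulo P. The intersection with O_K takes care of
  the empty list, whose \<open>Inter\<close> is the whole type.\<close>

lemma ideal_prod_list_maximal:
  assumes "distinct Ps" "\<And>P. P \<in> set Ps \<Longrightarrow> maximal P"
  shows "ideal_prod_list K Ps = OK \<inter> \<Inter>(set Ps) \<and> is_ideal K (OK \<inter> \<Inter>(set Ps))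
     \<and> ideal_norm K (OK \<inter> \<Inter>(set Ps)) = prod_list (map (ideal_norm K) Ps)"
  using assms
proof (induction Ps)
  case Nil
  have "cls OK ` OK = {OK}" using OK_closed by (auto simp: cls_def image_iff intro!: bexI[of _ 0])
  then show ?case by (simp add: ideal_prod_list_def ideal_OK ideal_norm_cls)
next
  case (Cons P Ps)
  let ?I = "OK \<inter> \<Inter>(set Ps)"
  have IH: "ideal_prod_list K Ps = ?I" "is_ideal K ?I" "ideal_norm K ?I = prod_list (map (ideal_norm K) Ps)"
    using Cons by auto
  have P: "maximal P" using Cons by simp
  have "\<exists>a\<in>Q. 1 - a \<in> P" if "Q \<in> set Ps" for Q
    using maximal_comaximal[of Q P] Cons that by auto
  then obtain f where f: "\<And>Q. Q \<in> set Ps \<Longrightarrow> f Q \<in> Q" "\<And>Q. Q \<in> set Ps \<Longrightarrow> 1 - f Q \<in> P" by metis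
  have id: "is_ideal K Q" if "Q \<in> set Ps" for Q using Cons.prems(2)[of Q] that maximal_ideal by simp
  have fO: "f Q \<in> OK" if "Q \<in> set Ps" for Q using f(1)[OF that] ideal_D(1)[OF id[OF that]] by auto
  have "prod f (set Ps) \<in> ?I"
    using f fO by (auto intro: OK_prod ideal_prod_mem[OF id])
  moreover have "1 - prod f (set Ps) \<in> P"
    by (rule ideal_one_minus_prod[OF maximal_ideal[OF P]]) (auto simp: f fO)
  ultimately have cm: "comaximal P ?I" unfolding comaximal_def
    by (intro bexI[of _ "1 - prod f (set Ps)"] bexI[of _ "prod f (set Ps)"]) auto
  have eq: "OK \<inter> \<Inter>(set (P # Ps)) = P \<inter> ?I" by auto
  have "ideal_prod_list K (P # Ps) = ideal_mult P ?I" using IH(1) by (simp add: ideal_prod_list_def)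
  then show ?case unfolding eq
    using ideal_mult_eq_inter[OF maximal_ideal[OF P] IH(2) cm] ideal_inter[OF maximal_ideal[OF P] IH(2)]
      ideal_norm_inter[OF maximal_ideal[OF P] IH(2) cm] IH(3) by simp
qed

text \<open>By transitivity the primes over p share one norm q. If there are g of them,
  multiplicativity gives q^g = p^N, so q = p^r with r g = N.\<close>

theorem splitting_of_unramified_prime:
  assumes p: "prime p" "\<not> int p dvd discriminant K" and dimK: "dimK > 0"
  shows "\<exists>r. r dvd dimK \<and> r > 0 \<and> p \<in> primes_split K r \<and> (\<forall>P\<in>primes_over p. ideal_norm K P = p ^ r)"
proof -
  have p0: "p > 0" using p prime_gt_0_nat by blast
  obtain Ps where Ps: "set Ps = primes_over p" "distinct Ps" using finite_distinct_list[OF finite_primes_over[OF p0]] by blast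
  have maxs: "maximal P" if "P \<in> set Ps" for P using that Ps by (simp add: primes_over_def)
  obtain P0 where P0: "P0 \<in> primes_over p" using primes_over_nonempty[OF p(1)] by blast
  let ?q = "ideal_norm K P0"
  have q: "ideal_norm K P = ?q" if "P \<in> primes_over p" for P
    using primes_over_transitive[OF p(1) P0 that] preimage_norm maximal_ideal P0 unfolding primes_over_def by auto
  note L = ideal_prod_list_maximal[OF Ps(2) maxs]
  have L1: "ideal_prod_list K Ps = principal_nat K p" using L primes_over_inter[OF p] Ps(1) by simp
  have "p ^ dimK = prod_list (map (ideal_norm K) Ps)"
    using L primes_over_inter[OF p] Ps(1) ideal_norm_principal(2)[OF p0] by simp
  also have "map (ideal_norm K) Ps = map (\<lambda>_. ?q) Ps" using q Ps(1) by (intro map_cong) auto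
  also have "prod_list \<dots> = ?q ^ length Ps" by (simp add: map_replicate_const)
  finally have qg: "?q ^ length Ps = p ^ dimK" by simp
  have len: "length Ps > 0" using Ps P0 by (cases Ps) auto
  then have "?q dvd p ^ dimK" unfolding qg[symmetric] by (simp add: dvd_power)
  then obtain r where r: "?q = p ^ r" using divides_primepow_nat[OF p(1)] by blast
  then have "p ^ (r * length Ps) = p ^ dimK" using qg by (simp add: power_mult)
  then have rg: "r * length Ps = dimK" using prime_gt_1_nat[OF p(1)] by (simp add: power_inject_exp)
  then have r0: "r > 0" using dimK by (cases r) auto
  have "length Ps = field_degree K div r" using rg r0 by (metis field_degree_eq nonzero_mult_div_cancel_left not_gr_zero)
  then have "p \<in> primes_split K r" unfolding primes_split_def mem_Collect_eq
    using p L1 Ps q r maximal_prime_ideal maxs by (intro conjI exI[of _ Ps]) auto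
  moreover have "r dvd dimK" unfolding rg[symmetric] by simp
  ultimately show ?thesis using r q r0 by (intro exI[of _ r]) auto
qed

section \<open>Norms exactly divisible by a prime\<close>

text \<open>The wanted prime is B = A + p O_K. Its norm divides both the norm of A and p^N, so it is
  1 or p. Since B is proper, it has norm p; the integers then represent all residues modulo B, so
  nonzero residues are invertible by Bezout.\<close>

lemma ideal_norm_exact_prime_divisor:
  assumes p: "prime p" and A: "is_ideal K A" and pos: "ideal_norm K A > 0"
    and dv: "p dvd ideal_norm K A" and nd: "\<not> p\<^sup>2 dvd ideal_norm K A"
  shows "\<exists>P\<in>primes_over p. ideal_norm K P = p"
proof -
  have p0: "p > 0" and p1: "p > 1" using p prime_gt_0_nat prime_gt_1_nat by auto
  have fin: "finite (cls A ` OK)" using pos unfolding ideal_norm_cls by (metis card.infinite less_irrefl)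
  define B where "B = {a + of_nat p * y | a y. a \<in> A \<and> y \<in> OK}"
  note B = ideal_plus_principal[OF A OK_closed(8)[of p], folded B_def]
  have "ideal_norm K B dvd ideal_norm K A" by (rule ideal_norm_dvd_mono[OF A B(1,2) fin])
  moreover have "ideal_norm K B dvd p ^ dimK"
    using ideal_norm_dvd_mono[OF ideal_principal B(1) principal_subset[OF B(1,3)]] ideal_norm_principal[OF p0] by simp
  ultimately have B1p: "ideal_norm K B = 1 \<or> ideal_norm K B = p"
  proof -
    assume d1: "ideal_norm K B dvd ideal_norm K A" and "ideal_norm K B dvd p ^ dimK"
    then obtain i where i: "ideal_norm K B = p ^ i" using divides_primepow_nat[OF p] by blast
    have "i < 2"
    proof (rule ccontr)
      assume "\<not> i < 2"
      then have "p\<^sup>2 dvd p ^ i" by (simp add: le_imp_power_dvd)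
      then show False using d1 i nd dvd_trans by metis
    qed
    then show ?thesis using i by (auto simp: less_2_cases_iff)
  qed
  \<comment> \<open>Suppose 1 = a + p y with a in A, and let e be the least positive integer in A.
    The norm of A divides e^N, so p divides e; multiplying 1 = a + p y by e / p puts e / p into A,
    against minimality.\<close>
  have notone: "1 \<notin> B"
  proof
    assume "1 \<in> B"
    then obtain a y where ay: "1 = a + of_nat p * y" "a \<in> A" "y \<in> OK" unfolding B_def by blast
    have "\<exists>m>0. of_nat m \<in> A"
    proof -
      have "\<not> inj_on (\<lambda>m::nat. cls A (of_nat m)) UNIV"
      proof
        assume "inj_on (\<lambda>m::nat. cls A (of_nat m)) UNIV"
        moreover have "range (\<lambda>m::nat. cls A (of_nat m)) \<subseteq> cls A ` OK" using OK_closed(8) by blast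
        ultimately show False using fin by (meson finite_imageD finite_subset infinite_UNIV_nat)
      qed
      then obtain i j :: nat where ij: "i \<noteq> j" "cls A (of_nat i) = cls A (of_nat j)" by (auto simp: inj_on_def)
      then have "of_nat i - of_nat j \<in> A" "of_nat j - of_nat i \<in> A"
        using cls_eq_iff[OF A OK_closed(8) OK_closed(8)] by metis+
      then have "j > i \<Longrightarrow> of_nat (j - i) \<in> A" "i > j \<Longrightarrow> of_nat (i - j) \<in> A" by (simp_all add: of_nat_diff)
      then show ?thesis using ij(1) by (meson linorder_neqE_nat zero_less_diff)
    qed
    then obtain e where e: "e > 0 \<and> of_nat e \<in> A" and min: "\<And>m. m > 0 \<and> of_nat m \<in> A \<Longrightarrow> e \<le> m"
      using ex_has_least_nat[of "\<lambda>m. m > 0 \<and> of_nat m \<in> A" _ "\<lambda>m. m"] by blast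
    have "ideal_norm K A dvd e ^ dimK"
      using ideal_norm_dvd_mono[OF ideal_principal A principal_subset[OF A conjunct2[OF e]]] ideal_norm_principal[of e] e by simp
    then have "p dvd e ^ dimK" using dv dvd_trans by blast
    then have "p dvd e" using p prime_dvd_power by blast
    then obtain e' where e': "e = p * e'" by (elim dvdE)
    have "of_nat e' * (a + of_nat p * y) = of_nat e' * a + y * of_nat e" by (simp add: e' algebra_simps)
    then have "of_nat e' = of_nat e' * a + y * of_nat e" unfolding ay(1)[symmetric] by simp
    moreover have "of_nat e' * a + y * of_nat e \<in> A" using ay e by (intro ideal_D(3,4)[OF A] OK_closed) auto
    ultimately have "of_nat e' \<in> A" by simp
    moreover have "e' > 0" using e e' by (cases e') auto
    ultimately have "e \<le> e'" using min[of e'] by blast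
    moreover have "e' < e" unfolding e' using \<open>e' > 0\<close> p1 by simp
    ultimately show False by simp
  qed
  have finB: "finite (cls B ` OK)" by (rule cls_finite_mono[OF A B(1,2) fin])
  \<comment> \<open>The numbers 0, ..., p - 1 are incongruent modulo B: a difference prime to p
    would, together with p, generate 1.\<close>
  have inj: "inj_on (\<lambda>m. cls B (of_nat m)) {..<p}"
  proof (rule inj_onI, rule ccontr)
    fix i j assume ij: "i \<in> {..<p}" "j \<in> {..<p}" "cls B (of_nat i) = cls B (of_nat j)" "i \<noteq> j"
    then have "of_nat i - of_nat j \<in> B" using cls_eq_iff[OF B(1) OK_closed(8)[of i] OK_closed(8)[of j]] by simp
    then have k: "of_int (int i - int j) \<in> B" by simp
    have "\<not> int p dvd (int i - int j)" using ij
      by (auto simp: mod_eq_dvd_iff[symmetric])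
    then have "coprime (int p) (int i - int j)" using p by (simp add: prime_imp_coprime)
    then obtain u v where "u * int p + v * (int i - int j) = 1" using bezout_int[of "int p" "int i - int j"] by auto
    then have "of_int (u * int p + v * (int i - int j)) = (1::complex)" by simp
    then have "of_int u * of_nat p + of_int v * of_int (int i - int j) = (1::complex)" by simp
    moreover have "of_int u * of_nat p + of_int v * of_int (int i - int j) \<in> B"
      using B(3) k by (intro ideal_D(3,4)[OF B(1)] OK_closed)
    ultimately show False using notone by simp
  qed
  have "card ((\<lambda>m. cls B (of_nat m)) ` {..<p}) \<le> card (cls B ` OK)"
    using finB OK_closed(8) by (intro card_mono) auto
  then have ge: "p \<le> ideal_norm K B" by (simp add: card_image[OF inj] ideal_norm_cls)
  then have Bp: "ideal_norm K B = p" using B1p p1 by auto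
  have "(\<lambda>m. cls B (of_nat m)) ` {..<p} = cls B ` OK"
    by (rule card_subset_eq[OF finB]) (use OK_closed(8) Bp in \<open>auto simp: card_image[OF inj] ideal_norm_cls\<close>)
  then have reps: "\<exists>m<p. x - of_nat m \<in> B" if "x \<in> OK" for x
    using that cls_eq_iff[OF B(1) that OK_closed(8)] by (metis (no_types, lifting) imageE imageI lessThan_iff)
  have "maximal B" unfolding maximal_def
  proof (intro conjI ballI impI B(1) notone)
    fix x assume x: "x \<in> OK" "x \<notin> B"
    obtain m where m: "m < p" "x - of_nat m \<in> B" using reps[OF x(1)] by blast
    have "m \<noteq> 0" using m x by (cases m) auto
    then have "coprime (int p) (int m)" using m p
      by (metis coprime_int_iff prime_imp_coprime nat_dvd_not_less not_gr_zero)
    then obtain u v where "u * int p + v * int m = 1" using bezout_int[of "int p" "int m"] by auto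
    then have "of_int (u * int p + v * int m) = (1::complex)" by simp
    then have uv: "of_int u * of_nat p + of_int v * of_nat m = (1::complex)" by simp
    have "1 - x * of_int v = of_int u * of_nat p - of_int v * (x - of_nat m)"
      unfolding uv[symmetric] by (simp add: algebra_simps)
    moreover have "of_int u * of_nat p - of_int v * (x - of_nat m) \<in> B"
      by (rule ideal_D(7)[OF B(1) ideal_D(4)[OF B(1) B(3) OK_closed(7)] ideal_D(4)[OF B(1) m(2) OK_closed(7)]])
    ultimately show "\<exists>y\<in>OK. 1 - x * y \<in> B" using OK_closed(7)[of v] by (intro bexI[of _ "of_int v"]) auto
  qed
  then show ?thesis using B(3) Bp unfolding primes_over_def by blast
qed

end

section \<open>The density of the completely split primes\<close>

text \<open>Cauchy-Schwarz: the fibre sizes n_t add up to the size of S, and the number of congruent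
  pairs is the sum of the n_t^2.\<close>

lemma pigeonhole_pairs:
  assumes "finite S" "card (f ` S) \<le> p"
  shows "real (card S) ^ 2 \<le> real p * real (card {(x, y). x \<in> S \<and> y \<in> S \<and> f x = f y})"
proof -
  define n where "n t = real (card {x \<in> S. f x = t})" for t
  let ?T = "f ` S"
  have fin: "finite ?T" using assms by simp
  have "(\<Sum>t\<in>?T. n t) = real (card S)"
  proof -
    have "card S = (\<Sum>t\<in>?T. card {x \<in> S. f x = t})"
      using card_eq_sum sum.image_gen[OF assms(1), of "\<lambda>_. 1" f] by (metis (no_types, lifting) sum.cong)
    then show ?thesis by (simp add: n_def)
  qed
  have "{(x, y). x \<in> S \<and> y \<in> S \<and> f x = f y} = (\<Union>t\<in>?T. {x \<in> S. f x = t} \<times> {x \<in> S. f x = t})" by auto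
  then have "card {(x, y). x \<in> S \<and> y \<in> S \<and> f x = f y} = (\<Sum>t\<in>?T. card ({x \<in> S. f x = t} \<times> {x \<in> S. f x = t}))"
    using assms(1) by (simp only:) (rule card_UN_disjoint, auto)
  then have pairs: "real (card {(x, y). x \<in> S \<and> y \<in> S \<and> f x = f y}) = (\<Sum>t\<in>?T. (n t)\<^sup>2)"
    by (simp add: n_def card_cartesian_product power2_eq_square)
  have "real (card S) ^ 2 = (\<Sum>s\<in>?T. \<Sum>t\<in>?T. n s * n t)"
    unfolding \<open>(\<Sum>t\<in>?T. n t) = real (card S)\<close>[symmetric] by (simp add: power2_eq_square sum_product)
  also have "\<dots> \<le> (\<Sum>s\<in>?T. \<Sum>t\<in>?T. ((n s)\<^sup>2 + (n t)\<^sup>2) / 2)"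
  proof (intro sum_mono)
    fix s t
    have "(n s - n t)\<^sup>2 \<ge> 0" by simp
    then show "n s * n t \<le> ((n s)\<^sup>2 + (n t)\<^sup>2) / 2" by (simp add: power2_diff)
  qed
  also have "\<dots> = real (card ?T) * (\<Sum>t\<in>?T. (n t)\<^sup>2)"
  proof -
    have "(\<Sum>s\<in>?T. \<Sum>t\<in>?T. (n s)\<^sup>2 / 2) = real (card ?T) * (\<Sum>t\<in>?T. (n t)\<^sup>2) / 2"
      by (simp add: sum_distrib_left sum_divide_distrib)
    moreover have "(\<Sum>s\<in>?T. \<Sum>t\<in>?T. (n t)\<^sup>2 / 2) = real (card ?T) * (\<Sum>t\<in>?T. (n t)\<^sup>2) / 2"
      by (simp add: sum_divide_distrib[symmetric])
    ultimately show ?thesis unfolding add_divide_distrib sum.distrib by linarith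
  qed
  also have "\<dots> \<le> real p * (\<Sum>t\<in>?T. (n t)\<^sup>2)"
    using assms(2) by (intro mult_right_mono sum_nonneg) auto
  finally show ?thesis unfolding pairs .
qed

context normal_number_field
begin

text \<open>Choose t outside P but in all other primes over p. Then t y is in p O_K for each y in P,
  so t^k times the norm lies in p^k O_K, where k counts the conjugates of x in P. As t is not in P,
  the k factors p can be extracted from the integer m one at a time.\<close>

lemma norm_divisible:
  assumes p: "prime p" "\<not> int p dvd discriminant K" and P: "P \<in> primes_over p"
    and x: "x \<in> OK" and m: "norm_el x = of_int m"
  shows "int p ^ card {\<sigma>\<in>G. \<sigma> x \<in> P} dvd m"
proof -
  have mP: "maximal P" using P by (simp add: primes_over_def)
  note I = maximal_ideal[OF mP]
  define S where "S = {\<sigma>\<in>G. \<sigma> x \<in> P}"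
  have S: "S \<subseteq> G" "finite S" using finite_G by (auto simp: S_def)
  have p0: "p > 0" using p prime_gt_0_nat by blast
  have ov: "maximal Q" if "Q \<in> primes_over p" for Q using that by (simp add: primes_over_def)
  have "\<exists>a\<in>Q. 1 - a \<in> P" if "Q \<in> primes_over p - {P}" for Q
    using maximal_comaximal[OF ov mP] that by auto
  then obtain f where f: "\<And>Q. Q \<in> primes_over p - {P} \<Longrightarrow> f Q \<in> Q" "\<And>Q. Q \<in> primes_over p - {P} \<Longrightarrow> 1 - f Q \<in> P" by metis
  have fO: "f Q \<in> OK" if "Q \<in> primes_over p - {P}" for Q
    using f(1)[OF that] ideal_D(1)[OF maximal_ideal[OF ov]] that by blast
  have fP: "f Q \<notin> P" if "Q \<in> primes_over p - {P}" for Q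
    using ideal_D(3)[OF I f(2)[OF that], of "f Q"] maximal_1[OF mP] by auto
  define t where "t = prod f (primes_over p - {P})"
  have tO: "t \<in> OK" unfolding t_def using fO by (rule OK_prod)
  have tP: "t \<notin> P" unfolding t_def using fO fP by (rule maximal_prod[OF mP])
  have tQ: "t \<in> Q" if "Q \<in> primes_over p - {P}" for Q
    unfolding t_def using that finite_primes_over[OF p0] f fO maximal_ideal[OF ov] by (intro ideal_prod_mem[of Q _ Q]) auto
  have div: "\<exists>u\<in>OK. t * y = of_nat p * u" if y: "y \<in> P" for y
  proof -
    have yO: "y \<in> OK" using y ideal_D(1)[OF I] by auto
    have "t * y \<in> Q" if Q: "Q \<in> primes_over p" for Q
    proof (cases "Q = P")
      case True then show ?thesis using ideal_D(4)[OF I y tO] by simp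
    next
      case False then show ?thesis using ideal_D(5)[OF maximal_ideal[OF ov[OF Q]] _ yO] tQ[of Q] Q by simp
    qed
    then have "t * y \<in> OK \<inter> \<Inter>(primes_over p)" using tO yO by (auto intro: OK_closed)
    then have "t * y \<in> principal_nat K p" unfolding primes_over_inter[OF p] .
    then show ?thesis by (auto simp: principal_nat_def)
  qed
  have "\<forall>\<sigma>. \<exists>u. \<sigma> \<in> S \<longrightarrow> u \<in> OK \<and> t * \<sigma> x = of_nat p * u" using div by (auto simp: S_def)
  then obtain u where u: "\<And>\<sigma>. \<sigma> \<in> S \<Longrightarrow> u \<sigma> \<in> OK" "\<And>\<sigma>. \<sigma> \<in> S \<Longrightarrow> t * \<sigma> x = of_nat p * u \<sigma>" by metis
  define v where "v = (\<Prod>\<sigma>\<in>S. u \<sigma>) * (\<Prod>\<sigma>\<in>G-S. \<sigma> x)"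
  have vO: "v \<in> OK" unfolding v_def using u x emb_OK by (intro OK_closed(4) OK_prod) auto
  have "t ^ card S * norm_el x = (\<Prod>\<sigma>\<in>S. t * \<sigma> x) * (\<Prod>\<sigma>\<in>G-S. \<sigma> x)"
    unfolding norm_el_def using prod.subset_diff[OF S(1) finite_G, of "\<lambda>\<sigma>. \<sigma> x"] S(2)
    by (simp add: prod.distrib mult_ac)
  also have "(\<Prod>\<sigma>\<in>S. t * \<sigma> x) = of_nat p ^ card S * (\<Prod>\<sigma>\<in>S. u \<sigma>)"
    using u(2) S(2) by (simp add: prod.distrib)
  finally have eq: "t ^ card S * of_int m = of_nat p ^ card S * v" by (simp add: m v_def mult.assoc)
  have tk: "t ^ k \<notin> P \<and> t ^ k \<in> OK" for k
    by (induction k) (use maximal_1[OF mP] OK_closed(2) maximal_prime[OF mP] tO tP OK_closed(4) in auto)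
  have "j \<le> card S \<Longrightarrow> int p ^ j dvd m" for j
  proof (induction j)
    case (Suc j)
    then obtain m' where m': "m = int p ^ j * m'" by (auto elim!: dvdE)
    have cs: "card S = j + Suc (card S - Suc j)" using Suc.prems by simp
    have "of_nat p ^ j * (t ^ card S * of_int m') = of_nat p ^ j * (of_nat p ^ Suc (card S - Suc j) * v)"
      using eq unfolding m' by (subst (asm) (2) cs) (simp add: power_add mult_ac)
    then have "t ^ card S * of_int m' = of_nat p * (of_nat p ^ (card S - Suc j) * v)"
      using p0 by (simp add: mult_ac)
    moreover have "of_nat p ^ k \<in> OK" for k using OK_closed(8)[of "p ^ k"] by simp
    moreover have "of_nat p \<in> P" using P by (simp add: primes_over_def)
    ultimately have "t ^ card S * of_int m' \<in> P" using vO by (auto intro!: ideal_D(5)[OF I] OK_closed(4))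
    then have "of_int m' \<in> P" using maximal_prime[OF mP _ OK_closed(7)] tk by blast
    then have "int p dvd m'" using primes_over_int[OF p(1) P] by simp
    then show ?case unfolding m' by (simp add: mult.commute)
  qed simp
  then show ?thesis unfolding S_def by blast
qed

text \<open>Since the primes over p are conjugate, one of norm p forces all to have norm p; these
  are the completely split primes prime to the discriminant.\<close>

definition split_primes :: "nat set" where
  "split_primes = {p. prime p \<and> \<not> int p dvd discriminant K \<and> (\<exists>P\<in>primes_over p. ideal_norm K P = p)}"

definition Box :: "nat \<Rightarrow> complex set" where
  "Box B = (\<lambda>c. elt (\<lambda>i. int (c i))) ` PiE {..<dimK} (\<lambda>_. {..<B})"

lemma Box_OK: "Box B \<subseteq> OK" unfolding Box_def using elt_OK by auto

lemma card_Box: "finite (Box B)" "card (Box B) = B ^ dimK"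
proof -
  show "finite (Box B)" unfolding Box_def by (intro finite_imageI finite_PiE) auto
  have "inj_on (\<lambda>c. elt (\<lambda>i. int (c i))) (PiE {..<dimK} (\<lambda>_. {..<B}))"
  proof (rule inj_onI)
    fix c d assume cd: "c \<in> PiE {..<dimK} (\<lambda>_. {..<B})" "d \<in> PiE {..<dimK} (\<lambda>_. {..<B})"
      "elt (\<lambda>i. int (c i)) = elt (\<lambda>i. int (d i))"
    show "c = d" by (rule PiE_ext[OF cd(1,2)]) (use elt_inj[OF cd(3)] in auto)
  qed
  then show "card (Box B) = B ^ dimK" unfolding Box_def by (simp add: card_image card_PiE)
qed

text \<open>The summand 1 keeps the bound at least 1 and its logarithm nonnegative.\<close>

definition emb_bound :: real where "emb_bound = 1 + (\<Sum>\<sigma>\<in>G. \<Sum>i<dimK. norm (\<sigma> (int_basis ! i)))"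

lemma emb_bound_ge_1: "emb_bound \<ge> 1"
  unfolding emb_bound_def by (simp add: sum_nonneg)

lemma Box_diff_bound:
  assumes s: "\<sigma> \<in> G" and x: "x \<in> Box B" "y \<in> Box B"
  shows "norm (\<sigma> (x - y)) \<le> emb_bound * real B"
proof -
  obtain c d where cd: "c \<in> PiE {..<dimK} (\<lambda>_. {..<B})" "d \<in> PiE {..<dimK} (\<lambda>_. {..<B})"
    "x = elt (\<lambda>i. int (c i))" "y = elt (\<lambda>i. int (d i))" using x unfolding Box_def by blast
  have "x - y = (\<Sum>i<dimK. of_int (int (c i) - int (d i)) * int_basis ! i)"
    unfolding cd elt_diff[symmetric] by (simp add: elt_def)
  moreover have "of_int (int (c i) - int (d i)) * int_basis ! i \<in> K" if "i < dimK" for i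
    using that by (intro K_closed(4) subfield_C_of_int[OF K] OK_D(1) int_basis_OK)
  ultimately have "\<sigma> (x - y) = (\<Sum>i<dimK. \<sigma> (of_int (int (c i) - int (d i)) * int_basis ! i))"
    by (simp only: emb_sum[OF s]) (subst emb_sum[OF s], auto)
  also have "\<dots> = (\<Sum>i<dimK. of_int (int (c i) - int (d i)) * \<sigma> (int_basis ! i))"
    by (intro sum.cong refl) (simp only: emb_mult[OF s subfield_C_of_int[OF K] OK_D(1)[OF int_basis_OK]] emb_of_int[OF s] lessThan_iff)
  finally have "norm (\<sigma> (x - y)) \<le> (\<Sum>i<dimK. norm (of_int (int (c i) - int (d i)) * \<sigma> (int_basis ! i)))"
    by (simp only: norm_sum)
  also have "\<dots> \<le> (\<Sum>i<dimK. real B * norm (\<sigma> (int_basis ! i)))"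
  proof (rule sum_mono)
    fix i assume "i \<in> {..<dimK}"
    then have "c i < B" "d i < B" using cd(1,2) by auto
    then have "\<bar>int (c i) - int (d i)\<bar> \<le> int B" by linarith
    then have "norm (of_int (int (c i) - int (d i)) :: complex) \<le> real B"
      by (simp only: norm_of_int)
    then show "norm (of_int (int (c i) - int (d i)) * \<sigma> (int_basis ! i)) \<le> real B * norm (\<sigma> (int_basis ! i))"
      unfolding norm_mult by (rule mult_right_mono) simp
  qed
  also have "\<dots> = (\<Sum>i<dimK. norm (\<sigma> (int_basis ! i))) * real B" by (simp add: sum_distrib_left mult.commute)
  also have "\<dots> \<le> emb_bound * real B"
  proof (rule mult_right_mono)
    have "(\<Sum>i<dimK. norm (\<sigma> (int_basis ! i))) \<le> (\<Sum>\<sigma>\<in>G. \<Sum>i<dimK. norm (\<sigma> (int_basis ! i)))"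
      using member_le_sum[OF s, of "\<lambda>\<sigma>. \<Sum>i<dimK. norm (\<sigma> (int_basis ! i))"] finite_G by (simp add: sum_nonneg)
    then show "(\<Sum>i<dimK. norm (\<sigma> (int_basis ! i))) \<le> emb_bound" by (simp add: emb_bound_def)
  qed simp
  finally show ?thesis .
qed

text \<open>Every pair of distinct points of a box contributes, through the norm of their difference, at
  least \<open>ln p\<close> for each automorphism under which they become congruent modulo a fixed prime of
  degree one over \<open>p\<close>. By the pigeonhole principle a proportion \<open>1 / p\<close> of all pairs is
  congruent, without any lattice point counting.\<close>

lemma split_primes_box_bound:
  assumes B: "B \<ge> 1" and dimK: "dimK > 0"
  shows "(\<Sum>p\<in>{p\<in>split_primes. p \<le> B ^ dimK}. ln (real p) / real p) \<le> ln (real B) + (ln emb_bound + ln 4)"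
proof -
  define X where "X = B ^ dimK"
  have X0: "real X > 0" using B by (simp add: X_def)
  define Q where "Q = {p\<in>split_primes. p \<le> X}"
  have finQ: "finite Q" unfolding Q_def by (rule finite_subset[of _ "{..X}"]) auto
  have Qp: "prime p" "\<not> int p dvd discriminant K" "p \<le> X" if "p \<in> Q" for p
    using that by (auto simp: Q_def split_primes_def)
  have "\<forall>p. \<exists>P. p \<in> Q \<longrightarrow> P \<in> primes_over p \<and> ideal_norm K P = p" by (auto simp: Q_def split_primes_def)
  then obtain P where P: "\<And>p. p \<in> Q \<Longrightarrow> P p \<in> primes_over p" "\<And>p. p \<in> Q \<Longrightarrow> ideal_norm K (P p) = p" by metis
  have IP: "is_ideal K (P p)" if "p \<in> Q" for p using P(1)[OF that] by (simp add: primes_over_def maximal_def)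
  \<comment> \<open>The diagonal is removed because the norm of 0 carries no size information. This
    costs X pairs for each prime and automorphism.\<close>
  define D where "D = {z \<in> Box B \<times> Box B. fst z \<noteq> snd z}"
  have finD: "finite D" unfolding D_def using card_Box(1) by simp
  have cardD: "real (card D) \<le> real X ^ 2"
  proof -
    have "card D \<le> card (Box B \<times> Box B)" unfolding D_def using card_Box(1) by (intro card_mono) auto
    also have "\<dots> = X ^ 2" by (simp add: card_cartesian_product card_Box(2) X_def power2_eq_square)
    finally show ?thesis by (metis of_nat_le_iff of_nat_power)
  qed
  have cG: "card G > 0" using finite_G idK_in_G by (auto simp: card_gt_0_iff)
  have lnp: "ln (real p) \<ge> 0" if "p \<in> Q" for p using prime_gt_1_real[OF Qp(1)[OF that]] by simp
  define k where "k p z = card {\<sigma>\<in>G. \<sigma> (fst z - snd z) \<in> P p}" for p and z :: "complex \<times> complex"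
  have upper: "(\<Sum>p\<in>Q. real (k p z) * ln (real p)) \<le> real (card G) * ln (emb_bound * real B)" if z: "z \<in> D" for z
  proof -
    define x where "x = fst z - snd z"
    have b: "fst z \<in> Box B" "snd z \<in> Box B" "fst z \<noteq> snd z" using z by (auto simp: D_def)
    have xO: "x \<in> OK" unfolding x_def using b Box_OK by (intro OK_closed) auto
    have x0: "x \<noteq> 0" using b by (simp add: x_def)
    obtain m where m: "norm_el x = of_int m" using norm_int[OF xO] by blast
    have "norm_el x \<noteq> 0" unfolding norm_el_def using finite_G emb_nonzero x0 OK_D(1)[OF xO] by (simp add: prod_zero_iff)
    then have m0: "m \<noteq> 0" using m by auto
    have "(\<Prod>p\<in>Q. p ^ k p z) dvd nat \<bar>m\<bar>"
    proof (rule prod_primes_dvd[OF finQ Qp(1)])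
      fix p assume p: "p \<in> Q"
      have "int p ^ k p z dvd m" unfolding k_def x_def[symmetric]
        by (rule norm_divisible[OF Qp(1)[OF p] Qp(2)[OF p] P(1)[OF p] xO m])
      then have "int (p ^ k p z) dvd \<bar>m\<bar>" by simp
      then show "p ^ k p z dvd nat \<bar>m\<bar>" by (metis abs_ge_zero int_dvd_int_iff nat_0_le)
    qed
    then have "(\<Prod>p\<in>Q. p ^ k p z) \<le> nat \<bar>m\<bar>" using m0 by (intro dvd_imp_le) auto
    then have "real (\<Prod>p\<in>Q. p ^ k p z) \<le> real (nat \<bar>m\<bar>)" by (simp only: of_nat_le_iff)
    then have "(\<Prod>p\<in>Q. real p ^ k p z) \<le> real (nat \<bar>m\<bar>)" by simp
    also have "real (nat \<bar>m\<bar>) = norm (norm_el x)" by (simp add: m)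
    also have "\<dots> = (\<Prod>\<sigma>\<in>G. norm (\<sigma> x))" by (simp add: norm_el_def prod_norm)
    also have "\<dots> \<le> (\<Prod>\<sigma>\<in>G. emb_bound * real B)"
      unfolding x_def using b by (intro prod_mono) (auto intro: Box_diff_bound)
    also have "\<dots> = (emb_bound * real B) ^ card G" by simp
    finally have le: "(\<Prod>p\<in>Q. real p ^ k p z) \<le> (emb_bound * real B) ^ card G" .
    have pos: "(\<Prod>p\<in>Q. real p ^ k p z) > 0" using Qp(1) by (intro prod_pos) (auto simp: prime_gt_0_nat)
    have "(\<Sum>p\<in>Q. real (k p z) * ln (real p)) = ln (\<Prod>p\<in>Q. real p ^ k p z)"
      using Qp(1) finQ by (subst ln_prod) (auto simp: prime_gt_0_nat ln_realpow)
    also have "\<dots> \<le> ln ((emb_bound * real B) ^ card G)" using le pos by (simp add: ln_mono)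
    also have "\<dots> = real (card G) * ln (emb_bound * real B)"
      by (rule ln_realpow)
    finally show ?thesis .
  qed
  have lower: "real (card G) * (real X ^ 2 / real p - real X) \<le> (\<Sum>z\<in>D. real (k p z))" if p: "p \<in> Q" for p
  proof -
    have pp: "real p > 0" using Qp(1)[OF p] by (simp add: prime_gt_0_nat)
    have one: "real X ^ 2 / real p - real X \<le> real (card {z\<in>D. \<sigma> (fst z - snd z) \<in> P p})" if s: "\<sigma> \<in> G" for \<sigma>
    proof -
      let ?f = "\<lambda>x. cls (P p) (\<sigma> x)"
      let ?E = "{(x, y). x \<in> Box B \<and> y \<in> Box B \<and> ?f x = ?f y}"
      have "card (?f ` Box B) \<le> card (cls (P p) ` OK)"
      proof (rule card_mono)
        have "card (cls (P p) ` OK) > 0" using P(2)[OF p] Qp(1)[OF p] by (simp add: ideal_norm_cls prime_gt_0_nat)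
        then show "finite (cls (P p) ` OK)" by (rule card_ge_0_finite)
        show "?f ` Box B \<subseteq> cls (P p) ` OK" using Box_OK emb_OK[OF s] by auto
      qed
      then have "card (?f ` Box B) \<le> p" using P(2)[OF p] by (simp add: ideal_norm_cls)
      from pigeonhole_pairs[OF card_Box(1) this]
      have 1: "real X ^ 2 \<le> real p * real (card ?E)" by (simp add: card_Box(2) X_def)
      have "?E \<subseteq> {z\<in>D. \<sigma> (fst z - snd z) \<in> P p} \<union> (\<lambda>x. (x, x)) ` Box B"
      proof (rule subsetI, safe)
        fix x y assume xy: "x \<in> Box B" "y \<in> Box B" "?f x = ?f y" "(x, y) \<notin> (\<lambda>x. (x, x)) ` Box B"
        have O: "x \<in> OK" "y \<in> OK" using xy Box_OK by auto
        have "\<sigma> x - \<sigma> y \<in> P p" using xy(3) cls_eq_iff[OF IP[OF p] emb_OK[OF s O(1)] emb_OK[OF s O(2)]] by simp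
        then show "\<sigma> (fst (x, y) - snd (x, y)) \<in> P p" using O by (simp add: emb_diff[OF s] OK_D)
        show "(x, y) \<in> D" using xy by (auto simp: D_def)
      qed
      then have "card ?E \<le> card ({z\<in>D. \<sigma> (fst z - snd z) \<in> P p} \<union> (\<lambda>x. (x, x)) ` Box B)"
        using finD card_Box(1) by (intro card_mono) auto
      also have "\<dots> \<le> card {z\<in>D. \<sigma> (fst z - snd z) \<in> P p} + card ((\<lambda>x. (x, x)) ` Box B)" by (rule card_Un_le)
      also have "card ((\<lambda>x. (x, x)) ` Box B) \<le> X" using card_image_le[OF card_Box(1)] card_Box(2) X_def by metis
      finally have "real (card ?E) \<le> real (card {z\<in>D. \<sigma> (fst z - snd z) \<in> P p}) + real X" by linarith
      moreover have "real X ^ 2 / real p \<le> real (card ?E)" using 1 pp by (simp add: field_simps)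
      ultimately show ?thesis by linarith
    qed
    have "(\<Sum>z\<in>D. real (k p z)) = (\<Sum>z\<in>D. \<Sum>\<sigma>\<in>G. if \<sigma> (fst z - snd z) \<in> P p then 1 else 0)"
      unfolding k_def using finite_G by (simp add: sum.If_cases Int_def)
    also have "\<dots> = (\<Sum>\<sigma>\<in>G. \<Sum>z\<in>D. if \<sigma> (fst z - snd z) \<in> P p then 1 else 0)" by (rule sum.swap)
    also have "\<dots> = (\<Sum>\<sigma>\<in>G. real (card {z\<in>D. \<sigma> (fst z - snd z) \<in> P p}))"
      using finD by (simp add: sum.If_cases Int_def)
    also have "\<dots> \<ge> (\<Sum>\<sigma>\<in>G. real X ^ 2 / real p - real X)" by (rule sum_mono[OF one])
    finally show ?thesis by simp
  qed
  have "real (card G) * (\<Sum>p\<in>Q. ln (real p) * (real X ^ 2 / real p - real X))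
      = (\<Sum>p\<in>Q. ln (real p) * (real (card G) * (real X ^ 2 / real p - real X)))"
    by (simp add: sum_distrib_left mult_ac)
  also have "\<dots> \<le> (\<Sum>p\<in>Q. ln (real p) * (\<Sum>z\<in>D. real (k p z)))"
    by (intro sum_mono mult_left_mono lower lnp)
  also have "\<dots> = (\<Sum>z\<in>D. \<Sum>p\<in>Q. real (k p z) * ln (real p))"
    by (subst sum.swap) (simp add: sum_distrib_left mult.commute)
  also have "\<dots> \<le> (\<Sum>z\<in>D. real (card G) * ln (emb_bound * real B))" by (rule sum_mono[OF upper])
  also have "\<dots> = real (card D) * (real (card G) * ln (emb_bound * real B))" by simp
  also have "\<dots> \<le> real X ^ 2 * (real (card G) * ln (emb_bound * real B))"
  proof (rule mult_right_mono[OF cardD])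
    have "emb_bound * real B \<ge> 1 * 1" using emb_bound_ge_1 B by (intro mult_mono) auto
    then show "0 \<le> real (card G) * ln (emb_bound * real B)" by simp
  qed
  finally have "real (card G) * (\<Sum>p\<in>Q. ln (real p) * (real X ^ 2 / real p - real X))
      \<le> real (card G) * (real X ^ 2 * ln (emb_bound * real B))" by (simp add: mult_ac)
  \<comment> \<open>Each prime was counted once per automorphism and the norm has one factor per
    automorphism, so \<open>card G\<close> cancels.\<close>
  then have "(\<Sum>p\<in>Q. ln (real p) * (real X ^ 2 / real p - real X)) \<le> real X ^ 2 * ln (emb_bound * real B)"
    using cG by simp
  moreover have "(\<Sum>p\<in>Q. ln (real p) * (real X ^ 2 / real p - real X))
      = real X ^ 2 * (\<Sum>p\<in>Q. ln (real p) / real p) - real X * (\<Sum>p\<in>Q. ln (real p))"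
    by (simp add: sum_distrib_left algebra_simps sum_subtractf)
  \<comment> \<open>The cost of the diagonal: by Chebyshev's bound for p <= X it has the order X^2
    and contributes the constant ln 4 after division. This is why the range of p is tied to the
    number X of points.\<close>
  moreover have "real X * (\<Sum>p\<in>Q. ln (real p)) \<le> real X * (real X * ln 4)"
  proof (rule mult_left_mono)
    have "(\<Sum>p\<in>Q. ln (real p)) \<le> (\<Sum>p\<in>{p. prime p \<and> p \<le> X}. ln (real p))"
      by (rule sum_mono2) (auto simp: Qp dest: prime_gt_1_nat)
    also have "\<dots> \<le> real X * ln 4" by (rule sum_ln_primes_le)
    finally show "(\<Sum>p\<in>Q. ln (real p)) \<le> real X * ln 4" .
  qed simp
  ultimately have "real X ^ 2 * (\<Sum>p\<in>Q. ln (real p) / real p) \<le> real X ^ 2 * (ln (emb_bound * real B) + ln 4)"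
    by (simp add: algebra_simps power2_eq_square)
  then have "(\<Sum>p\<in>Q. ln (real p) / real p) \<le> ln (emb_bound * real B) + ln 4" using X0 by simp
  also have "ln (emb_bound * real B) = ln emb_bound + ln (real B)"
    using emb_bound_ge_1 B by (intro ln_mult_pos) auto
  finally show ?thesis unfolding Q_def X_def by simp
qed

text \<open>The box side is the N-th root of n rounded up, so that the box has at least n points;
  the rounding at most doubles the side and costs ln 2.\<close>

lemma split_primes_sum_ln_over:
  assumes n: "n \<ge> 2" and dimK: "dimK > 0"
  shows "(\<Sum>p\<in>{p\<in>split_primes. 2 \<le> p \<and> p \<le> n}. ln (real p) / real p)
     \<le> (1 / real dimK) * ln (real n) + (ln 2 + ln emb_bound + ln 4)"
proof -
  define y where "y = real n powr (1 / real dimK)"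
  have y1: "y \<ge> 1" unfolding y_def using n by (intro ge_one_powr_ge_zero) auto
  define B where "B = nat \<lceil>y\<rceil>"
  have B: "real B \<ge> y" "real B \<le> y + 1" "B \<ge> 1" using y1 unfolding B_def by linarith+
  have "real n = y ^ dimK" unfolding y_def using dimK n by (simp add: powr_power)
  also have "\<dots> \<le> real B ^ dimK" using B y1 by (intro power_mono) auto
  finally have "n \<le> B ^ dimK" by (simp flip: of_nat_power)
  then have "(\<Sum>p\<in>{p\<in>split_primes. 2 \<le> p \<and> p \<le> n}. ln (real p) / real p) \<le> (\<Sum>p\<in>{p\<in>split_primes. p \<le> B ^ dimK}. ln (real p) / real p)"
    by (intro sum_mono2) (auto intro: finite_subset[of _ "{..B ^ dimK}"] simp: split_primes_def dest: prime_gt_1_nat)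
  also have "\<dots> \<le> ln (real B) + (ln emb_bound + ln 4)" by (rule split_primes_box_bound[OF B(3) dimK])
  also have "ln (real B) \<le> ln (2 * y)" using B y1 by (intro ln_mono) auto
  also have "ln (2 * y) = ln 2 + (1 / real dimK) * ln (real n)"
    using y1 n by (subst ln_mult_pos) (auto simp: y_def ln_powr)
  finally show ?thesis by simp
qed

lemma split_primes_sum_inverse:
  assumes dimK: "dimK > 0"
  shows "\<exists>C. \<forall>n\<ge>2. (\<Sum>p\<in>{p\<in>split_primes. p \<le> n}. 1 / real p) \<le> (1 / real dimK) * ln (ln (real n)) + C"
proof -
  let ?C = "ln 2 + ln emb_bound + ln (4::real)"
  have C: "?C \<ge> 0" using emb_bound_ge_1 by simp
  have R: "{p\<in>split_primes. p \<le> n} = {p\<in>split_primes. 2 \<le> p \<and> p \<le> n}" for n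
    by (auto simp: split_primes_def dest: prime_ge_2_nat)
  show ?thesis unfolding R
    using sum_inverse_le_of_sum_ln_over_le[of "1 / real dimK" ?C split_primes, OF _ C split_primes_sum_ln_over[OF _ dimK]]
    by (intro exI[of _ "1 / real dimK - 1 / real dimK * ln (ln 2) + ?C / ln 2"]) auto
qed

end

section \<open>The excluded residues\<close>

text \<open>As a is invertible modulo p, the condition fixes one residue modulo p, which has p lifts
  modulo p^2.\<close>

lemma card_linear_residues:
  fixes p :: nat and a b :: int
  assumes p: "prime p" and a: "\<not> int p dvd a"
  shows "card {n::nat. n < p\<^sup>2 \<and> int p dvd a * int n + b} = p"
proof -
  have p0: "p > 0" using p prime_gt_0_nat by blast
  have "coprime a (int p)" using p a by (metis coprime_commute prime_imp_coprime prime_nat_int_transfer)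
  then obtain u where u: "[a * u = 1] (mod int p)" using cong_solve_coprime_int by blast
  define n0 where "n0 = nat ((- b * u) mod int p)"
  have n0: "int n0 = (- b * u) mod int p" "n0 < p" using p0 by (auto simp: n0_def nat_less_iff)
  have "[a * int n0 + b = a * (- b * u) + b] (mod int p)"
    unfolding n0 by (intro cong_add cong_mult cong_refl) (simp add: cong_def)
  moreover have "[a * (- b * u) + b = - b * 1 + b] (mod int p)"
  proof -
    have "a * (- b * u) + b = - b * (a * u) + b" by (simp add: algebra_simps)
    then show ?thesis using u by (simp only:) (intro cong_add cong_mult cong_refl)
  qed
  ultimately have "[a * int n0 + b = 0] (mod int p)" by (metis add.left_inverse cong_trans mult.right_neutral)
  then have root: "int p dvd a * int n0 + b" by (simp add: cong_0_iff)
  have iff: "int p dvd a * int n + b \<longleftrightarrow> n mod p = n0" for n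
  proof -
    have "int p dvd a * int n + b \<longleftrightarrow> int p dvd (a * int n + b) - (a * int n0 + b)"
      using dvd_add_left_iff[OF root, of "(a * int n + b) - (a * int n0 + b)"] by (simp only: diff_add_cancel)
    also have "(a * int n + b) - (a * int n0 + b) = a * (int n - int n0)" by (simp add: algebra_simps)
    also have "int p dvd a * (int n - int n0) \<longleftrightarrow> int p dvd int n - int n0"
      using p a by (simp add: prime_dvd_mult_iff)
    also have "\<dots> \<longleftrightarrow> int n mod int p = int n0 mod int p" by (simp add: mod_eq_dvd_iff)
    also have "\<dots> \<longleftrightarrow> n mod p = n0" using n0(2) by (simp flip: of_nat_mod)
    finally show ?thesis .
  qed
  have "{n::nat. n < p\<^sup>2 \<and> int p dvd a * int n + b} = (\<lambda>k. n0 + p * k) ` {..<p}"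
  proof (intro Set.set_eqI iffI)
    fix n assume "n \<in> {n::nat. n < p\<^sup>2 \<and> int p dvd a * int n + b}"
    then have n: "n < p * p" "n mod p = n0" by (auto simp: iff power2_eq_square)
    then have "n div p < p" by (simp add: less_mult_imp_div_less)
    moreover have "n = n0 + p * (n div p)" using n(2) mod_mult_div_eq[of n p] by simp
    ultimately show "n \<in> (\<lambda>k. n0 + p * k) ` {..<p}" by blast
  next
    fix n assume "n \<in> (\<lambda>k. n0 + p * k) ` {..<p}"
    then obtain k where k: "k < p" "n = n0 + p * k" by blast
    have "n < p + p * k" using k n0(2) by simp
    also have "\<dots> \<le> p * p" using k(1) by (metis Suc_leI mult_Suc_right mult_le_mono2)
    finally show "n \<in> {n::nat. n < p\<^sup>2 \<and> int p dvd a * int n + b}"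
      using k n0(2) by (auto simp: iff power2_eq_square)
  qed
  moreover have "inj_on (\<lambda>k. n0 + p * k) {..<p}" using p0 by (auto simp: inj_on_def)
  ultimately show ?thesis by (simp add: card_image)
qed

lemma card_linear_residues_square:
  fixes p :: nat and a b :: int
  assumes p: "prime p" and a: "\<not> int p dvd a"
  shows "card {n::nat. n < p\<^sup>2 \<and> int (p\<^sup>2) dvd a * int n + b} \<le> 1"
proof -
  let ?S = "{n::nat. n < p\<^sup>2 \<and> int (p\<^sup>2) dvd a * int n + b}"
  have fin: "finite ?S" by (rule finite_subset[of _ "{..<p\<^sup>2}"]) auto
  have "coprime (int p) a" using p a by (metis prime_imp_coprime prime_nat_int_transfer)
  then have cop: "coprime (int (p\<^sup>2)) a" by simp
  have "n = m" if "n \<in> ?S" "m \<in> ?S" for n m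
  proof -
    have "int (p\<^sup>2) dvd (a * int n + b) - (a * int m + b)" using that by (intro dvd_diff) auto
    then have "int (p\<^sup>2) dvd a * (int n - int m)" by (simp add: algebra_simps)
    then have "int (p\<^sup>2) dvd int n - int m" using cop coprime_dvd_mult_right_iff by blast
    then have "int n mod int (p\<^sup>2) = int m mod int (p\<^sup>2)" by (simp only: mod_eq_dvd_iff)
    then have "n mod p\<^sup>2 = m mod p\<^sup>2" by (metis of_nat_mod of_nat_eq_iff)
    then show ?thesis using that by simp
  qed
  then show ?thesis using card_le_Suc0_iff_eq[OF fin] by auto
qed

text \<open>Exact divisibility of some form by p, the event that a prime without prime ideals of
  norm p rules out for norms.\<close>

definition excluded :: "nat \<Rightarrow> (nat \<Rightarrow> int) \<Rightarrow> (nat \<Rightarrow> int) \<Rightarrow> nat \<Rightarrow> nat \<Rightarrow> bool" where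
  "excluded M a b p n \<longleftrightarrow> (\<exists>m\<in>{1..M}. int p dvd a m * int n + b m \<and> \<not> int (p\<^sup>2) dvd a m * int n + b m)"

lemma excluded_periodic: "excluded M a b p (n mod p\<^sup>2) = excluded M a b p n"
proof -
  have *: "d dvd a m * int (n mod p\<^sup>2) + b m \<longleftrightarrow> d dvd a m * int n + b m" if "d dvd int (p\<^sup>2)" for d m
  proof -
    have e: "int (n mod p\<^sup>2) = int n - int (p\<^sup>2) * int (n div p\<^sup>2)"
      by (metis minus_mult_div_eq_mod of_nat_mult zdiv_int zmod_int)
    have "(a m * int n + b m) - (a m * int (n mod p\<^sup>2) + b m) = int (p\<^sup>2) * (a m * int (n div p\<^sup>2))"
      unfolding e by (simp add: algebra_simps)
    then have "d dvd (a m * int n + b m) - (a m * int (n mod p\<^sup>2) + b m)" using that by (simp add: dvd_mult2)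
    then show ?thesis by (metis dvd_diff_commute dvd_add_right_iff diff_add_cancel)
  qed
  have "int p dvd int (p\<^sup>2)" by (simp add: power2_eq_square)
  then show ?thesis unfolding excluded_def using * by simp
qed

text \<open>Each form vanishes modulo p at p residues modulo p^2, and modulo p^2 at no more than one
  of them. Two forms cannot vanish together modulo p, since p would divide their determinant, so the
  contributions add up.\<close>

lemma card_excluded:
  fixes p :: nat
  assumes p: "prime p" and a: "\<And>m. m \<in> {1..M} \<Longrightarrow> \<not> int p dvd a m"
    and ab: "\<And>m k. m \<in> {1..M} \<Longrightarrow> k \<in> {1..M} \<Longrightarrow> m \<noteq> k \<Longrightarrow> \<not> int p dvd a m * b k - a k * b m"
  shows "real M * (real p - 1) \<le> real (card {n. n < p\<^sup>2 \<and> excluded M a b p n})"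
    and "real (card {n. n < p\<^sup>2 \<and> excluded M a b p n}) \<le> real M * real p"
proof -
  define E where "E m = {n::nat. n < p\<^sup>2 \<and> int p dvd a m * int n + b m \<and> \<not> int (p\<^sup>2) dvd a m * int n + b m}" for m
  have un: "{n. n < p\<^sup>2 \<and> excluded M a b p n} = (\<Union>m\<in>{1..M}. E m)" by (auto simp: E_def excluded_def)
  have fin: "finite (E m)" for m unfolding E_def by (rule finite_subset[of _ "{..<p\<^sup>2}"]) auto
  have disj: "E m \<inter> E k = {}" if mk: "m \<in> {1..M}" "k \<in> {1..M}" "m \<noteq> k" for m k
  proof (rule ccontr)
    assume "E m \<inter> E k \<noteq> {}"
    then obtain n where n: "int p dvd a m * int n + b m" "int p dvd a k * int n + b k" by (auto simp: E_def)
    then have "int p dvd a m * (a k * int n + b k) - a k * (a m * int n + b m)" by (intro dvd_diff dvd_mult)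
    then have "int p dvd a m * b k - a k * b m" by (simp add: algebra_simps)
    then show False using ab[OF mk] by blast
  qed
  have card: "card {n. n < p\<^sup>2 \<and> excluded M a b p n} = (\<Sum>m\<in>{1..M}. card (E m))"
    unfolding un by (rule card_UN_disjoint) (use fin disj in auto)
  have le: "card (E m) \<le> p" "p \<le> card (E m) + 1" if m: "m \<in> {1..M}" for m
  proof -
    let ?A = "{n::nat. n < p\<^sup>2 \<and> int p dvd a m * int n + b m}"
    let ?B = "{n::nat. n < p\<^sup>2 \<and> int (p\<^sup>2) dvd a m * int n + b m}"
    have A: "card ?A = p" by (rule card_linear_residues[OF p a[OF m]])
    have finA: "finite ?A" "finite ?B" by (rule finite_subset[of _ "{..<p\<^sup>2}"]; auto)+
    have "E m \<subseteq> ?A" by (auto simp: E_def)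
    then show "card (E m) \<le> p" using A card_mono[OF finA(1)] by metis
    have "card ?A \<le> card (E m \<union> ?B)" by (rule card_mono) (use fin finA in \<open>auto simp: E_def\<close>)
    also have "\<dots> \<le> card (E m) + card ?B" by (rule card_Un_le)
    also have "card ?B \<le> 1" by (rule card_linear_residues_square[OF p a[OF m]])
    finally show "p \<le> card (E m) + 1" using A by simp
  qed
  have "(\<Sum>m\<in>{1..M}. card (E m)) \<le> (\<Sum>m\<in>{1..M}. p)" by (rule sum_mono) (use le in auto)
  then have "card {n. n < p\<^sup>2 \<and> excluded M a b p n} \<le> M * p" using card by simp
  then show "real (card {n. n < p\<^sup>2 \<and> excluded M a b p n}) \<le> real M * real p"
    by (metis of_nat_le_iff of_nat_mult)
  have "(\<Sum>m\<in>{1..M}. real p - 1) \<le> (\<Sum>m\<in>{1..M}. real (card (E m)))"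
  proof (rule sum_mono)
    fix m assume "m \<in> {1..M}"
    then show "real p - 1 \<le> real (card (E m))" using le(2)[of m] by linarith
  qed
  then show "real M * (real p - 1) \<le> real (card {n. n < p\<^sup>2 \<and> excluded M a b p n})" using card by simp
qed

lemma sum_Un_le:
  fixes f :: "'a \<Rightarrow> real"
  assumes "finite A" "finite B" "\<And>x. x \<in> B \<Longrightarrow> f x \<ge> 0"
  shows "sum f (A \<union> B) \<le> sum f A + sum f B"
proof -
  have "sum f (A \<inter> B) \<ge> 0" using assms(3) by (intro sum_nonneg) auto
  then show ?thesis using sum.union_inter[OF assms(1,2), of f] by linarith
qed

lemma sum_inverse_squares_subset_le:
  assumes "finite (A :: nat set)" "0 \<notin> A"
  shows "(\<Sum>p\<in>A. 1 / real p ^ 2) \<le> 2"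
proof -
  obtain n where n: "A \<subseteq> {..n}" using finite_nat_iff_bounded_le[of A] assms(1) by blast
  then have "A \<subseteq> {1..n}" using assms(2) by (auto simp: Suc_le_eq intro: gr0I)
  then have "(\<Sum>p\<in>A. 1 / real p ^ 2) \<le> (\<Sum>p=1..n. 1 / real p ^ 2)" by (intro sum_mono2) auto
  also have "\<dots> \<le> 2 - 1 / real n" by (rule sum_inverse_squares_le)
  also have "\<dots> \<le> 2" by simp
  finally show ?thesis .
qed

text \<open>Turns the loss from the omitted primes into the shape of gamma. With t = M / p in [0, 1]
  one has t - t^2 <= ln (1 + t), and the quadratic terms sum to at most 2 M^2.\<close>

lemma exp_sum_inverse_le_prod:
  assumes "finite (A :: nat set)" "\<And>p. p \<in> A \<Longrightarrow> p \<ge> 2 * M" "M > 0"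
  shows "exp (real M * (\<Sum>p\<in>A. 1 / real p)) \<le> exp (2 * real M ^ 2) * (\<Prod>p\<in>A. 1 + real M / real p)"
proof -
  have pos: "real p > 0" if "p \<in> A" for p using assms(2)[OF that] assms(3) by simp
  have factor: "exp (real M / real p) \<le> exp (real M ^ 2 * (1 / real p ^ 2)) * (1 + real M / real p)" if p: "p \<in> A" for p
  proof -
    let ?t = "real M / real p"
    have t: "0 \<le> ?t" "?t \<le> 1" using assms(2)[OF p] pos[OF p] by (auto simp: field_simps)
    have "?t - ?t\<^sup>2 \<le> ln (1 + ?t)" using t by (rule ln_one_plus_pos_lower_bound)
    then have "exp ?t \<le> exp (?t\<^sup>2 + ln (1 + ?t))" by simp
    also have "\<dots> = exp (?t\<^sup>2) * (1 + ?t)"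
    proof -
      have "1 + ?t > 0" using t(1) by linarith
      then show ?thesis by (simp only: exp_add exp_ln)
    qed
    finally show ?thesis by (simp add: power_divide)
  qed
  have "exp (real M * (\<Sum>p\<in>A. 1 / real p)) = (\<Prod>p\<in>A. exp (real M / real p))"
    using assms(1) by (simp add: exp_sum[symmetric] sum_distrib_left)
  also have "\<dots> \<le> (\<Prod>p\<in>A. exp (real M ^ 2 * (1 / real p ^ 2)) * (1 + real M / real p))"
    by (rule prod_mono) (use factor in auto)
  also have "\<dots> = exp (real M ^ 2 * (\<Sum>p\<in>A. 1 / real p ^ 2)) * (\<Prod>p\<in>A. 1 + real M / real p)"
    using assms(1) by (simp add: prod.distrib exp_sum[symmetric] sum_distrib_left)
  also have "\<dots> \<le> exp (2 * real M ^ 2) * (\<Prod>p\<in>A. 1 + real M / real p)"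
  proof (rule mult_right_mono)
    have "0 \<notin> A" using pos by fastforce
    then have "real M ^ 2 * (\<Sum>p\<in>A. 1 / real p ^ 2) \<le> real M ^ 2 * 2"
      using assms(1) by (intro mult_left_mono sum_inverse_squares_subset_le) auto
    then show "exp (real M ^ 2 * (\<Sum>p\<in>A. 1 / real p ^ 2)) \<le> exp (2 * real M ^ 2)" by simp
  qed (auto intro!: prod_nonneg add_nonneg_nonneg)
  finally show ?thesis .
qed

context normal_number_field
begin

section \<open>The sieving primes and the final estimate\<close>

definition nonsplit_primes :: "nat set" where
  "nonsplit_primes = {p. prime p \<and> \<not> int p dvd discriminant K \<and> p \<notin> split_primes}"

text \<open>Needed so that every omitted sieving prime dividing the determinants or the leading
  coefficients is one of the primes in the product gamma.\<close>

lemma nonsplit_primes_subset: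
  assumes "p \<in> nonsplit_primes" "dimK > 0"
  shows "\<exists>r. r dvd field_degree K \<and> r > 1 \<and> p \<in> primes_split K r"
proof -
  have p: "prime p" "\<not> int p dvd discriminant K" "p \<notin> split_primes" using assms(1) by (auto simp: nonsplit_primes_def)
  obtain r where r: "r dvd dimK" "r > 0" "p \<in> primes_split K r" "\<forall>P\<in>primes_over p. ideal_norm K P = p ^ r"
    using splitting_of_unramified_prime[OF p(1,2) assms(2)] by blast
  have "r \<noteq> 1" using r(4) p primes_over_nonempty[OF p(1)] by (auto simp: split_primes_def)
  then show ?thesis using r by (auto simp: field_degree_eq)
qed

lemma nonsplit_dvd_square:
  assumes "p \<in> nonsplit_primes" "bK K n \<noteq> 0" "int p dvd n"
  shows "int (p\<^sup>2) dvd n"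
proof -
  have p: "prime p" "\<not> int p dvd discriminant K" "p \<notin> split_primes" using assms(1) by (auto simp: nonsplit_primes_def)
  obtain A where A: "is_ideal K A" "int (ideal_norm K A) = n" "n > 0"
    using assms(2) unfolding bK_def by (auto split: if_splits)
  have dv: "p dvd ideal_norm K A" using assms(3) A(2) by (metis int_dvd_int_iff)
  have "p\<^sup>2 dvd ideal_norm K A"
  proof (rule ccontr)
    assume "\<not> p\<^sup>2 dvd ideal_norm K A"
    then have "\<exists>P\<in>primes_over p. ideal_norm K P = p"
      using A by (intro ideal_norm_exact_prime_divisor[OF p(1) A(1) _ dv]) auto
    then show False using p by (auto simp: split_primes_def)
  qed
  then show ?thesis using A(2) by (metis int_dvd_int_iff)
qed

lemma sieve_bound:
  fixes M :: nat
  assumes dimK: "dimK \<ge> 2" and M: "M \<ge> 2"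
  shows "\<exists>C > 0. \<exists>x0. \<forall>a b :: nat \<Rightarrow> int.
           (\<forall>m\<in>{1..M}. a m > 0) \<longrightarrow> cross_prod M a b \<noteq> 0 \<longrightarrow>
           (\<forall>x::real. x \<ge> x0 \<longrightarrow>
              S_sum K M a b x \<le> C * gamma_fac K M a b * x
                 / ln x powr (real M * (1 - 1 / real (field_degree K))))"
proof -
  have dimK0: "dimK > 0" using dimK by simp
  obtain C1 where C1: "\<And>n. n \<ge> 2 \<Longrightarrow> (\<Sum>p\<in>{p\<in>split_primes. p \<le> n}. 1 / real p) \<le> (1 / real dimK) * ln (ln (real n)) + C1"
    using split_primes_sum_inverse[OF dimK0] by blast
  \<comment> \<open>Primes up to 2 M are dropped to guarantee g <= 1/2. The set depends on K and M
    only, so its reciprocal sum goes into the constant.\<close>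
  define Bad where "Bad = {p::nat. prime p \<and> (p \<le> 2 * M \<or> int p dvd discriminant K)}"
  have finBad: "finite Bad"
  proof (rule finite_subset)
    show "Bad \<subseteq> {..2 * M} \<union> {..nat \<bar>discriminant K\<bar>}"
    proof
      fix p assume "p \<in> Bad"
      then consider "p \<le> 2 * M" | "int p dvd discriminant K" by (auto simp: Bad_def)
      then show "p \<in> {..2 * M} \<union> {..nat \<bar>discriminant K\<bar>}"
      proof cases
        case 2
        then have "\<bar>int p\<bar> \<le> \<bar>discriminant K\<bar>" using discriminant_nonzero by (rule dvd_imp_le_int[rotated])
        then show ?thesis by auto
      qed auto
    qed
  qed simp
  define Cb where "Cb = (\<Sum>p\<in>Bad. 1 / real p)"
  define \<kappa> where "\<kappa> = real M * (1 - 1 / real dimK)"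
  have \<kappa>0: "\<kappa> \<ge> 0" using dimK by (simp add: \<kappa>_def)
  \<comment> \<open>This is 9 B + 1 from the truncation lemma with B = 2 M, the bound h <= 2 M /
    p.\<close>
  define s where "s = 18 * real M + 1"
  have s: "s > 0" using M by (simp add: s_def)
  \<comment> \<open>Here 2 M pays for the terms M / p^2 in the densities, and the rest for the
    constants in the lower bound of the reciprocal sum over the sieving primes.\<close>
  define A0 where "A0 = 2 * real M + real M * (ln 2 + C1 + Cb)"
  \<comment> \<open>The 8 is 4 from the sieve inequality times 2 from the truncation; exp (2 M^2)
    comes from passing to gamma, and 24 s from comparing ln z with ln x.\<close>
  define C where "C = 8 * exp (A0 + 2 * real M ^ 2) * (24 * s) powr \<kappa>"
  have Cpos: "C > 0" using s by (simp add: C_def)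
  show ?thesis
  proof (rule exI[of _ C], rule conjI[OF Cpos], rule exI[of _ "4 powr (12 * s)"], intro allI impI)
    fix a b :: "nat \<Rightarrow> int" and x :: real
    assume apos: "\<forall>m\<in>{1..M}. a m > 0" and cross: "cross_prod M a b \<noteq> 0" and x: "4 powr (12 * s) \<le> x"
    define W where "W = (\<Prod>m\<in>{1..M}. a m) * cross_prod M a b"
    have W0: "W \<noteq> 0" using apos cross by (auto simp: W_def)
    have "(4::real) powr 0 \<le> 4 powr (12 * s)" using s by (intro powr_mono) auto
    then have x1: "x \<ge> 1" using x by simp
    \<comment> \<open>The threshold on x says precisely that y >= 4, and it involves neither the
      coefficients nor K.\<close>
    define y where "y = x powr (1 / (12 * s))"
    have y4: "y \<ge> 4"
    proof -
      have "(4 powr (12 * s)) powr (1 / (12 * s)) \<le> y" unfolding y_def using x s by (intro powr_mono2) auto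
      then show ?thesis using s by (simp add: powr_powr)
    qed
    define z where "z = nat \<lfloor>y\<rfloor>"
    have z: "real z \<le> y" "real z \<ge> y - 1" using y4 unfolding z_def by linarith+
    have z2: "z \<ge> 2" using z y4 by linarith
    have lny: "ln y = ln x / (12 * s)" unfolding y_def using x1 by (simp add: ln_powr)
    have lnz_le: "ln (real z) \<le> ln y" using z z2 by (intro ln_mono) auto
    \<comment> \<open>For y >= 4 the floor z satisfies y <= (y - 1)^2 <= z^2, so rounding at most
      halves the logarithm and 12 s becomes 24 s.\<close>
    have lnz_ge: "ln (real z) \<ge> ln x / (24 * s)"
    proof -
      have "y * 4 \<le> y * y" using y4 by (intro mult_left_mono) auto
      moreover have "(y - 1)\<^sup>2 = y * y - 2 * y + 1" by (simp add: power2_eq_square algebra_simps)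
      ultimately have "y \<le> (y - 1)\<^sup>2" using y4 by linarith
      also have "\<dots> \<le> (real z)\<^sup>2" using z y4 by (intro power_mono) auto
      finally have "ln y \<le> ln ((real z)\<^sup>2)" using y4 by (intro ln_mono) auto
      also have "\<dots> = 2 * ln (real z)" using z2 by (simp add: ln_realpow)
      finally show ?thesis unfolding lny using s by (simp add: field_simps)
    qed
    have lnz0: "ln (real z) > 0" using z2 by simp
    have lnx0: "ln x > 0"
    proof -
      have "ln y > 0" using y4 by simp
      then show ?thesis unfolding lny using s by (simp add: zero_less_divide_iff)
    qed
    \<comment> \<open>The exponent 1 / 12 makes ln D = s ln y, enough for the truncation, and the
      sieve error 2 D^6 only a multiple of the square root of x.\<close>
    define D where "D = x powr (1 / 12)"
    have D1: "D \<ge> 1" unfolding D_def using x1 by (intro ge_one_powr_ge_zero) auto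
    have lnD: "ln D \<ge> s * ln (real z)"
    proof -
      have "s * ln (real z) \<le> s * ln y" using lnz_le s by (intro mult_left_mono) auto
      also have "\<dots> = ln D" unfolding lny D_def using s x1 by (simp add: ln_powr)
      finally show ?thesis .
    qed
    have D6: "D ^ 6 \<le> x"
    proof -
      have "D ^ 6 = x powr (1 / 2)" unfolding D_def using x1 by (simp add: powr_power)
      also have "\<dots> \<le> x powr 1" using x1 by (intro powr_mono) auto
      finally show ?thesis using x1 by simp
    qed
    \<comment> \<open>\<open>Qs\<close> is sieved by. In \<open>Ex\<close> are the primes modulo
      which a form may lose its leading coefficient or two forms may vanish together.\<close>
    define Qs where "Qs = {p \<in> nonsplit_primes. p \<le> z \<and> p > 2 * M \<and> \<not> int p dvd W}"
    define Ex where "Ex = {p \<in> nonsplit_primes. p \<le> z \<and> p > 2 * M \<and> int p dvd W}"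
    have fin: "finite Qs" "finite Ex" unfolding Qs_def Ex_def by (rule finite_subset[of _ "{..z}"]; auto)+
    have Qpr: "prime p" if "p \<in> Qs" for p using that by (auto simp: Qs_def nonsplit_primes_def)
    have pr0: "real p > 0" if "p \<in> Qs" for p using Qpr[OF that] by (simp add: prime_gt_0_nat)
    define e where "e = (\<Sum>p\<in>Ex. 1 / real p)"
    \<comment> \<open>All factors are at least 1, so the product only grows when \<open>Ex\<close>
      is enlarged to all exceptional primes, a finite set because W is nonzero.\<close>
    have gam: "(\<Prod>p\<in>Ex. 1 + real M / real p) \<le> gamma_fac K M a b"
      unfolding gamma_fac_def
    proof (rule prod_mono2)
      have "exc_primes K M a b \<subseteq> {..nat \<bar>W\<bar>}"
      proof
        fix p assume "p \<in> exc_primes K M a b"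
        then have "int p dvd W" by (simp add: exc_primes_def W_def)
        then have "\<bar>int p\<bar> \<le> \<bar>W\<bar>" using W0 by (rule dvd_imp_le_int[rotated])
        then show "p \<in> {..nat \<bar>W\<bar>}" by auto
      qed
      then show "finite (exc_primes K M a b)" by (rule finite_subset) simp
      show "Ex \<subseteq> exc_primes K M a b"
      proof
        fix p assume p: "p \<in> Ex"
        then have "p \<in> nonsplit_primes" by (simp add: Ex_def)
        then have "\<exists>r. r dvd field_degree K \<and> r > 1 \<and> p \<in> primes_split K r" by (rule nonsplit_primes_subset[OF _ dimK0])
        then show "p \<in> exc_primes K M a b" using p by (auto simp: exc_primes_def Ex_def W_def)
      qed
    qed (auto intro: add_nonneg_nonneg)
    have expe: "exp (real M * e) \<le> exp (2 * real M ^ 2) * gamma_fac K M a b"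
    proof -
      have "exp (real M * e) \<le> exp (2 * real M ^ 2) * (\<Prod>p\<in>Ex. 1 + real M / real p)"
        unfolding e_def by (rule exp_sum_inverse_le_prod) (use fin M in \<open>auto simp: Ex_def\<close>)
      also have "\<dots> \<le> exp (2 * real M ^ 2) * gamma_fac K M a b" using gam by (intro mult_left_mono) auto
      finally show ?thesis .
    qed
    define V where "V = (\<Sum>p\<in>Qs. 1 / real p)"
    \<comment> \<open>Every prime up to z is sieved by, split, bad or exceptional. The split ones
      cost ln ln z divided by N, the last two the sums \<open>Cb\<close> and e.\<close>
    have V: "V \<ge> (1 - 1 / real dimK) * ln (ln (real z)) - (ln 2 + C1 + Cb) - e"
    proof -
      let ?R = "{p\<in>split_primes. p \<le> z}"
      have finR: "finite ?R" by (rule finite_subset[of _ "{..z}"]) auto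
      have "ln (ln (real z)) - ln 2 \<le> (\<Sum>p\<in>{p::nat. prime p \<and> p \<le> z}. 1 / real p)"
        by (rule sum_inverse_primes_ge[OF z2])
      also have "\<dots> \<le> (\<Sum>p\<in>Qs \<union> (?R \<union> (Bad \<union> Ex)). 1 / real p)"
        using fin finR finBad by (intro sum_mono2) (auto simp: Qs_def Ex_def nonsplit_primes_def Bad_def)
      also have "\<dots> \<le> V + (\<Sum>p\<in>?R \<union> (Bad \<union> Ex). 1 / real p)"
        unfolding V_def using fin finR finBad by (intro sum_Un_le) auto
      also have "(\<Sum>p\<in>?R \<union> (Bad \<union> Ex). 1 / real p) \<le> (\<Sum>p\<in>?R. 1 / real p) + (\<Sum>p\<in>Bad \<union> Ex. 1 / real p)"
        using fin finR finBad by (intro sum_Un_le) auto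
      also have "(\<Sum>p\<in>?R. 1 / real p) \<le> (1 / real dimK) * ln (ln (real z)) + C1" by (rule C1[OF z2])
      also have "(\<Sum>p\<in>Bad \<union> Ex. 1 / real p) \<le> Cb + e"
        unfolding Cb_def e_def using fin finBad by (intro sum_Un_le) auto
      finally show ?thesis by (simp add: algebra_simps)
    qed
    define g where "g = (\<lambda>p. real (card {n. n < p\<^sup>2 \<and> excluded M a b p n}) / real (p\<^sup>2))"
    define h where "h = (\<lambda>p. g p / (1 - g p))"
    define J where "J = (\<Sum>T\<in>{T\<in>Pow Qs. real (\<Prod>T) \<le> D}. \<Prod>p\<in>T. h p)"
    have gb: "real M / real p - real M / real p ^ 2 \<le> g p" "g p \<le> real M / real p" "g p \<le> 1 / 2" "g p \<ge> 0"
      if p: "p \<in> Qs" for p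
    proof -
      have nd: "\<not> int p dvd W" and p2: "p > 2 * M" using p by (auto simp: Qs_def)
      have nda: "\<not> int p dvd a m" if "m \<in> {1..M}" for m
      proof
        assume "int p dvd a m"
        then have "int p dvd (\<Prod>m\<in>{1..M}. a m)" using that by (meson dvd_prodI dvd_trans finite_atLeastAtMost)
        then show False using nd by (simp add: W_def)
      qed
      have ndc: "\<not> int p dvd a m * b k - a k * b m" if mk: "m \<in> {1..M}" "k \<in> {1..M}" "m \<noteq> k" for m k
      proof
        assume d: "int p dvd a m * b k - a k * b m"
        have "a m * b k - a k * b m dvd (\<Prod>k\<in>{1..M} - {m}. a m * b k - a k * b m)"
          using mk by (intro dvd_prodI) auto
        also have "\<dots> dvd cross_prod M a b" unfolding cross_prod_def
          using dvd_prodI[of "{1..M}" m "\<lambda>m. \<Prod>k\<in>{1..M} - {m}. a m * b k - a k * b m"] mk by simp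
        finally show False using d nd dvd_trans by (metis W_def dvd_mult)
      qed
      note ce = card_excluded[of p M a b, OF Qpr[OF p] nda ndc]
      have pp: "real p > 0" by (rule pr0[OF p])
      have "real M * (real p - 1) / real (p\<^sup>2) \<le> g p" unfolding g_def using ce(1) by (intro divide_right_mono) auto
      moreover have "real M * (real p - 1) / real (p\<^sup>2) = real M / real p - real M / real p ^ 2"
        using pp by (simp add: field_simps power2_eq_square)
      ultimately show "real M / real p - real M / real p ^ 2 \<le> g p" by simp
      have "g p \<le> real M * real p / real (p\<^sup>2)" unfolding g_def using ce(2) by (intro divide_right_mono) auto
      also have "\<dots> = real M / real p" using pp by (simp add: power2_eq_square)
      finally show gM: "g p \<le> real M / real p" .
      also have "\<dots> \<le> 1 / 2" using p2 pp by (simp add: field_simps)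
      finally show "g p \<le> 1 / 2" .
      show "g p \<ge> 0" by (simp add: g_def)
    qed
    have hb: "0 \<le> h p" "h p \<le> 2 * real M / real p" if p: "p \<in> Qs" for p
    proof -
      show "0 \<le> h p" unfolding h_def using gb(3,4)[OF p] by (intro divide_nonneg_nonneg) auto
      have "h p \<le> g p / (1 / 2)" unfolding h_def using gb(3,4)[OF p] by (intro divide_left_mono) auto
      also have "\<dots> \<le> 2 * real M / real p" using gb(2)[OF p] by simp
      finally show "h p \<le> 2 * real M / real p" .
    qed
    define Y where "Y = {n\<in>{1..nat \<lfloor>x\<rfloor>}. \<forall>m\<in>{1..M}. bK K (a m * int n + b m) \<noteq> 0}"
    have SY: "S_sum K M a b x = real (card Y)"
    proof -
      have "(\<Prod>m\<in>{1..M}. real (bK K (a m * int n + b m))) = (if \<forall>m\<in>{1..M}. bK K (a m * int n + b m) \<noteq> 0 then 1 else 0)" for n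
      proof (cases "\<forall>m\<in>{1..M}. bK K (a m * int n + b m) \<noteq> 0")
        case True
        then have "real (bK K (a m * int n + b m)) = 1" if "m \<in> {1..M}" for m
          using that by (auto simp: bK_def split: if_splits)
        then show ?thesis using True by simp
      next
        case False
        then show ?thesis by auto
      qed
      then show ?thesis unfolding S_sum_def Y_def by (simp add: sum.If_cases Int_def)
    qed
    \<comment> \<open>The sieve interval begins at 0 and must contain the floor of x, hence the
      added 1.\<close>
    have "real (card Y) * J\<^sup>2 \<le> real (nat \<lfloor>x\<rfloor> + 1) * J + 2 * D ^ 6"
      unfolding J_def h_def g_def
    proof (rule sifted_set_bound)
      show "Y \<subseteq> {..<nat \<lfloor>x\<rfloor> + 1}" by (auto simp: Y_def)
      fix n p assume n: "n \<in> Y" and p: "p \<in> Qs"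
      show "\<not> excluded M a b p n"
      proof
        assume "excluded M a b p n"
        then obtain m where m: "m \<in> {1..M}" "int p dvd a m * int n + b m" "\<not> int (p\<^sup>2) dvd a m * int n + b m"
          by (auto simp: excluded_def)
        moreover have "bK K (a m * int n + b m) \<noteq> 0" using n m(1) by (simp add: Y_def)
        moreover have "p \<in> nonsplit_primes" using p by (simp add: Qs_def)
        ultimately show False using nonsplit_dvd_square by blast
      qed
    qed (use fin D1 Qpr gb(3) excluded_periodic in \<open>auto simp: g_def\<close>)
    \<comment> \<open>The empty set contributes 1 to J. This lets the error 2 D^6 be absorbed into 2
      x J before one factor J is cancelled.\<close>
    moreover have J1: "J \<ge> 1"
    proof -
      have "(\<Sum>T\<in>{{}}. \<Prod>p\<in>T. h p) \<le> J" unfolding J_def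
      proof (rule sum_mono2)
        show "finite {T\<in>Pow Qs. real (\<Prod>T) \<le> D}" using fin by simp
        show "{{}} \<subseteq> {T\<in>Pow Qs. real (\<Prod>T) \<le> D}" using D1 by simp
        show "0 \<le> (\<Prod>p\<in>T. h p)" if "T \<in> {T\<in>Pow Qs. real (\<Prod>T) \<le> D} - {{}}" for T
          using that hb(1) by (intro prod_nonneg) auto
      qed
      then show ?thesis by simp
    qed
    ultimately have YJ: "real (card Y) * J \<le> 4 * x"
    proof -
      assume le: "real (card Y) * J\<^sup>2 \<le> real (nat \<lfloor>x\<rfloor> + 1) * J + 2 * D ^ 6"
      have "real (nat \<lfloor>x\<rfloor> + 1) \<le> 2 * x" using x1 by linarith
      then have "real (nat \<lfloor>x\<rfloor> + 1) * J \<le> 2 * x * J" using J1 by (intro mult_right_mono) auto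
      moreover have "2 * D ^ 6 \<le> 2 * x * J"
      proof -
        have "2 * D ^ 6 \<le> 2 * x" using D6 by simp
        also have "\<dots> \<le> 2 * x * J" using J1 x1 by (simp add: mult_le_cancel_left1)
        finally show ?thesis .
      qed
      ultimately have "real (card Y) * J\<^sup>2 \<le> (4 * x) * J" using le by linarith
      then have "(real (card Y) * J) * J \<le> (4 * x) * J" by (simp add: power2_eq_square mult.assoc)
      then show ?thesis using J1 by simp
    qed
    have JV: "J \<ge> (1 / 2) * exp (real M * V - 2 * real M)"
    proof -
      have "J \<ge> (1 / 2) * (\<Prod>p\<in>Qs. 1 + h p)" unfolding J_def
      proof (rule truncated_sum_ge_half_prod)
        show "prime p \<and> real p \<le> real z" if "p \<in> Qs" for p using that Qpr by (auto simp: Qs_def)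
        show "ln D \<ge> (9 * (2 * real M) + 1) * ln (real z)" using lnD by (simp add: s_def algebra_simps)
      qed (use fin hb z2 D1 in auto)
      moreover have "exp (real M * V - 2 * real M) \<le> (\<Prod>p\<in>Qs. 1 + h p)"
      proof -
        have "real M * V - 2 * real M \<le> (\<Sum>p\<in>Qs. g p)"
        proof -
          have "(\<Sum>p\<in>Qs. 1 / real p ^ 2) \<le> 2"
            using fin Qpr by (intro sum_inverse_squares_subset_le) (auto dest: prime_gt_0_nat)
          then have "real M * (\<Sum>p\<in>Qs. 1 / real p ^ 2) \<le> real M * 2" by (rule mult_left_mono) simp
          then have "real M * V - 2 * real M \<le> real M * V - real M * (\<Sum>p\<in>Qs. 1 / real p ^ 2)" by simp
          also have "\<dots> = (\<Sum>p\<in>Qs. real M / real p - real M / real p ^ 2)"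
            by (simp add: V_def sum_distrib_left sum_subtractf)
          also have "\<dots> \<le> (\<Sum>p\<in>Qs. g p)" by (rule sum_mono[OF gb(1)])
          finally show ?thesis .
        qed
        then have "exp (real M * V - 2 * real M) \<le> exp (\<Sum>p\<in>Qs. g p)" by simp
        also have "\<dots> = (\<Prod>p\<in>Qs. exp (g p))" using fin by (simp add: exp_sum)
        \<comment> \<open>The factor 1 + h equals 1 / (1 - g), which is at least exp g.\<close>
        also have "\<dots> \<le> (\<Prod>p\<in>Qs. 1 + h p)"
        proof (rule prod_mono, safe)
          fix p assume p: "p \<in> Qs"
          have g1: "1 - g p > 0" using gb(3)[OF p] by simp
          have "1 + h p = 1 / (1 - g p)" unfolding h_def using g1 by (simp add: field_simps)
          moreover have "1 - g p \<le> exp (- g p)" using exp_ge_add_one_self[of "- g p"] by simp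
          then have "exp (g p) * (1 - g p) \<le> exp (g p) * exp (- g p)" by (intro mult_left_mono) auto
          then have "exp (g p) * (1 - g p) \<le> 1" by (simp flip: exp_add)
          then have "exp (g p) \<le> 1 / (1 - g p)" using g1 by (simp add: field_simps)
          ultimately show "exp (g p) \<le> 1 + h p" by simp
        qed simp
        finally show ?thesis .
      qed
      ultimately show ?thesis by linarith
    qed
    have "real M * V - 2 * real M \<ge> \<kappa> * ln (ln (real z)) - A0 - real M * e"
    proof -
      have "real M * ((1 - 1 / real dimK) * ln (ln (real z)) - (ln 2 + C1 + Cb) - e) \<le> real M * V"
        using V by (intro mult_left_mono) auto
      then show ?thesis by (simp add: \<kappa>_def A0_def algebra_simps)
    qed
    then have "exp (\<kappa> * ln (ln (real z)) - A0 - real M * e) \<le> exp (real M * V - 2 * real M)" by simp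
    then have JE: "exp (\<kappa> * ln (ln (real z)) - A0 - real M * e) \<le> 2 * J" using JV by linarith
    have "real (card Y) * exp (\<kappa> * ln (ln (real z)) - A0 - real M * e) \<le> real (card Y) * (2 * J)"
      by (rule mult_left_mono[OF JE]) simp
    also have "\<dots> \<le> 8 * x" using YJ by (simp add: mult.commute)
    finally have main: "real (card Y) * exp (\<kappa> * ln (ln (real z)) - A0 - real M * e) \<le> 8 * x" .
    have lz: "exp (\<kappa> * ln (ln (real z))) \<ge> (ln x) powr \<kappa> / (24 * s) powr \<kappa>"
    proof -
      have "(ln x) powr \<kappa> / (24 * s) powr \<kappa> = (ln x / (24 * s)) powr \<kappa>"
        using lnx0 s by (simp add: powr_divide)
      also have "\<dots> \<le> ln (real z) powr \<kappa>" using lnz_ge lnx0 s \<kappa>0 by (intro powr_mono2) auto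
      also have "\<dots> = exp (\<kappa> * ln (ln (real z)))" using lnz0 by (simp add: powr_def)
      finally show ?thesis .
    qed
    have "real (card Y) * ((ln x) powr \<kappa> / (24 * s) powr \<kappa>) \<le> real (card Y) * exp (\<kappa> * ln (ln (real z)))"
      by (rule mult_left_mono[OF lz]) simp
    \<comment> \<open>Puts back the factors exp A0 and exp (M e) removed in the bound
      \<open>main\<close>; the latter is then traded for gamma.\<close>
    also have "\<dots> = (real (card Y) * exp (\<kappa> * ln (ln (real z)) - A0 - real M * e)) * (exp A0 * exp (real M * e))"
      by (simp add: exp_diff)
    also have "\<dots> \<le> (8 * x) * (exp A0 * exp (real M * e))" by (rule mult_right_mono[OF main]) simp
    also have "\<dots> \<le> (8 * x) * (exp A0 * (exp (2 * real M ^ 2) * gamma_fac K M a b))"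
      using expe x1 by (intro mult_left_mono) auto
    finally have fin1: "real (card Y) * ((ln x) powr \<kappa> / (24 * s) powr \<kappa>)
        \<le> (8 * x) * (exp A0 * (exp (2 * real M ^ 2) * gamma_fac K M a b))" .
    have lp: "(ln x) powr \<kappa> > 0" "(24 * s) powr \<kappa> > 0" using lnx0 s by auto
    have "real (card Y) = (real (card Y) * ((ln x) powr \<kappa> / (24 * s) powr \<kappa>)) * ((24 * s) powr \<kappa> / (ln x) powr \<kappa>)"
      using lp by simp
    also have "\<dots> \<le> ((8 * x) * (exp A0 * (exp (2 * real M ^ 2) * gamma_fac K M a b))) * ((24 * s) powr \<kappa> / (ln x) powr \<kappa>)"
      using lp by (intro mult_right_mono[OF fin1]) auto
    also have "\<dots> = C * gamma_fac K M a b * x / ln x powr \<kappa>"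
      by (simp add: C_def exp_add mult_ac)
    finally show "S_sum K M a b x \<le> C * gamma_fac K M a b * x / ln x powr (real M * (1 - 1 / real (field_degree K)))"
      unfolding SY \<kappa>_def field_degree_eq .
  qed
qed

end

theorem mainTheorem1:
  fixes K :: "complex set" and M :: nat
  assumes "number_field K" and "normal_ext K" and "field_degree K \<ge> 2" and "M \<ge> 2"
  shows "\<exists>C > 0. \<exists>x0. \<forall>a b :: nat \<Rightarrow> int.
           (\<forall>m\<in>{1..M}. a m > 0) \<longrightarrow> cross_prod M a b \<noteq> 0 \<longrightarrow>
           (\<forall>x::real. x \<ge> x0 \<longrightarrow>
              S_sum K M a b x \<le> C * gamma_fac K M a b * x
                 / ln x powr (real M * (1 - 1 / real (field_degree K))))"
proof -
  interpret normal_number_field K using assms by unfold_locales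
  show ?thesis using assms by (intro sieve_bound) (simp_all add: field_degree_eq)
qed

end
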